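(* Let $R$ be a commutative unital ring. If $G_i$, for $1\leq i\leq n$, and $H_j$, for $1\leq j\leq m$, are finite groups such that $$\bigoplus_{i=1}^n\frac{\{\bullet\}}{G_i}\cong \bigoplus_{j=1}^m\frac{\{\bullet\}}{H_j}$$ in $\mathscr{C}_R$, then $m=n$ and there exists $\sigma\in S_n$ such that $G_i\cong H_{\sigma(i)}$ as groups for all $i$. In particular, for every object $X/G$ of $\mathscr{C}_R$, the decomposition $\frac{X}{G}\cong\bigoplus_{i=1}^n\frac{\{\bullet\}}{G_i}$, where $X=\bigsqcup_{i=1}^nO_i$ is the decomposition of $X$ into $G$-orbits and $G_i$ is the stabilizer of an element of $O_i$, is unique up to isomorphism on the $G$-stabilizers of $X$.
   Context: $\{\bullet\}$ denotes a one-point set with trivial action, and $\oplus$ the direct sum in the additive category $\mathscr{C}_R$, given on objects by $\frac{X}{G}\oplus\frac{Y}{H}=\frac{(X\times H)\sqcup (G\times Y)}{G\times H}$ with componentwise $(G\times H)$-actions. All groups and sets with group action are finite; actions are left actions unless stated otherwise. For a finite group $\Gamma$ and a finite $\Gamma$-set $Z$, $B(Z)$ denotes the Grothendieck group, for the relations given by disjoint union, of the category of finite $\Gamma$-sets over $Z$ (pairs $(S,\varphi)$ with $\varphi:S\to Z$ a morphism of $\Gamma$-sets; isomorphisms are $\Gamma$-isomorphisms commuting with the maps to $Z$). The category $\mathscr{C}_R$: Objects are pairs $(G,X)$ with $G$ a finite group and $X$ a finite $G$-set, written $\frac{X}{G}$ or $X/G$. Morphisms: given $X/G$ and $Y/H$,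 regard $X$ and $Y$ as $(H\times G)$-sets through the projections ($H$ acts trivially on $X$, $G$ acts trivially on $Y$), and set $\mathrm{Hom}_{\mathscr{C}_R}(X/G,Y/H)=RB^{H,G}(Y,X):=R\otimes_{\mathbb Z}B(Y\times X)$, with $Y\times X$ viewed as an $(H\times G)$-set. It is generated by the classes $\langle U,\beta,\alpha\rangle$ of spans $Y\xleftarrow{\beta}U\xrightarrow{\alpha}X$ of $(H\times G)$-sets. An $(H\times G)$-set is identified with an $(H,G)$-biset through $(h,g)u=hug^{-1}$; so $\beta(hug)=h\beta(u)$ and $\alpha(hug)=g^{-1}\alpha(u)$. Composition: for $\langle U,\beta,\alpha\rangle\in RB^{H,G}(Y,X)$ and $\langle V,\delta,\gamma\rangle\in RB^{K,H}(Z,Y)$, $\langle V,\delta,\gamma\rangle\circ\langle U,\beta,\alpha\rangle=\langle V\hat\times_HU,\hat\delta,\hat\alpha\rangle$, where $V\times_HU$ is the set of orbits $[v,u]$ of $V\times U$ under the right $H$-action $(v,u)\cdot h=(vh,h^{-1}u)$, $V\hat\times_HU=\{[v,u]\in V\times_HU\mid\gamma(v)=\beta(u)\}$ with the natural $(K\times G)$-action, $\hat\delta[v,u]=\delta(v)$, $\hat\alpha[v,u]=\alpha(u)$; this is extended $R$-bilinearly. Identity of $X/G$: $\langle G\times X,\underline1,\overline1\rangle$, with $(a,b)(g,x)=(agb^{-1},ax)$, $\underline1(g,x)=x$, $\overline1(g,x)=g^{-1}x$.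
   Formalization: The commutative unital ring R is taken to be nonzero (0 ≠ 1); over the zero ring all objects of the category are isomorphic and the uniqueness claim is false. *)

theory Defs
  imports
    "HOL-Algebra.Group_Action"
    "HOL-Algebra.Generated_Groups"
    "HOL-Algebra.Product_Groups"
    "HOL-Algebra.Free_Abelian_Groups"
    "HOL-Combinatorics.Permutations"
begin

section \<open>Finite sets with group action\<close>

text \<open>A pair \<open>(G, X)\<close>: these are the objects \<open>X/G\<close> of the category, and also the bases
  \<open>Z\<close> of the Grothendieck groups \<open>B(Z)\<close>.\<close>

record ('g, 'x) gset =
  grp :: "'g monoid"
  pts :: "'x set"
  act :: "'g \<Rightarrow> 'x \<Rightarrow> 'x"

definition finite_gset :: "('g, 'x) gset \<Rightarrow> bool" where
  "finite_gset A \<longleftrightarrow>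
     group (grp A) \<and> finite (carrier (grp A)) \<and> finite (pts A) \<and>
     group_action (grp A) (pts A) (act A)"

text \<open>\<open>Y \<times> X\<close> as an \<open>(H \<times> G)\<close>-set, \<open>H\<close> acting trivially on \<open>X\<close> and \<open>G\<close> trivially on \<open>Y\<close>.\<close>

definition ext_prod :: "('h, 'y) gset \<Rightarrow> ('g, 'x) gset \<Rightarrow> ('h \<times> 'g, 'y \<times> 'x) gset" where
  "ext_prod B A =
     \<lparr>grp = grp B \<times>\<times> grp A,
      pts = pts B \<times> pts A,
      act = (\<lambda>(h, g). \<lambda>(y, x) \<in> pts B \<times> pts A. (act B h y, act A g x))\<rparr>"

definition point :: "'g monoid \<Rightarrow> ('g, unit) gset" where
  "point G = \<lparr>grp = G, pts = {()}, act = (\<lambda>g. \<lambda>x \<in> {()}. x)\<rparr>"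

definition gset_equiv :: "('g, 'x) gset \<Rightarrow> ('h, 'y) gset \<Rightarrow> bool" where
  "gset_equiv A B \<longleftrightarrow>
     (\<exists>\<theta> \<in> iso (grp A) (grp B). \<exists>f. bij_betw f (pts A) (pts B) \<and>
        (\<forall>g \<in> carrier (grp A). \<forall>x \<in> pts A. f (act A g x) = act B (\<theta> g) (f x)))"

definition dir_sum2 :: "('g, 'x) gset \<Rightarrow> ('h, 'y) gset \<Rightarrow> ('g \<times> 'h, 'x \<times> 'h + 'g \<times> 'y) gset" where
  "dir_sum2 A B =
     \<lparr>grp = grp A \<times>\<times> grp B,
      pts = (pts A \<times> carrier (grp B)) <+> (carrier (grp A) \<times> pts B),
      act = (\<lambda>(g, h). \<lambda>z \<in> (pts A \<times> carrier (grp B)) <+> (carrier (grp A) \<times> pts B).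
               case z of Inl (x, h') \<Rightarrow> Inl (act A g x, h \<otimes>\<^bsub>grp B\<^esub> h')
                       | Inr (g', y) \<Rightarrow> Inr (g \<otimes>\<^bsub>grp A\<^esub> g', act B h y))\<rparr>"

text \<open>The iterated direct sum over a finite index set, without bracketing: the point set is
  the disjoint union over \<open>i \<in> I\<close> of \<open>X\<^sub>i \<times> (\<Prod>j \<noteq> i. G\<^sub>j)\<close>, with the group \<open>\<Prod>j. G\<^sub>j\<close> acting
  componentwise. Iterating the binary \<open>dir_sum2\<close> itself would change the type at every step;
  \<open>dir_sum_insert\<close> and \<open>dir_sum_singleton\<close> below say that the two agree.
  The empty sum is the zero object \<open>\<emptyset>/1\<close>.\<close>

definition dir_sum_pts :: "'i set \<Rightarrow> ('i \<Rightarrow> ('g, 'x) gset) \<Rightarrow> ('i \<times> 'x \<times> ('i \<Rightarrow> 'g)) set" where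
  "dir_sum_pts I A = (SIGMA i:I. pts (A i) \<times> (\<Pi>\<^sub>E j \<in> I - {i}. carrier (grp (A j))))"

definition dir_sum :: "'i set \<Rightarrow> ('i \<Rightarrow> ('g, 'x) gset) \<Rightarrow> ('i \<Rightarrow> 'g, 'i \<times> 'x \<times> ('i \<Rightarrow> 'g)) gset" where
  "dir_sum I A =
     \<lparr>grp = product_group I (\<lambda>i. grp (A i)),
      pts = dir_sum_pts I A,
      act = (\<lambda>g. \<lambda>(i, x, f) \<in> dir_sum_pts I A.
               (i, act (A i) (g i) x, \<lambda>j \<in> I - {i}. g j \<otimes>\<^bsub>grp (A j)\<^esub> f j))\<rparr>"


section \<open>Sets over a base and their Grothendieck group\<close>

record ('g, 's, 'z) over =
  tot :: "'s set"
  oact :: "'g \<Rightarrow> 's \<Rightarrow> 's"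
  str :: "'s \<Rightarrow> 'z"

definition over_base :: "('g, 'z) gset \<Rightarrow> ('g, 's, 'z) over \<Rightarrow> bool" where
  "over_base Z S \<longleftrightarrow>
     finite (tot S) \<and> group_action (grp Z) (tot S) (oact S) \<and>
     str S \<in> tot S \<rightarrow> pts Z \<and>
     (\<forall>g \<in> carrier (grp Z). \<forall>s \<in> tot S. str S (oact S g s) = act Z g (str S s))"

definition over_iso :: "('g, 'z) gset \<Rightarrow> ('g, 's, 'z) over \<Rightarrow> ('g, 't, 'z) over \<Rightarrow> bool" where
  "over_iso Z S T \<longleftrightarrow>
     (\<exists>f. bij_betw f (tot S) (tot T) \<and>
        (\<forall>g \<in> carrier (grp Z). \<forall>s \<in> tot S. f (oact S g s) = oact T g (f s)) \<and>
        (\<forall>s \<in> tot S. str T (f s) = str S s))"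

definition over_sum :: "('g, 's, 'z) over \<Rightarrow> ('g, 't, 'z) over \<Rightarrow> ('g, 's + 't, 'z) over" where
  "over_sum S T =
     \<lparr>tot = tot S <+> tot T,
      oact = (\<lambda>g. \<lambda>u \<in> tot S <+> tot T. map_sum (oact S g) (oact T g) u),
      str = case_sum (str S) (str T)\<rparr>"

text \<open>The sets over \<open>Z\<close> with underlying set in \<^typ>\<open>nat\<close> represent all isomorphism
  classes. \<open>B(Z)\<close> is the free abelian group on them modulo \<open>[S] = [T]\<close> for \<open>S \<cong> T\<close> and
  \<open>[W] = [S] + [T]\<close> for \<open>W \<cong> S \<squnion> T\<close>.\<close>

type_synonym ('g, 'z) fsum = "('g, nat, 'z) over \<Rightarrow>\<^sub>0 int"

definition burnside_free :: "('g, 'z) gset \<Rightarrow> ('g, 'z) fsum monoid" where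
  "burnside_free Z = free_Abelian_group {S. over_base Z S}"

definition burnside_rel :: "('g, 'z) gset \<Rightarrow> ('g, 'z) fsum set" where
  "burnside_rel Z = generate (burnside_free Z)
     ({frag_of S - frag_of T | S T. over_base Z S \<and> over_base Z T \<and> over_iso Z S T} \<union>
      {frag_of W - frag_of S - frag_of T | W S T.
         over_base Z W \<and> over_base Z S \<and> over_base Z T \<and> over_iso Z W (over_sum S T)})"

definition burnside :: "('g, 'z) gset \<Rightarrow> ('g, 'z) fsum set monoid" where
  "burnside Z = burnside_free Z Mod burnside_rel Z"

definition nat_copy :: "('g, 'z) gset \<Rightarrow> ('g, 's, 'z) over \<Rightarrow> ('g, nat, 'z) over" where
  "nat_copy Z S = (SOME T. over_base Z T \<and> over_iso Z S T)"

definition burnside_class :: "('g, 'z) gset \<Rightarrow> ('g, 's, 'z) over \<Rightarrow> ('g, 'z) fsum set" where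
  "burnside_class Z S = burnside_rel Z #>\<^bsub>burnside_free Z\<^esub> frag_of (nat_copy Z S)"


section \<open>Extension of scalars\<close>

text \<open>\<open>R \<otimes>\<^sub>\<int> M\<close> for an abelian group \<open>M\<close> (written multiplicatively, as in \<open>HOL-Algebra\<close>): the
  free abelian group on \<open>R \<times> M\<close> modulo biadditivity. The ring \<open>R\<close> is the type \<open>'r\<close>, of
  class \<^class>\<open>comm_ring_1\<close>; in particular \<open>0 \<noteq> 1\<close> in \<open>R\<close>.\<close>

type_synonym ('r, 'm) tens = "('r \<times> 'm) \<Rightarrow>\<^sub>0 int"

definition tensor_free :: "'m monoid \<Rightarrow> ('r::comm_ring_1, 'm) tens monoid" where
  "tensor_free M = free_Abelian_group (UNIV \<times> carrier M)"

definition tensor_rel :: "'m monoid \<Rightarrow> ('r::comm_ring_1, 'm) tens set" where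
  "tensor_rel M = generate (tensor_free M)
     ({frag_of (r + s, a) - frag_of (r, a) - frag_of (s, a) | r s a. a \<in> carrier M} \<union>
      {frag_of (r, a \<otimes>\<^bsub>M\<^esub> b) - frag_of (r, a) - frag_of (r, b) | r a b.
         a \<in> carrier M \<and> b \<in> carrier M})"

definition tensor :: "'m monoid \<Rightarrow> ('r::comm_ring_1, 'm) tens set monoid" where
  "tensor M = tensor_free M Mod tensor_rel M"

definition pure_tensor :: "'m monoid \<Rightarrow> 'r::comm_ring_1 \<Rightarrow> 'm \<Rightarrow> ('r, 'm) tens set" where
  "pure_tensor M r a = tensor_rel M #>\<^bsub>tensor_free M\<^esub> frag_of (r, a)"


section \<open>The category\<close>

text \<open>A span \<open>Y \<leftarrow> U \<rightarrow> X\<close> of \<open>(H \<times> G)\<close>-sets is a set \<open>U\<close> over \<open>Y \<times> X\<close>, its structure map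
  being \<open>u \<mapsto> (\<beta> u, \<alpha> u)\<close>.\<close>

type_synonym ('h, 'y, 'g, 'x, 'u) span = "('h \<times> 'g, 'u, 'y \<times> 'x) over"

type_synonym ('r, 'h, 'y, 'g, 'x) morph = "('r, ('h \<times> 'g, 'y \<times> 'x) fsum set) tens set"

definition Hom_C ::
  "('g, 'x) gset \<Rightarrow> ('h, 'y) gset \<Rightarrow> ('r::comm_ring_1, 'h, 'y, 'g, 'x) morph set" where
  "Hom_C A B = carrier (tensor (burnside (ext_prod B A)))"

text \<open>The biset actions \<open>h u = (h, 1) u\<close> and \<open>u g = (1, g\<^sup>-\<^sup>1) u\<close>.\<close>

definition lact ::
  "('h, 'y) gset \<Rightarrow> ('g, 'x) gset \<Rightarrow> ('h, 'y, 'g, 'x, 'u) span \<Rightarrow> 'h \<Rightarrow> 'u \<Rightarrow> 'u" where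
  "lact B A U h u = oact U (h, \<one>\<^bsub>grp A\<^esub>) u"

definition ract ::
  "('h, 'y) gset \<Rightarrow> ('g, 'x) gset \<Rightarrow> ('h, 'y, 'g, 'x, 'u) span \<Rightarrow> 'u \<Rightarrow> 'g \<Rightarrow> 'u" where
  "ract B A U u g = oact U (\<one>\<^bsub>grp B\<^esub>, inv\<^bsub>grp A\<^esub> g) u"

text \<open>For \<open>A = X/G\<close>, \<open>B = Y/H\<close>, \<open>C = Z/K\<close>: the orbit \<open>[v, u]\<close> of the right \<open>H\<close>-action
  \<open>(v, u) \<cdot> h = (v h, h\<^sup>-\<^sup>1 u)\<close>.\<close>

definition bal_orbit ::
  "('k, 'z) gset \<Rightarrow> ('h, 'y) gset \<Rightarrow> ('g, 'x) gset \<Rightarrow>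
   ('k, 'z, 'h, 'y, 'v) span \<Rightarrow> ('h, 'y, 'g, 'x, 'u) span \<Rightarrow> 'v \<Rightarrow> 'u \<Rightarrow> ('v \<times> 'u) set" where
  "bal_orbit C B A V U v u =
     {(ract C B V v h, lact B A U (inv\<^bsub>grp B\<^esub> h) u) | h. h \<in> carrier (grp B)}"

definition span_comp_tot ::
  "('k, 'z) gset \<Rightarrow> ('h, 'y) gset \<Rightarrow> ('g, 'x) gset \<Rightarrow>
   ('k, 'z, 'h, 'y, 'v) span \<Rightarrow> ('h, 'y, 'g, 'x, 'u) span \<Rightarrow> ('v \<times> 'u) set set" where
  "span_comp_tot C B A V U =
     {bal_orbit C B A V U v u | v u. v \<in> tot V \<and> u \<in> tot U \<and> snd (str V v) = fst (str U u)}"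

text \<open>The structure map sends \<open>[v, u]\<close> to \<open>(\<delta> v, \<alpha> u)\<close>, and \<open>(k, g) [v, u] = [k v, u g\<^sup>-\<^sup>1]\<close>;
  both are computed on the whole orbit.\<close>

definition span_comp ::
  "('k, 'z) gset \<Rightarrow> ('h, 'y) gset \<Rightarrow> ('g, 'x) gset \<Rightarrow>
   ('k, 'z, 'h, 'y, 'v) span \<Rightarrow> ('h, 'y, 'g, 'x, 'u) span \<Rightarrow>
   ('k, 'z, 'g, 'x, ('v \<times> 'u) set) span" where
  "span_comp C B A V U =
     \<lparr>tot = span_comp_tot C B A V U,
      oact = (\<lambda>(k, g). \<lambda>w \<in> span_comp_tot C B A V U.
                (\<lambda>(v, u). (lact C B V k v, ract B A U u (inv\<^bsub>grp A\<^esub> g))) ` w),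
      str = (\<lambda>w. the_elem ((\<lambda>(v, u). (fst (str V v), snd (str U u))) ` w))\<rparr>"

text \<open>Biadditive extension to the Grothendieck groups and \<open>R\<close>-bilinear extension to the tensor
  products. An element of a quotient is a coset; the operation is carried out on all pairs of
  representatives, and \<^const>\<open>the_elem\<close> extracts the common coset of the results.\<close>

definition burnside_comp ::
  "('k, 'z) gset \<Rightarrow> ('h, 'y) gset \<Rightarrow> ('g, 'x) gset \<Rightarrow>
   ('k \<times> 'h, 'z \<times> 'y) fsum set \<Rightarrow> ('h \<times> 'g, 'y \<times> 'x) fsum set \<Rightarrow>
   ('k \<times> 'g, 'z \<times> 'x) fsum set" where
  "burnside_comp C B A b a =
     the_elem ((\<lambda>(q, p).
        burnside_rel (ext_prod C A) #>\<^bsub>burnside_free (ext_prod C A)\<^esub>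
          frag_extend (\<lambda>V. frag_extend (\<lambda>U.
             frag_of (nat_copy (ext_prod C A) (span_comp C B A V U))) p) q) ` (b \<times> a))"

definition comp_C ::
  "('k, 'z) gset \<Rightarrow> ('h, 'y) gset \<Rightarrow> ('g, 'x) gset \<Rightarrow>
   ('r::comm_ring_1, 'k, 'z, 'h, 'y) morph \<Rightarrow> ('r, 'h, 'y, 'g, 'x) morph \<Rightarrow>
   ('r, 'k, 'z, 'g, 'x) morph" where
  "comp_C C B A \<psi> \<phi> =
     the_elem ((\<lambda>(q, p).
        tensor_rel (burnside (ext_prod C A)) #>\<^bsub>tensor_free (burnside (ext_prod C A))\<^esub>
          frag_extend (\<lambda>(r, b). frag_extend (\<lambda>(s, a).
             frag_of (r * s, burnside_comp C B A b a)) p) q) ` (\<psi> \<times> \<phi>))"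

definition id_span :: "('g, 'x) gset \<Rightarrow> ('g, 'x, 'g, 'x, 'g \<times> 'x) span" where
  "id_span A =
     \<lparr>tot = carrier (grp A) \<times> pts A,
      oact = (\<lambda>(a, b). \<lambda>(g, x) \<in> carrier (grp A) \<times> pts A.
                (a \<otimes>\<^bsub>grp A\<^esub> g \<otimes>\<^bsub>grp A\<^esub> inv\<^bsub>grp A\<^esub> b, act A a x)),
      str = (\<lambda>(g, x). (x, act A (inv\<^bsub>grp A\<^esub> g) x))\<rparr>"

definition id_C :: "('g, 'x) gset \<Rightarrow> ('r::comm_ring_1, 'g, 'x, 'g, 'x) morph" where
  "id_C A = pure_tensor (burnside (ext_prod A A)) 1 (burnside_class (ext_prod A A) (id_span A))"

definition iso_C :: "'r::comm_ring_1 itself \<Rightarrow> ('g, 'x) gset \<Rightarrow> ('h, 'y) gset \<Rightarrow> bool" where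
  "iso_C _ A B \<longleftrightarrow>
     (\<exists>\<phi> \<in> (Hom_C A B :: ('r, 'h, 'y, 'g, 'x) morph set).
      \<exists>\<psi> \<in> (Hom_C B A :: ('r, 'g, 'x, 'h, 'y) morph set).
        comp_C A B A \<psi> \<phi> = id_C A \<and> comp_C B A B \<phi> \<psi> = id_C B)"


section \<open>The constructions are well formed\<close>

lemma group_actionI:
  assumes G: "group G"
    and ext: "\<And>g. g \<in> carrier G \<Longrightarrow> \<phi> g \<in> extensional E"
    and closed: "\<And>g x. g \<in> carrier G \<Longrightarrow> x \<in> E \<Longrightarrow> \<phi> g x \<in> E"
    and one: "\<And>x. x \<in> E \<Longrightarrow> \<phi> \<one>\<^bsub>G\<^esub> x = x"
    and mult: "\<And>g h x. g \<in> carrier G \<Longrightarrow> h \<in> carrier G \<Longrightarrow> x \<in> E \<Longrightarrow>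
                 \<phi> (g \<otimes>\<^bsub>G\<^esub> h) x = \<phi> g (\<phi> h x)"
  shows "group_action G E \<phi>"
proof -
  interpret group G by (rule G)
  have bij: "\<phi> g \<in> Bij E" if g: "g \<in> carrier G" for g
  proof -
    have "bij_betw (\<phi> g) E E"
    proof (rule bij_betw_byWitness[where f' = "\<phi> (inv\<^bsub>G\<^esub> g)"])
      show "\<forall>a\<in>E. \<phi> (inv\<^bsub>G\<^esub> g) (\<phi> g a) = a"
        using g by (metis G group.l_inv group.inv_closed mult one)
      show "\<forall>a\<in>E. \<phi> g (\<phi> (inv\<^bsub>G\<^esub> g) a) = a"
        using g by (metis G group.r_inv group.inv_closed mult one)
    qed (use g closed in auto)
    then show ?thesis using ext[OF g] by (simp add: Bij_def)
  qed
  show ?thesis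
  proof (intro group_action.intro group_hom.intro group_hom_axioms.intro G group_BijGroup homI)
    fix g h assume gh: "g \<in> carrier G" "h \<in> carrier G"
    have "\<phi> (g \<otimes>\<^bsub>G\<^esub> h) = compose E (\<phi> g) (\<phi> h)"
      by (rule extensionalityI[OF ext compose_extensional]) (use gh mult in \<open>auto simp: compose_def\<close>)
    then show "\<phi> (g \<otimes>\<^bsub>G\<^esub> h) = \<phi> g \<otimes>\<^bsub>BijGroup E\<^esub> \<phi> h"
      using gh bij by (simp add: BijGroup_def)
  qed (use bij in \<open>simp add: BijGroup_def\<close>)
qed

lemma group_actionD:
  assumes "group_action G E \<phi>"
  shows "group G"
    and "\<And>g. g \<in> carrier G \<Longrightarrow> \<phi> g \<in> extensional E"
    and "\<And>g x. g \<in> carrier G \<Longrightarrow> x \<in> E \<Longrightarrow> \<phi> g x \<in> E"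
    and "\<And>x. x \<in> E \<Longrightarrow> \<phi> \<one>\<^bsub>G\<^esub> x = x"
    and "\<And>g h x. g \<in> carrier G \<Longrightarrow> h \<in> carrier G \<Longrightarrow> x \<in> E \<Longrightarrow>
                 \<phi> (g \<otimes>\<^bsub>G\<^esub> h) x = \<phi> g (\<phi> h x)"
proof -
  interpret group_action G E \<phi> by fact
  show "group G" using group_hom by (simp add: group_hom_def)
  show "\<phi> g \<in> extensional E" if "g \<in> carrier G" for g using bij_prop0[OF that] by (simp add: Bij_def)
  show "\<phi> g x \<in> E" if "g \<in> carrier G" "x \<in> E" for g x using element_image that by blast
  show "\<phi> \<one>\<^bsub>G\<^esub> x = x" if "x \<in> E" for x using id_eq_one that by (metis restrict_apply')
  show "\<phi> (g \<otimes>\<^bsub>G\<^esub> h) x = \<phi> g (\<phi> h x)" if "g \<in> carrier G" "h \<in> carrier G" "x \<in> E" for g h x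
    using composition_rule that by blast
qed

lemma finite_gsetD:
  assumes "finite_gset A"
  shows "group (grp A)" "finite (carrier (grp A))" "finite (pts A)" 
    "\<And>g x. g \<in> carrier (grp A) \<Longrightarrow> x \<in> pts A \<Longrightarrow> act A g x \<in> pts A"
    "\<And>x. x \<in> pts A \<Longrightarrow> act A \<one>\<^bsub>grp A\<^esub> x = x"
    "\<And>g h x. g \<in> carrier (grp A) \<Longrightarrow> h \<in> carrier (grp A) \<Longrightarrow> x \<in> pts A \<Longrightarrow>
                 act A (g \<otimes>\<^bsub>grp A\<^esub> h) x = act A g (act A h x)"
  using assms group_actionD[of "grp A" "pts A" "act A"] unfolding finite_gset_def by auto

lemma finite_gset_point: "group G \<Longrightarrow> finite (carrier G) \<Longrightarrow> finite_gset (point G)"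
  unfolding finite_gset_def point_def by (auto intro!: group_actionI)

lemma finite_gset_ext_prod:
  assumes "finite_gset B" "finite_gset A"
  shows "finite_gset (ext_prod B A)"
  using finite_gsetD[OF assms(1)] finite_gsetD[OF assms(2)]
  unfolding finite_gset_def ext_prod_def
  by (auto intro!: group_actionI DirProd_group)

lemma finite_gset_dir_sum:
  assumes "finite I" "\<And>i. i \<in> I \<Longrightarrow> finite_gset (A i)"
  shows "finite_gset (dir_sum I A)"
proof -
  note d = finite_gsetD[OF assms(2)]
  have gp: "group (product_group I (\<lambda>i. grp (A i)))"
    using d(1) by (intro product_group) auto
  have "group_action (grp (dir_sum I A)) (pts (dir_sum I A)) (act (dir_sum I A))"
    unfolding dir_sum_def gset.simps
  proof (rule group_actionI[OF gp], goal_cases)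
    case 1 then show ?case by simp
  next
    case (2 g x) then show ?case using d
      by (auto simp: dir_sum_pts_def PiE_iff intro!: monoid.m_closed[OF group.is_monoid] split: if_splits)
  next
    case (3 x) 
    obtain i y f where x: "x = (i,y,f)" by (cases x) auto
    have i: "i \<in> I" "y \<in> pts (A i)" and f: "f \<in> (\<Pi>\<^sub>E j \<in> I - {i}. carrier (grp (A j)))"
      using 3 by (auto simp: dir_sum_pts_def x)
    have "(\<lambda>j\<in>I - {i}. \<one>\<^bsub>grp (A j)\<^esub> \<otimes>\<^bsub>grp (A j)\<^esub> f j) = f"
      by (rule extensionalityI[where A = "I - {i}"]) (use f d(1) in \<open>auto simp: PiE_iff group.is_monoid monoid.l_one\<close>)
    moreover have "(\<lambda>j\<in>I - {i}. (\<lambda>i\<in>I. \<one>\<^bsub>grp (A i)\<^esub>) j \<otimes>\<^bsub>grp (A j)\<^esub> f j) = (\<lambda>j\<in>I - {i}. \<one>\<^bsub>grp (A j)\<^esub> \<otimes>\<^bsub>grp (A j)\<^esub> f j)"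
      by (rule restrict_ext) simp
    ultimately show ?case using 3 i d(5) by (simp add: x)
  next
    case (4 g h x)
    obtain i y f where x: "x = (i,y,f)" by (cases x) auto
    have i: "i \<in> I" "y \<in> pts (A i)" and f: "f \<in> (\<Pi>\<^sub>E j \<in> I - {i}. carrier (grp (A j)))"
      using 4 by (auto simp: dir_sum_pts_def x)
    have g: "\<And>j. j \<in> I \<Longrightarrow> g j \<in> carrier (grp (A j))" "\<And>j. j \<in> I \<Longrightarrow> h j \<in> carrier (grp (A j))"
      using 4 by auto
    have h: "(i, act (A i) (h i) y, \<lambda>j\<in>I - {i}. h j \<otimes>\<^bsub>grp (A j)\<^esub> f j) \<in> dir_sum_pts I A"
      using i f g d by (auto simp: dir_sum_pts_def PiE_iff group.is_monoid monoid.m_closed)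
    show ?case using 4 h i f g d by (auto simp: x fun_eq_iff PiE_iff group.is_monoid monoid.m_assoc)
  qed
  moreover have "finite (pts (dir_sum I A))"
    unfolding dir_sum_def dir_sum_pts_def using assms(1) d(2,3) by (auto intro!: finite_SigmaI finite_PiE)
  ultimately show ?thesis
    using gp assms(1) d(2) by (auto simp: finite_gset_def dir_sum_def intro!: finite_PiE)
qed

lemma over_base_id_span:
  assumes "finite_gset A"
  shows "over_base (ext_prod A A) (id_span A)"
proof -
  note d = finite_gsetD[OF assms]
  interpret group "grp A" by (rule d)
  have "group_action (grp (ext_prod A A)) (tot (id_span A)) (oact (id_span A))"
    unfolding ext_prod_def id_span_def gset.simps over.simps
    by (rule group_actionI) (use d in \<open>auto intro: DirProd_group simp: m_assoc inv_mult_group\<close>)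
  moreover have "act A (inv\<^bsub>grp A\<^esub> (a \<otimes>\<^bsub>grp A\<^esub> g \<otimes>\<^bsub>grp A\<^esub> inv\<^bsub>grp A\<^esub> b)) (act A a x)
      = act A b (act A (inv\<^bsub>grp A\<^esub> g) x)"
    if "a \<in> carrier (grp A)" "b \<in> carrier (grp A)" "g \<in> carrier (grp A)" "x \<in> pts A" for a b g x
    using that d(6)[symmetric] by (simp add: d(4) inv_mult_group m_assoc)
  ultimately show ?thesis using d unfolding over_base_def by (auto simp: id_span_def ext_prod_def)
qed

lemma over_baseD:
  assumes "over_base (ext_prod B A) U"
  shows "\<And>h g u. h \<in> carrier (grp B) \<Longrightarrow> g \<in> carrier (grp A) \<Longrightarrow> u \<in> tot U \<Longrightarrow> oact U (h, g) u \<in> tot U"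
    and "\<And>u. u \<in> tot U \<Longrightarrow> oact U (\<one>\<^bsub>grp B\<^esub>, \<one>\<^bsub>grp A\<^esub>) u = u"
    and "\<And>h g h' g' u. h \<in> carrier (grp B) \<Longrightarrow> g \<in> carrier (grp A) \<Longrightarrow>
      h' \<in> carrier (grp B) \<Longrightarrow> g' \<in> carrier (grp A) \<Longrightarrow> u \<in> tot U \<Longrightarrow>
      oact U (h, g) (oact U (h', g') u) = oact U (h \<otimes>\<^bsub>grp B\<^esub> h', g \<otimes>\<^bsub>grp A\<^esub> g') u"
    and "\<And>u. u \<in> tot U \<Longrightarrow> fst (str U u) \<in> pts B"
    and "\<And>u. u \<in> tot U \<Longrightarrow> snd (str U u) \<in> pts A"
    and "\<And>h g u. h \<in> carrier (grp B) \<Longrightarrow> g \<in> carrier (grp A) \<Longrightarrow> u \<in> tot U \<Longrightarrow>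
      fst (str U (oact U (h, g) u)) = act B h (fst (str U u))"
    and "\<And>h g u. h \<in> carrier (grp B) \<Longrightarrow> g \<in> carrier (grp A) \<Longrightarrow> u \<in> tot U \<Longrightarrow>
      snd (str U (oact U (h, g) u)) = act A g (snd (str U u))"
    and "finite (tot U)"
proof -
  have *: "group_action (grp B \<times>\<times> grp A) (tot U) (oact U)"
    and p: "str U \<in> tot U \<rightarrow> pts B \<times> pts A"
    and eq: "\<And>h g u. h \<in> carrier (grp B) \<Longrightarrow> g \<in> carrier (grp A) \<Longrightarrow> u \<in> tot U \<Longrightarrow>
      str U (oact U (h, g) u) = (act B h (fst (str U u)), act A g (snd (str U u)))"
    using assms by (auto simp: over_base_def ext_prod_def Pi_def split: prod.splits)
  note ** = group_actionD[OF *]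
  show "finite (tot U)" using assms by (simp add: over_base_def)
  show "oact U (h, g) u \<in> tot U" if "h \<in> carrier (grp B)" "g \<in> carrier (grp A)" "u \<in> tot U" for h g u
    using **(3) that by auto
  show "oact U (\<one>\<^bsub>grp B\<^esub>, \<one>\<^bsub>grp A\<^esub>) u = u" if "u \<in> tot U" for u using **(4)[OF that] by simp
  show "oact U (h, g) (oact U (h', g') u) = oact U (h \<otimes>\<^bsub>grp B\<^esub> h', g \<otimes>\<^bsub>grp A\<^esub> g') u"
    if "h \<in> carrier (grp B)" "g \<in> carrier (grp A)" "h' \<in> carrier (grp B)" "g' \<in> carrier (grp A)" "u \<in> tot U"
    for h g h' g' u using **(5)[of "(h,g)" "(h',g')" u] that by simp
  show "fst (str U u) \<in> pts B" "snd (str U u) \<in> pts A" if "u \<in> tot U" for u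
    using p that by - (simp_all add: Pi_iff mem_Times_iff)
  show "fst (str U (oact U (h, g) u)) = act B h (fst (str U u))"
       "snd (str U (oact U (h, g) u)) = act A g (snd (str U u))"
    if "h \<in> carrier (grp B)" "g \<in> carrier (grp A)" "u \<in> tot U" for h g u
    using eq[OF that] by simp_all
qed

lemma over_base_span_comp:
  assumes A: "finite_gset A" and B: "finite_gset B" and C: "finite_gset C"
    and V: "over_base (ext_prod C B) V" and U: "over_base (ext_prod B A) U"
  shows "over_base (ext_prod C A) (span_comp C B A V U)"
    and "\<And>v u. v \<in> tot V \<Longrightarrow> u \<in> tot U \<Longrightarrow>
      str (span_comp C B A V U) (bal_orbit C B A V U v u) = (fst (str V v), snd (str U u))"
    and "\<And>k g v u. k \<in> carrier (grp C) \<Longrightarrow> g \<in> carrier (grp A) \<Longrightarrow> v \<in> tot V \<Longrightarrow> u \<in> tot U \<Longrightarrow>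
      snd (str V v) = fst (str U u) \<Longrightarrow>
      oact (span_comp C B A V U) (k, g) (bal_orbit C B A V U v u)
        = bal_orbit C B A V U (lact C B V k v) (oact U (\<one>\<^bsub>grp B\<^esub>, g) u)"
proof -
  note a = finite_gsetD[OF A] and b = finite_gsetD[OF B] and c = finite_gsetD[OF C]
  note vd = over_baseD[OF V] and ud = over_baseD[OF U]
  interpret A: group "grp A" by (rule a)
  interpret B: group "grp B" by (rule b)
  interpret C: group "grp C" by (rule c)
  let ?o = "bal_orbit C B A V U"
  let ?T = "span_comp_tot C B A V U"
  have str: "str (span_comp C B A V U) (?o v u) = (fst (str V v), snd (str U u))"
    if "v \<in> tot V" "u \<in> tot U" for v u
  proof -
    have "(\<lambda>(v, u). (fst (str V v), snd (str U u))) ` ?o v u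
        = (\<lambda>h. (fst (str V (ract C B V v h)), snd (str U (lact B A U (inv\<^bsub>grp B\<^esub> h) u)))) ` carrier (grp B)"
      unfolding bal_orbit_def by auto
    also have "\<dots> = (\<lambda>h. (fst (str V v), snd (str U u))) ` carrier (grp B)"
      using that by (intro image_cong) (auto simp: lact_def ract_def vd ud a c)
    also have "\<dots> = {(fst (str V v), snd (str U u))}" using B.one_closed by blast
    finally have "(\<lambda>(v, u). (fst (str V v), snd (str U u))) ` ?o v u = {(fst (str V v), snd (str U u))}" .
    then show ?thesis by (simp add: span_comp_def)
  qed
  show "\<And>v u. v \<in> tot V \<Longrightarrow> u \<in> tot U \<Longrightarrow>
      str (span_comp C B A V U) (bal_orbit C B A V U v u) = (fst (str V v), snd (str U u))" by (rule str)
  have memT: "?o v u \<in> ?T" if "v \<in> tot V" "u \<in> tot U" "snd (str V v) = fst (str U u)" for v u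
    using that by (auto simp: span_comp_tot_def)
  have act: "oact (span_comp C B A V U) (k, g) (?o v u) = ?o (lact C B V k v) (oact U (\<one>\<^bsub>grp B\<^esub>, g) u)"
    if k: "k \<in> carrier (grp C)" "g \<in> carrier (grp A)" "v \<in> tot V" "u \<in> tot U"
      "snd (str V v) = fst (str U u)" for k g v u
  proof -
    have "oact (span_comp C B A V U) (k, g) (?o v u)
        = (\<lambda>(v, u). (lact C B V k v, ract B A U u (inv\<^bsub>grp A\<^esub> g))) ` ?o v u"
      using memT[OF k(3-5)] by (simp add: span_comp_def)
    also have "\<dots> = (\<lambda>h. (lact C B V k (ract C B V v h), ract B A U (lact B A U (inv\<^bsub>grp B\<^esub> h) u) (inv\<^bsub>grp A\<^esub> g))) ` carrier (grp B)"
      unfolding bal_orbit_def by auto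
    also have "\<dots> = (\<lambda>h. (ract C B V (lact C B V k v) h, lact B A U (inv\<^bsub>grp B\<^esub> h) (oact U (\<one>\<^bsub>grp B\<^esub>, g) u))) ` carrier (grp B)"
      using k by (intro image_cong) (auto simp: lact_def ract_def vd ud)
    finally show ?thesis unfolding bal_orbit_def by auto
  qed
  show "\<And>k g v u. k \<in> carrier (grp C) \<Longrightarrow> g \<in> carrier (grp A) \<Longrightarrow> v \<in> tot V \<Longrightarrow> u \<in> tot U \<Longrightarrow>
      snd (str V v) = fst (str U u) \<Longrightarrow>
      oact (span_comp C B A V U) (k, g) (bal_orbit C B A V U v u)
        = bal_orbit C B A V U (lact C B V k v) (oact U (\<one>\<^bsub>grp B\<^esub>, g) u)" by (rule act)
  have T: "\<exists>v u. w = ?o v u \<and> v \<in> tot V \<and> u \<in> tot U \<and> snd (str V v) = fst (str U u)" if "w \<in> ?T" for w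
    using that by (auto simp: span_comp_tot_def)
  have tot: "tot (span_comp C B A V U) = ?T" by (simp add: span_comp_def)
  have fib: "snd (str V (lact C B V k v)) = fst (str U (oact U (\<one>\<^bsub>grp B\<^esub>, g) u))"
      "lact C B V k v \<in> tot V" "oact U (\<one>\<^bsub>grp B\<^esub>, g) u \<in> tot U"
    if "k \<in> carrier (grp C)" "g \<in> carrier (grp A)" "v \<in> tot V" "u \<in> tot U"
      "snd (str V v) = fst (str U u)" for k g v u
    using that by (auto simp: lact_def vd ud b)
  have ga: "group_action (grp C \<times>\<times> grp A) ?T (oact (span_comp C B A V U))"
  proof (rule group_actionI, goal_cases)
    case 1 then show ?case by (intro DirProd_group a c)
  next
    case (2 g) then show ?case by (auto simp: span_comp_def)
  next
    case (3 g x) then show ?case using T[OF 3(2)] act fib memT by (auto) 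
  next
    case (4 x) then show ?case using T[OF 4] act by (auto simp: lact_def vd ud)
  next
    case (5 g h w)
    obtain k1 g1 k2 g2 where gh: "g = (k1, g1)" "h = (k2, g2)" by fastforce
    have mem: "k1 \<in> carrier (grp C)" "g1 \<in> carrier (grp A)" "k2 \<in> carrier (grp C)" "g2 \<in> carrier (grp A)"
      using 5 gh by auto
    obtain v u where w: "w = ?o v u" "v \<in> tot V" "u \<in> tot U" "snd (str V v) = fst (str U u)"
      using T[OF 5(3)] by blast
    have "oact (span_comp C B A V U) g (oact (span_comp C B A V U) h w)
        = ?o (lact C B V k1 (lact C B V k2 v)) (oact U (\<one>\<^bsub>grp B\<^esub>, g1) (oact U (\<one>\<^bsub>grp B\<^esub>, g2) u))"
      unfolding gh w(1) act[OF mem(3,4) w(2-4)]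
      by (rule act[OF mem(1,2) fib(2,3)[OF mem(3,4) w(2-4)] fib(1)[OF mem(3,4) w(2-4)]])
    also have "\<dots> = oact (span_comp C B A V U) (k1 \<otimes>\<^bsub>grp C\<^esub> k2, g1 \<otimes>\<^bsub>grp A\<^esub> g2) w"
      unfolding w(1) using act[of "k1 \<otimes>\<^bsub>grp C\<^esub> k2" "g1 \<otimes>\<^bsub>grp A\<^esub> g2" v u] mem w
      by (simp add: lact_def vd ud)
    finally show ?case by (simp add: gh)
  qed
  have "finite ?T"
  proof (rule finite_subset)
    show "?T \<subseteq> (\<lambda>(v, u). ?o v u) ` (tot V \<times> tot U)" by (auto simp: span_comp_tot_def)
  qed (use vd ud in auto)
  moreover have "str (span_comp C B A V U) w \<in> pts C \<times> pts A" if "w \<in> ?T" for w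
    using T[OF that] str vd ud by auto
  moreover have "str (span_comp C B A V U) (oact (span_comp C B A V U) (k, g) w)
      = act (ext_prod C A) (k, g) (str (span_comp C B A V U) w)"
    if "w \<in> ?T" "k \<in> carrier (grp C)" "g \<in> carrier (grp A)" for w k g
    using T[OF that(1)] that by (auto simp: act str fib ext_prod_def vd ud) (auto simp: lact_def vd)
  ultimately show "over_base (ext_prod C A) (span_comp C B A V U)"
    using ga by (auto simp: over_base_def tot) (auto simp: ext_prod_def)
qed

lemma nat_copy:
  assumes S: "over_base Z S"
  shows "over_base Z (nat_copy Z S) \<and> over_iso Z S (nat_copy Z S)"
proof -
  have fin: "finite (tot S)" and ga: "group_action (grp Z) (tot S) (oact S)"
    and p: "str S \<in> tot S \<rightarrow> pts Z"
    and eq: "\<And>g s. g \<in> carrier (grp Z) \<Longrightarrow> s \<in> tot S \<Longrightarrow> str S (oact S g s) = act Z g (str S s)"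
    using S by (auto simp: over_base_def)
  note gd = group_actionD[OF ga]
  obtain f :: "_ \<Rightarrow> nat" where f: "bij_betw f (tot S) {0..<card (tot S)}"
    using ex_bij_betw_finite_nat[OF fin] by blast
  define N where "N = {0..<card (tot S)}"
  define f' where "f' = inv_into (tot S) f"
  have ff: "\<And>s. s \<in> tot S \<Longrightarrow> f' (f s) = s" "\<And>s. s \<in> tot S \<Longrightarrow> f s \<in> N"
     "\<And>n. n \<in> N \<Longrightarrow> f (f' n) = n" "\<And>n. n \<in> N \<Longrightarrow> f' n \<in> tot S"
    using f by (auto simp: f'_def N_def bij_betw_inv_into_left bij_betw_inv_into_right bij_betwE
        bij_betwE[OF bij_betw_inv_into[OF f]] simp del: atLeastLessThan_iff)
  define T where "T = \<lparr>tot = N, oact = (\<lambda>g. \<lambda>n \<in> N. f (oact S g (f' n))), str = str S \<circ> f'\<rparr>"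
  have "group_action (grp Z) N (\<lambda>g. \<lambda>n \<in> N. f (oact S g (f' n)))"
    by (rule group_actionI) (auto simp: gd ff)
  then have "over_base Z T"
    using p by (auto simp: over_base_def T_def N_def[symmetric] ff eq gd) (simp add: N_def)
  moreover have "over_iso Z S T"
    unfolding over_iso_def T_def using f by (intro exI[of _ f]) (auto simp: ff N_def[symmetric])
  ultimately show ?thesis unfolding nat_copy_def by (rule_tac someI[of _ T]) auto
qed

lemma dir_sum_insert:
  fixes A :: "'a \<Rightarrow> ('b, 'c) gset"
  assumes I: "finite I" "k \<notin> I"
  shows "gset_equiv (dir_sum (insert k I) A) (dir_sum2 (A k) (dir_sum I A))"
proof -
  let ?L = "dir_sum (insert k I) A" and ?R = "dir_sum2 (A k) (dir_sum I A)"
  define \<theta> where "\<theta> = (\<lambda>g :: 'a \<Rightarrow> 'b. (g k, restrict g I))"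
  define \<theta>' where "\<theta>' = (\<lambda>(a :: 'b, g :: 'a \<Rightarrow> 'b). (\<lambda>i \<in> insert k I. if i = k then a else g i))"
  define f where "f = (\<lambda>(i, x :: 'c, h :: 'a \<Rightarrow> 'b). if i = k then Inl (x, restrict h I) else Inr (h k, i, x, restrict h (I - {i})))"
  define f' where "f' = (\<lambda>z. case z of Inl (x :: 'c, h) \<Rightarrow> (k, x, h)
      | Inr (a :: 'b, i :: 'a, x, h) \<Rightarrow> (i, x, (\<lambda>j \<in> insert k I - {i}. if j = k then a else h j)))"
  have "\<theta> \<in> hom (grp ?L) (grp ?R)"
    by (rule homI) (auto simp: dir_sum_def dir_sum2_def \<theta>_def PiE_iff fun_eq_iff product_group_def)
  moreover have "bij_betw \<theta> (carrier (grp ?L)) (carrier (grp ?R))"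
    by (rule bij_betw_byWitness[where f' = \<theta>'])
      (use I in \<open>auto simp: dir_sum_def dir_sum2_def \<theta>_def \<theta>'_def PiE_iff fun_eq_iff extensional_def split: if_splits\<close>)
  ultimately have 1: "\<theta> \<in> iso (grp ?L) (grp ?R)" by (simp add: iso_def)
  have L: "pts ?L = dir_sum_pts (insert k I) A"
    and R: "pts ?R = (pts (A k) \<times> (\<Pi>\<^sub>E i\<in>I. carrier (grp (A i)))) <+> (carrier (grp (A k)) \<times> dir_sum_pts I A)"
    by (simp_all add: dir_sum_def dir_sum2_def)
  have kI: "insert k I - {k} = I" "\<And>i. i \<in> I \<Longrightarrow> i \<noteq> k" "\<And>i. i \<in> I \<Longrightarrow> (k = i) = False" using I by auto
  have 2: "bij_betw f (pts ?L) (pts ?R)"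
    unfolding L R
  proof (rule bij_betw_byWitness[where f' = f'])
    show "\<forall>a\<in>dir_sum_pts (insert k I) A. f' (f a) = a"
      using I(2) kI
      by (auto simp: dir_sum_pts_def f_def f'_def PiE_iff extensional_def fun_eq_iff)
    show "\<forall>a\<in>(pts (A k) \<times> (\<Pi>\<^sub>E i\<in>I. carrier (grp (A i)))) <+> (carrier (grp (A k)) \<times> dir_sum_pts I A).
        f (f' a) = a"
      using I(2) kI by (auto simp: dir_sum_pts_def f_def f'_def PiE_iff extensional_def fun_eq_iff)
    show "f ` dir_sum_pts (insert k I) A \<subseteq>
        (pts (A k) \<times> (\<Pi>\<^sub>E i\<in>I. carrier (grp (A i)))) <+> (carrier (grp (A k)) \<times> dir_sum_pts I A)"
      using I(2) kI by (auto simp: dir_sum_pts_def f_def PiE_iff extensional_def split: if_splits)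
    show "f' ` ((pts (A k) \<times> (\<Pi>\<^sub>E i\<in>I. carrier (grp (A i)))) <+> (carrier (grp (A k)) \<times> dir_sum_pts I A))
      \<subseteq> dir_sum_pts (insert k I) A"
      using I(2) kI by (auto simp: dir_sum_pts_def f'_def PiE_iff extensional_def split: if_splits)
  qed
  have 3: "f (act ?L g x) = act ?R (\<theta> g) (f x)" if g: "g \<in> carrier (grp ?L)" and x: "x \<in> pts ?L" for g x
  proof -
    have fx: "f x \<in> pts ?R" using 2 x by (auto simp: bij_betw_def)
    obtain i y h where xi: "x = (i, y, h)" by (cases x) auto
    have i: "i \<in> insert k I" using x by (auto simp: L xi dir_sum_pts_def)
    have gl: "act ?L g x = (i, act (A i) (g i) y, \<lambda>j \<in> insert k I - {i}. g j \<otimes>\<^bsub>grp (A j)\<^esub> h j)"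
      using x by (simp add: xi L) (simp add: dir_sum_def)
    show ?thesis
    proof (cases "i = k")
      case True
      have "act ?R (\<theta> g) (f x) = Inl (act (A k) (g k) y, \<lambda>j\<in>I. g j \<otimes>\<^bsub>grp (A j)\<^esub> h j)"
        using fx unfolding R
        by (simp add: xi f_def True dir_sum2_def \<theta>_def)
          (auto simp: dir_sum_def product_group_def intro!: restrict_ext)
      then show ?thesis unfolding gl by (simp add: f_def True kI fun_eq_iff)
    next
      case False
      have iI: "i \<in> I" using i False by simp
      have ne: "k \<noteq> i" using False by simp
      have "act ?R (\<theta> g) (f x) = Inr (g k \<otimes>\<^bsub>grp (A k)\<^esub> h k, act (dir_sum I A) (restrict g I) (i, y, restrict h (I - {i})))"
        using fx unfolding R
        by (simp add: xi f_def False dir_sum2_def \<theta>_def) (simp add: dir_sum_def)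
      also have "act (dir_sum I A) (restrict g I) (i, y, restrict h (I - {i}))
          = (i, act (A i) (g i) y, \<lambda>j\<in>I - {i}. g j \<otimes>\<^bsub>grp (A j)\<^esub> h j)"
        using fx iI unfolding R
        by (simp add: xi f_def False dir_sum_def) (auto intro!: restrict_ext split: if_splits)
      finally show ?thesis unfolding gl using False ne iI I(2) by (auto simp: f_def fun_eq_iff)
    qed
  qed
  show ?thesis unfolding gset_equiv_def using 1 2 3 by blast
qed

lemma dir_sum_singleton: "gset_equiv (dir_sum {k} A) (A k)"
proof -
  have "(\<lambda>g. g k) \<in> iso (grp (dir_sum {k} A)) (grp (A k))"
    unfolding iso_def
    by (auto simp: dir_sum_def product_group_def intro!: homI bij_betw_byWitness[where f' = "\<lambda>a. \<lambda>i \<in> {k}. a"] simp: PiE_iff extensional_def split: if_splits)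
  moreover have "bij_betw (\<lambda>(i, x, f). x) (pts (dir_sum {k} A)) (pts (A k))"
    by (rule bij_betw_byWitness[where f' = "\<lambda>x. (k, x, \<lambda>_. undefined)"])
      (auto simp: dir_sum_def dir_sum_pts_def)
  ultimately show ?thesis
    unfolding gset_equiv_def
    by (intro bexI exI conjI) (auto simp: dir_sum_def dir_sum_pts_def)
qed

end

theory Submission
  imports Defs "Jordan_Normal_Form.Determinant"
begin

text \<open>Fix a finite group \<open>L\<close>. In \<open>Hom(\<bullet>/L, X/G)\<close> the spans whose point stabilizers in \<open>G \<times> L\<close> are not
  graphs of surjections from a subgroup of \<open>G\<close> onto \<open>L\<close> form a subfunctor of \<open>X/G\<close>: if a point
  \<open>[v, u]\<close> of a composite \<open>V \<circ> U\<close> has such a graph as stabilizer, then so does \<open>u\<close>. The quotient functor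
  sends \<open>X/G\<close> to the free module on the \<open>G \<times> L\<close>-classes of pairs (point, graph in its stabilizer),
  and a span acts by the integer matrix counting orbits of each class. An isomorphism in the category
  gives mutually inverse matrices over \<open>R\<close>, so the number of classes is an invariant of \<open>X/G\<close>. It is
  additive in the orbits of \<open>X\<close>, and for \<open>\<bullet>/G\<close> it vanishes unless \<open>L\<close> is a quotient of a subgroup
  of \<open>G\<close> and is positive for \<open>L \<cong> G\<close>. Hence a group of maximal order occurring on one side occurs on both, and
  it can be cancelled.

  For the existence part, a span between \<open>X/G\<close> and \<open>Y/H\<close> on which \<open>G\<close> and \<open>H\<close> act freely and whose
  legs are the quotient maps by \<open>H\<close> and \<open>G\<close> is inverted by the opposite span.\<close>

section \<open>Spans and their composition\<close>

text \<open>What survives is that mutually inverse rectangular matrices over a nonzero commutative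
  ring are square. The difficulty is to find a functor to free modules that tells the groups apart.
  The functor Hom from \<open>point L\<close> is too large for this, since it is nonzero on
  \<open>point G\<close> even when L and G are unrelated. Dividing out the spans whose stabilizers
  are not graphs leaves only what sees L as a subquotient of G, and then a comparison of orders is
  enough. The test object stays on the source side throughout, so every matrix records composition
  from the left, and functoriality comes down to associativity of span composition. Orbit counts are
  additive under disjoint union, which is why they pass to Grothendieck groups and, multiplied into
  R, to tensor products.\<close>

lemma over_iso_refl: "over_iso Z S S"
  unfolding over_iso_def by (intro exI[of _ id]) auto

lemma over_iso_trans:
  assumes "over_iso Z S T" "over_iso Z T U"
  shows "over_iso Z S U"
proof -
  obtain f g where f: "bij_betw f (tot S) (tot T)"
      "\<And>a s. a \<in> carrier (grp Z) \<Longrightarrow> s \<in> tot S \<Longrightarrow> f (oact S a s) = oact T a (f s)"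
      "\<And>s. s \<in> tot S \<Longrightarrow> str T (f s) = str S s"
    and g: "bij_betw g (tot T) (tot U)"
      "\<And>a s. a \<in> carrier (grp Z) \<Longrightarrow> s \<in> tot T \<Longrightarrow> g (oact T a s) = oact U a (g s)"
      "\<And>s. s \<in> tot T \<Longrightarrow> str U (g s) = str T s"
    using assms unfolding over_iso_def by metis
  show ?thesis unfolding over_iso_def
    by (intro exI[of _ "g \<circ> f"] conjI bij_betw_trans[OF f(1) g(1)])
      (use f g in \<open>auto simp: bij_betwE\<close>)
qed

lemma over_iso_sym:
  assumes S: "over_base Z S" and "over_iso Z S T"
  shows "over_iso Z T S"
proof -
  obtain f where f: "bij_betw f (tot S) (tot T)"
      "\<And>a s. a \<in> carrier (grp Z) \<Longrightarrow> s \<in> tot S \<Longrightarrow> f (oact S a s) = oact T a (f s)"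
      "\<And>s. s \<in> tot S \<Longrightarrow> str T (f s) = str S s"
    using assms unfolding over_iso_def by metis
  let ?g = "inv_into (tot S) f"
  have g: "\<And>t. t \<in> tot T \<Longrightarrow> ?g t \<in> tot S" "\<And>t. t \<in> tot T \<Longrightarrow> f (?g t) = t"
      "\<And>s. s \<in> tot S \<Longrightarrow> ?g (f s) = s"
    using f(1) by (auto simp: bij_betw_inv_into_left bij_betw_inv_into_right bij_betwE[OF bij_betw_inv_into])
  have "?g (oact T a t) = oact S a (?g t)" if "a \<in> carrier (grp Z)" "t \<in> tot T" for a t
  proof -
    have "oact S a (?g t) \<in> tot S"
      using S that g(1) group_actionD(3)[of "grp Z" "tot S" "oact S"] by (simp add: over_base_def)
    then show ?thesis using that f(2)[of a "?g t"] g(1,2)[of t] g(3)[of "oact S a (?g t)"] by simp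
  qed
  moreover have "str S (?g t) = str T t" if "t \<in> tot T" for t
    using f(3)[of "?g t"] g that by simp
  ultimately show ?thesis unfolding over_iso_def
    using bij_betw_inv_into[OF f(1)] by blast
qed

lemma over_base_over_sum:
  assumes S: "over_base Z S" and T: "over_base Z T"
  shows "over_base Z (over_sum S T)"
proof -
  have s: "group_action (grp Z) (tot S) (oact S)" and t: "group_action (grp Z) (tot T) (oact T)"
    using S T by (auto simp: over_base_def)
  note sd = group_actionD[OF s] and td = group_actionD[OF t]
  have "group_action (grp Z) (tot S <+> tot T)
      (\<lambda>g. \<lambda>u \<in> tot S <+> tot T. map_sum (oact S g) (oact T g) u)"
    by (rule group_actionI) (auto simp: sd td)
  then show ?thesis
    using S T by (auto simp: over_base_def over_sum_def)
qed

lemma over_iso_over_sum: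
  assumes "over_iso Z S S'" "over_iso Z T T'"
  shows "over_iso Z (over_sum S T) (over_sum S' T')"
proof -
  obtain f g where f: "bij_betw f (tot S) (tot S')"
      "\<And>a s. a \<in> carrier (grp Z) \<Longrightarrow> s \<in> tot S \<Longrightarrow> f (oact S a s) = oact S' a (f s)"
      "\<And>s. s \<in> tot S \<Longrightarrow> str S' (f s) = str S s"
    and g: "bij_betw g (tot T) (tot T')"
      "\<And>a s. a \<in> carrier (grp Z) \<Longrightarrow> s \<in> tot T \<Longrightarrow> g (oact T a s) = oact T' a (g s)"
      "\<And>s. s \<in> tot T \<Longrightarrow> str T' (g s) = str T s"
    using assms unfolding over_iso_def by metis
  have "bij_betw (map_sum f g) (tot S <+> tot T) (tot S' <+> tot T')"
    by (rule bij_betw_byWitness[where f' = "map_sum (inv_into (tot S) f) (inv_into (tot T) g)"])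
      (use f(1) g(1) in \<open>auto simp: bij_betw_inv_into_left bij_betw_inv_into_right bij_betwE
        bij_betwE[OF bij_betw_inv_into]\<close>)
  then show ?thesis unfolding over_iso_def
    by (intro exI[of _ "map_sum f g"]) (use f g in \<open>auto simp: over_sum_def bij_betwE\<close>)
qed

text \<open>The action is cut off outside \<open>X\<close> because \<open>group_action\<close> asks
  for permutations that are extensional on the set.\<close>

definition over_restrict :: "('g, 's, 'z) over \<Rightarrow> 's set \<Rightarrow> ('g, 's, 'z) over" where
  "over_restrict S X = \<lparr>tot = X, oact = (\<lambda>g. \<lambda>x \<in> X. oact S g x), str = str S\<rparr>"

lemma over_base_over_restrict:
  assumes S: "over_base Z S" and X: "X \<subseteq> tot S"
    and inv: "\<And>g x. g \<in> carrier (grp Z) \<Longrightarrow> x \<in> X \<Longrightarrow> oact S g x \<in> X"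
  shows "over_base Z (over_restrict S X)"
proof -
  have s: "group_action (grp Z) (tot S) (oact S)"
    using S by (auto simp: over_base_def)
  note sd = group_actionD[OF s]
  have "group_action (grp Z) X (\<lambda>g. \<lambda>x \<in> X. oact S g x)"
    by (rule group_actionI) (use X in \<open>auto simp: sd inv subsetD\<close>)
  then show ?thesis
    using S X by (auto simp: over_base_def over_restrict_def finite_subset Pi_iff subsetD)
qed

text \<open>Inverses act too, so membership in \<open>X\<close> is preserved in both directions and
  the complement is invariant as well. This is how single orbits are split off in the induction
  behind \<open>ocount_span_comp\<close>.\<close>

lemma over_iso_over_restrict:
  assumes S: "over_base Z S" and X: "X \<subseteq> tot S"
    and inv: "\<And>g x. g \<in> carrier (grp Z) \<Longrightarrow> x \<in> X \<Longrightarrow> oact S g x \<in> X"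
  shows "over_base Z (over_restrict S (tot S - X))"
    and "over_iso Z S (over_sum (over_restrict S X) (over_restrict S (tot S - X)))"
proof -
  have s: "group_action (grp Z) (tot S) (oact S)"
    using S by (auto simp: over_base_def)
  note sd = group_actionD[OF s]
  interpret group "grp Z" by (rule sd)
  have inv': "oact S g x \<in> X \<longleftrightarrow> x \<in> X" if "g \<in> carrier (grp Z)" "x \<in> tot S" for g x
    using inv[of "inv\<^bsub>grp Z\<^esub> g" "oact S g x"] inv[of g x] that sd(5)[symmetric] sd(4) by auto
  show "over_base Z (over_restrict S (tot S - X))"
    by (rule over_base_over_restrict) (use S in \<open>auto simp: inv' sd\<close>)
  let ?f = "\<lambda>s. if s \<in> X then Inl s else Inr s"
  have "bij_betw ?f (tot S) (X <+> (tot S - X))"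
    by (rule bij_betw_byWitness[where f' = "case_sum id id"]) (use X in auto)
  then show "over_iso Z S (over_sum (over_restrict S X) (over_restrict S (tot S - X)))"
    unfolding over_iso_def
    by (intro exI[of _ ?f]) (use X in \<open>auto simp: over_sum_def over_restrict_def inv' sd\<close>)
qed

text \<open>The fibre product of \<open>V\<close> and \<open>U\<close> over the middle object,
  before orbits are taken; the composite is its quotient by the balancing action.\<close>

definition matched ::
  "('k, 'z, 'h, 'y, 'v) span \<Rightarrow> ('h, 'y, 'g, 'x, 'u) span \<Rightarrow> 'v \<Rightarrow> 'u \<Rightarrow> bool" where
  "matched V U v u \<longleftrightarrow> v \<in> tot V \<and> u \<in> tot U \<and> snd (str V v) = fst (str U u)"

lemma matchedD:
  assumes "matched V U v u"
  shows "v \<in> tot V" "u \<in> tot U" "snd (str V v) = fst (str U u)"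
  using assms by (auto simp: matched_def)

context
  fixes A :: "('g, 'x) gset" and B :: "('h, 'y) gset" and C :: "('k, 'z) gset"
    and U :: "('h, 'y, 'g, 'x, 'u) span" and V :: "('k, 'z, 'h, 'y, 'v) span"
  assumes A: "finite_gset A" and B: "finite_gset B" and C: "finite_gset C"
    and U: "over_base (ext_prod B A) U" and V: "over_base (ext_prod C B) V"
begin

lemma matched_act:
  assumes m: "matched V U v u" and h: "h \<in> carrier (grp B)" "k \<in> carrier (grp C)" "g \<in> carrier (grp A)"
  shows "matched V U (oact V (k, h) v) (oact U (h, g) u)"
  using assms finite_gsetD(1)[OF A] finite_gsetD(1)[OF B] finite_gsetD(1)[OF C]
  by (simp add: matched_def over_baseD[OF U] over_baseD[OF V])

text \<open>Both components of the right balancing action by h act through the inverse of h, and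
  inversion permutes the group. So the orbits are those of the diagonal left action of the middle
  group, with no inverses left to carry.\<close>

lemma bal_orbit_alt:
  "bal_orbit C B A V U v u =
     {(oact V (\<one>\<^bsub>grp C\<^esub>, h) v, oact U (h, \<one>\<^bsub>grp A\<^esub>) u) | h. h \<in> carrier (grp B)}"
proof -
  interpret B: group "grp B" by (rule finite_gsetD[OF B])
  have "\<exists>h'. oact V (\<one>\<^bsub>grp C\<^esub>, h) v = oact V (\<one>\<^bsub>grp C\<^esub>, inv\<^bsub>grp B\<^esub> h') v \<and>
      oact U (h, \<one>\<^bsub>grp A\<^esub>) u = oact U (inv\<^bsub>grp B\<^esub> h', \<one>\<^bsub>grp A\<^esub>) u \<and> h' \<in> carrier (grp B)"
    if "h \<in> carrier (grp B)" for h
    using that by (intro exI[of _ "inv\<^bsub>grp B\<^esub> h"]) simp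
  then show ?thesis unfolding bal_orbit_def lact_def ract_def by auto
qed

lemma bal_orbit_refl:
  assumes "v \<in> tot V" "u \<in> tot U"
  shows "(v, u) \<in> bal_orbit C B A V U v u"
proof -
  interpret B: group "grp B" by (rule finite_gsetD[OF B])
  show ?thesis unfolding bal_orbit_alt
    using over_baseD(2)[OF U assms(2)] over_baseD(2)[OF V assms(1)] by force
qed

lemma bal_orbit_eq_iff:
  assumes m: "v \<in> tot V" "u \<in> tot U" "v' \<in> tot V" "u' \<in> tot U"
  shows "bal_orbit C B A V U v u = bal_orbit C B A V U v' u' \<longleftrightarrow>
    (\<exists>h \<in> carrier (grp B). v' = oact V (\<one>\<^bsub>grp C\<^esub>, h) v \<and> u' = oact U (h, \<one>\<^bsub>grp A\<^esub>) u)"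
proof
  assume "bal_orbit C B A V U v u = bal_orbit C B A V U v' u'"
  then have "(v', u') \<in> bal_orbit C B A V U v u" using bal_orbit_refl m by blast
  then show "\<exists>h \<in> carrier (grp B). v' = oact V (\<one>\<^bsub>grp C\<^esub>, h) v \<and> u' = oact U (h, \<one>\<^bsub>grp A\<^esub>) u"
    unfolding bal_orbit_alt by auto
next
  interpret A: group "grp A" by (rule finite_gsetD[OF A])
  interpret B: group "grp B" by (rule finite_gsetD[OF B])
  interpret C: group "grp C" by (rule finite_gsetD[OF C])
  note vd = over_baseD[OF V] and ud = over_baseD[OF U]
  assume "\<exists>h \<in> carrier (grp B). v' = oact V (\<one>\<^bsub>grp C\<^esub>, h) v \<and> u' = oact U (h, \<one>\<^bsub>grp A\<^esub>) u"
  then obtain h where h: "h \<in> carrier (grp B)" "v' = oact V (\<one>\<^bsub>grp C\<^esub>, h) v" "u' = oact U (h, \<one>\<^bsub>grp A\<^esub>) u"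
    by blast
  have e: "oact V (\<one>\<^bsub>grp C\<^esub>, h') v' = oact V (\<one>\<^bsub>grp C\<^esub>, h' \<otimes>\<^bsub>grp B\<^esub> h) v"
      "oact U (h', \<one>\<^bsub>grp A\<^esub>) u' = oact U (h' \<otimes>\<^bsub>grp B\<^esub> h, \<one>\<^bsub>grp A\<^esub>) u"
    if "h' \<in> carrier (grp B)" for h'
    using that h m by (simp_all add: vd ud)
  have e': "oact V (\<one>\<^bsub>grp C\<^esub>, h') v = oact V (\<one>\<^bsub>grp C\<^esub>, h' \<otimes>\<^bsub>grp B\<^esub> inv\<^bsub>grp B\<^esub> h) v'"
      "oact U (h', \<one>\<^bsub>grp A\<^esub>) u = oact U (h' \<otimes>\<^bsub>grp B\<^esub> inv\<^bsub>grp B\<^esub> h, \<one>\<^bsub>grp A\<^esub>) u'"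
    if "h' \<in> carrier (grp B)" for h'
    using that h(1) by (simp_all add: e B.m_assoc)
  show "bal_orbit C B A V U v u = bal_orbit C B A V U v' u'"
    unfolding bal_orbit_alt using h(1) e e' by (blast intro: B.m_closed B.inv_closed)
qed

lemma bal_orbit_act:
  assumes m: "matched V U v u" and h: "h \<in> carrier (grp B)"
  shows "bal_orbit C B A V U (oact V (\<one>\<^bsub>grp C\<^esub>, h) v) (oact U (h, \<one>\<^bsub>grp A\<^esub>) u) =
    bal_orbit C B A V U v u"
proof -
  have "matched V U (oact V (\<one>\<^bsub>grp C\<^esub>, h) v) (oact U (h, \<one>\<^bsub>grp A\<^esub>) u)"
    using matched_act[OF m h] finite_gsetD(1)[OF A] finite_gsetD(1)[OF C]
    by (simp add: group.is_monoid monoid.one_closed)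
  then show ?thesis
    using bal_orbit_eq_iff[OF matchedD(1,2)[OF m] matchedD(1,2)] h by metis
qed

lemma bal_orbit_eqD:
  assumes "bal_orbit C B A V U v u = bal_orbit C B A V U v' u'" "matched V U v u" "matched V U v' u'"
  shows "\<exists>h \<in> carrier (grp B). v' = oact V (\<one>\<^bsub>grp C\<^esub>, h) v \<and> u' = oact U (h, \<one>\<^bsub>grp A\<^esub>) u"
  using bal_orbit_eq_iff[OF matchedD(1,2)[OF assms(2)] matchedD(1,2)[OF assms(3)]] assms(1) by simp

lemma bal_orbit_in_tot: "matched V U v u \<Longrightarrow> bal_orbit C B A V U v u \<in> tot (span_comp C B A V U)"
  by (auto simp: span_comp_def span_comp_tot_def matched_def)

lemma tot_span_compE:
  assumes "w \<in> tot (span_comp C B A V U)"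
  obtains v u where "matched V U v u" "w = bal_orbit C B A V U v u"
  using assms by (auto simp: span_comp_def span_comp_tot_def matched_def)

lemma oact_bal_orbit:
  assumes "matched V U v u" "k \<in> carrier (grp C)" "g \<in> carrier (grp A)"
  shows "oact (span_comp C B A V U) (k, g) (bal_orbit C B A V U v u) =
    bal_orbit C B A V U (oact V (k, \<one>\<^bsub>grp B\<^esub>) v) (oact U (\<one>\<^bsub>grp B\<^esub>, g) u)"
  using over_base_span_comp(3)[OF A B C V U] assms by (simp add: matched_def lact_def)

lemma str_bal_orbit:
  assumes "matched V U v u"
  shows "str (span_comp C B A V U) (bal_orbit C B A V U v u) = (fst (str V v), snd (str U u))"
  using over_base_span_comp(2)[OF A B C V U] assms by (simp add: matched_def)

text \<open>A map out of an orbit set is given on representatives: \<open>bal\<close> makes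
  \<open>F\<close> descend, and \<open>inj\<close> says that its fibres are single orbits. The
  identifications of composites below work by supplying such an \<open>F\<close>.\<close>

lemma span_comp_isoI:
  assumes tot: "\<And>v u. matched V U v u \<Longrightarrow> F v u \<in> tot T"
    and bal: "\<And>v u h. matched V U v u \<Longrightarrow> h \<in> carrier (grp B) \<Longrightarrow>
      F (oact V (\<one>\<^bsub>grp C\<^esub>, h) v) (oact U (h, \<one>\<^bsub>grp A\<^esub>) u) = F v u"
    and inj: "\<And>v u v' u'. matched V U v u \<Longrightarrow> matched V U v' u' \<Longrightarrow> F v u = F v' u' \<Longrightarrow>
      \<exists>h \<in> carrier (grp B). v' = oact V (\<one>\<^bsub>grp C\<^esub>, h) v \<and> u' = oact U (h, \<one>\<^bsub>grp A\<^esub>) u"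
    and surj: "\<And>t. t \<in> tot T \<Longrightarrow> \<exists>v u. matched V U v u \<and> F v u = t"
    and act: "\<And>v u k g. matched V U v u \<Longrightarrow> k \<in> carrier (grp C) \<Longrightarrow> g \<in> carrier (grp A) \<Longrightarrow>
      F (oact V (k, \<one>\<^bsub>grp B\<^esub>) v) (oact U (\<one>\<^bsub>grp B\<^esub>, g) u) = oact T (k, g) (F v u)"
    and str: "\<And>v u. matched V U v u \<Longrightarrow> str T (F v u) = (fst (str V v), snd (str U u))"
  shows "over_iso (ext_prod C A) (span_comp C B A V U) T"
proof -
  \<comment> \<open>An arbitrary member of the orbit is chosen; \<open>bal\<close> makes the value
    independent of it.\<close>
  define f where "f w = (case (SOME p. p \<in> w) of (v, u) \<Rightarrow> F v u)" for w
  let ?o = "bal_orbit C B A V U"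
  have f: "f (?o v u) = F v u" if m: "matched V U v u" for v u
  proof -
    have "(SOME p. p \<in> ?o v u) \<in> ?o v u"
      by (rule someI[of "\<lambda>p. p \<in> ?o v u" "(v, u)"])
        (rule bal_orbit_refl[OF matchedD(1,2)[OF m]])
    then obtain h where "h \<in> carrier (grp B)"
        "(SOME p. p \<in> ?o v u) = (oact V (\<one>\<^bsub>grp C\<^esub>, h) v, oact U (h, \<one>\<^bsub>grp A\<^esub>) u)"
      unfolding bal_orbit_alt by auto
    then show ?thesis using bal[OF m] by (simp add: f_def)
  qed
  interpret A: group "grp A" by (rule finite_gsetD[OF A])
  interpret B: group "grp B" by (rule finite_gsetD[OF B])
  interpret C: group "grp C" by (rule finite_gsetD[OF C])
  have "inj_on f (tot (span_comp C B A V U))"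
  proof (rule inj_onI)
    fix w w' assume w: "w \<in> tot (span_comp C B A V U)" "w' \<in> tot (span_comp C B A V U)" "f w = f w'"
    obtain v u v' u' where vu: "matched V U v u" "w = ?o v u" "matched V U v' u'" "w' = ?o v' u'"
      using w(1,2) by (elim tot_span_compE)
    have "F v u = F v' u'" using w(3) f[OF vu(1)] f[OF vu(3)] vu(2,4) by simp
    from inj[OF vu(1,3) this] show "w = w'"
      unfolding vu(2,4) bal_orbit_eq_iff[OF matchedD(1,2)[OF vu(1)] matchedD(1,2)[OF vu(3)]] .
  qed
  moreover have "f ` tot (span_comp C B A V U) = tot T"
  proof
    show "f ` tot (span_comp C B A V U) \<subseteq> tot T"
      using f tot by (auto elim!: tot_span_compE)
    show "tot T \<subseteq> f ` tot (span_comp C B A V U)"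
      using surj f bal_orbit_in_tot by (metis image_eqI subsetI)
  qed
  moreover have "f (oact (span_comp C B A V U) (k, g) w) = oact T (k, g) (f w)"
    if "w \<in> tot (span_comp C B A V U)" "k \<in> carrier (grp C)" "g \<in> carrier (grp A)" for w k g
    using that(1)
  proof (elim tot_span_compE)
    fix v u assume m: "matched V U v u" and w: "w = ?o v u"
    have "matched V U (oact V (k, \<one>\<^bsub>grp B\<^esub>) v) (oact U (\<one>\<^bsub>grp B\<^esub>, g) u)"
      using that by (intro matched_act[OF m]) auto
    then show ?thesis unfolding w using that m by (simp add: oact_bal_orbit f act)
  qed
  moreover have "str T (f w) = str (span_comp C B A V U) w"
    if "w \<in> tot (span_comp C B A V U)" for w
    using that by (auto elim!: tot_span_compE simp: f str_bal_orbit str)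
  ultimately show ?thesis unfolding over_iso_def
    by (intro exI[of _ f]) (auto simp: bij_betw_def ext_prod_def)
qed

end

section \<open>Congruence, distributivity, unit and associativity of span composition\<close>

lemma span_comp_cong:
  assumes A: "finite_gset A" and B: "finite_gset B" and C: "finite_gset C"
    and U: "over_base (ext_prod B A) U" and V: "over_base (ext_prod C B) V"
    and U': "over_base (ext_prod B A) U'" and V': "over_base (ext_prod C B) V'"
    and isoV: "over_iso (ext_prod C B) V V'" and isoU: "over_iso (ext_prod B A) U U'"
  shows "over_iso (ext_prod C A) (span_comp C B A V U) (span_comp C B A V' U')"
proof -
  interpret A: group "grp A" by (rule finite_gsetD[OF A])
  interpret B: group "grp B" by (rule finite_gsetD[OF B])
  interpret C: group "grp C" by (rule finite_gsetD[OF C])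
  note vd = over_baseD[OF V] and ud = over_baseD[OF U]
  obtain f where f: "bij_betw f (tot V) (tot V')"
      "\<And>k h v. k \<in> carrier (grp C) \<Longrightarrow> h \<in> carrier (grp B) \<Longrightarrow> v \<in> tot V \<Longrightarrow>
        f (oact V (k, h) v) = oact V' (k, h) (f v)"
      "\<And>v. v \<in> tot V \<Longrightarrow> str V' (f v) = str V v"
    using isoV by (auto simp: over_iso_def ext_prod_def)
  obtain g where g: "bij_betw g (tot U) (tot U')"
      "\<And>h a u. h \<in> carrier (grp B) \<Longrightarrow> a \<in> carrier (grp A) \<Longrightarrow> u \<in> tot U \<Longrightarrow>
        g (oact U (h, a) u) = oact U' (h, a) (g u)"
      "\<And>u. u \<in> tot U \<Longrightarrow> str U' (g u) = str U u"
    using isoU by (auto simp: over_iso_def ext_prod_def)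
  have m: "matched V' U' (f v) (g u)" if "matched V U v u" for v u
    using that f(1,3) g(1,3) by (auto simp: matched_def bij_betwE)
  note c = A B C U' V'
  show ?thesis
  proof (rule span_comp_isoI[OF A B C U V, where F = "\<lambda>v u. bal_orbit C B A V' U' (f v) (g u)"], goal_cases)
    case (1 v u)
    show ?case by (rule bal_orbit_in_tot[OF c m[OF 1]])
  next
    case (2 v u h)
    then show ?case using bal_orbit_act[OF c m[OF 2(1)] 2(2)] by (simp add: f(2) g(2) matchedD[OF 2(1)])
  next
    case (3 v u v' u')
    note m1 = matchedD[OF 3(1)] and m2 = matchedD[OF 3(2)]
    obtain h where h: "h \<in> carrier (grp B)" "f v' = f (oact V (\<one>\<^bsub>grp C\<^esub>, h) v)"
        "g u' = g (oact U (h, \<one>\<^bsub>grp A\<^esub>) u)"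
      using bal_orbit_eqD[OF c 3(3) m[OF 3(1)] m[OF 3(2)]] m1 by (auto simp: f(2) g(2))
    have "v' = oact V (\<one>\<^bsub>grp C\<^esub>, h) v" "u' = oact U (h, \<one>\<^bsub>grp A\<^esub>) u"
      using inj_onD[OF bij_betw_imp_inj_on[OF f(1)] h(2)] inj_onD[OF bij_betw_imp_inj_on[OF g(1)] h(3)]
        m1 m2 h(1) by (auto simp: vd ud)
    then show ?case using h(1) by blast
  next
    case (4 t)
    then obtain v' u' where t: "matched V' U' v' u'" "t = bal_orbit C B A V' U' v' u'"
      using tot_span_compE[OF c] by blast
    have "v' \<in> f ` tot V" "u' \<in> g ` tot U"
      using matchedD(1,2)[OF t(1)] f(1) g(1) by (simp_all add: bij_betw_def)
    then obtain v u where "v \<in> tot V" "u \<in> tot U" "f v = v'" "g u = u'" by blast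
    then show ?case using matchedD(3)[OF t(1)] f(3) g(3) t(2)
      by (intro exI[of _ v] exI[of _ u]) (auto simp: matched_def)
  next
    case (5 v u k a)
    then show ?case using oact_bal_orbit[OF c m[OF 5(1)] 5(2,3)] by (simp add: f(2) g(2) matchedD)
  next
    case (6 v u)
    then show ?case using str_bal_orbit[OF c m[OF 6]] by (simp add: f(3) g(3) matchedD)
  qed
qed

lemma over_sum_simps:
  "tot (over_sum S T) = tot S <+> tot T"
  "s \<in> tot S \<Longrightarrow> oact (over_sum S T) g (Inl s) = Inl (oact S g s)"
  "t \<in> tot T \<Longrightarrow> oact (over_sum S T) g (Inr t) = Inr (oact T g t)"
  "str (over_sum S T) (Inl s) = str S s"
  "str (over_sum S T) (Inr t) = str T t"
  by (auto simp: over_sum_def)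

text \<open>A matched pair has its left component in one summand and balancing does not leave that
  summand. This is what the relation for disjoint unions demands of composition in its left
  argument.\<close>

lemma span_comp_over_sum_left:
  assumes A: "finite_gset A" and B: "finite_gset B" and C: "finite_gset C"
    and U: "over_base (ext_prod B A) U"
    and V: "over_base (ext_prod C B) V" and V': "over_base (ext_prod C B) V'"
  shows "over_iso (ext_prod C A) (span_comp C B A (over_sum V V') U)
    (over_sum (span_comp C B A V U) (span_comp C B A V' U))"
proof -
  interpret A: group "grp A" by (rule finite_gsetD[OF A])
  interpret B: group "grp B" by (rule finite_gsetD[OF B])
  interpret C: group "grp C" by (rule finite_gsetD[OF C])
  note vd = over_baseD[OF V] and vd' = over_baseD[OF V'] and ud = over_baseD[OF U]
  note c = A B C U V and c' = A B C U V'
  have ml: "matched (over_sum V V') U (Inl v) u \<longleftrightarrow> matched V U v u"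
    and mr: "matched (over_sum V V') U (Inr v') u \<longleftrightarrow> matched V' U v' u" for v v' u
    by (auto simp: matched_def over_sum_simps)
  let ?F = "\<lambda>w u. case w of Inl v \<Rightarrow> Inl (bal_orbit C B A V U v u) | Inr v \<Rightarrow> Inr (bal_orbit C B A V' U v u)"
  show ?thesis
  proof (rule span_comp_isoI[OF A B C U over_base_over_sum[OF V V'], where F = ?F], goal_cases)
    case (1 v u)
    then show ?case
      by (cases v) (auto simp: ml mr over_sum_simps bal_orbit_in_tot[OF c] bal_orbit_in_tot[OF c'])
  next
    case (2 v u h)
    then show ?case
      by (cases v) (auto simp: ml mr over_sum_simps matchedD bal_orbit_act[OF c] bal_orbit_act[OF c'])
  next
    case (3 v u v' u')
    then show ?case
      by (cases v; cases v')
        (auto simp: ml mr over_sum_simps matchedD dest!: bal_orbit_eqD[OF c] bal_orbit_eqD[OF c'])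
  next
    case (4 t)
    show ?case
    proof (cases t)
      case (Inl w)
      then obtain v u where "matched V U v u" "w = bal_orbit C B A V U v u"
        using 4 tot_span_compE[OF c] by (auto simp: over_sum_simps)
      then show ?thesis by (intro exI[of _ "Inl v"] exI[of _ u]) (simp add: ml Inl)
    next
      case (Inr w)
      then obtain v u where "matched V' U v u" "w = bal_orbit C B A V' U v u"
        using 4 tot_span_compE[OF c'] by (auto simp: over_sum_simps)
      then show ?thesis by (intro exI[of _ "Inr v"] exI[of _ u]) (simp add: mr Inr)
    qed
  next
    case (5 v u k a)
    then show ?case
      by (cases v) (auto simp: ml mr over_sum_simps matchedD oact_bal_orbit[OF c] oact_bal_orbit[OF c']
          bal_orbit_in_tot[OF c] bal_orbit_in_tot[OF c'])
  next
    case (6 v u)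
    then show ?case
      by (cases v) (auto simp: ml mr over_sum_simps str_bal_orbit[OF c] str_bal_orbit[OF c'])
  qed
qed

lemma span_comp_over_sum_right:
  assumes A: "finite_gset A" and B: "finite_gset B" and C: "finite_gset C"
    and U: "over_base (ext_prod B A) U" and U': "over_base (ext_prod B A) U'"
    and V: "over_base (ext_prod C B) V"
  shows "over_iso (ext_prod C A) (span_comp C B A V (over_sum U U'))
    (over_sum (span_comp C B A V U) (span_comp C B A V U'))"
proof -
  interpret A: group "grp A" by (rule finite_gsetD[OF A])
  interpret B: group "grp B" by (rule finite_gsetD[OF B])
  interpret C: group "grp C" by (rule finite_gsetD[OF C])
  note vd = over_baseD[OF V] and ud' = over_baseD[OF U'] and ud = over_baseD[OF U]
  note c = A B C U V and c' = A B C U' V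
  have ml: "matched V (over_sum U U') v (Inl u) \<longleftrightarrow> matched V U v u"
    and mr: "matched V (over_sum U U') v (Inr u') \<longleftrightarrow> matched V U' v u'" for v u u'
    by (auto simp: matched_def over_sum_simps)
  let ?F = "\<lambda>v w. case w of Inl u \<Rightarrow> Inl (bal_orbit C B A V U v u) | Inr u \<Rightarrow> Inr (bal_orbit C B A V U' v u)"
  show ?thesis
  proof (rule span_comp_isoI[OF A B C over_base_over_sum[OF U U'] V, where F = ?F], goal_cases)
    case (1 v u)
    then show ?case
      by (cases u) (auto simp: ml mr over_sum_simps bal_orbit_in_tot[OF c] bal_orbit_in_tot[OF c'])
  next
    case (2 v u h)
    then show ?case
      by (cases u) (auto simp: ml mr over_sum_simps matchedD bal_orbit_act[OF c] bal_orbit_act[OF c'])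
  next
    case (3 v u v' u')
    then show ?case
      by (cases u; cases u')
        (auto simp: ml mr over_sum_simps matchedD dest!: bal_orbit_eqD[OF c] bal_orbit_eqD[OF c'])
  next
    case (4 t)
    show ?case
    proof (cases t)
      case (Inl w)
      then obtain v u where "matched V U v u" "w = bal_orbit C B A V U v u"
        using 4 tot_span_compE[OF c] by (auto simp: over_sum_simps)
      then show ?thesis by (intro exI[of _ v] exI[of _ "Inl u"]) (simp add: ml Inl)
    next
      case (Inr w)
      then obtain v u where "matched V U' v u" "w = bal_orbit C B A V U' v u"
        using 4 tot_span_compE[OF c'] by (auto simp: over_sum_simps)
      then show ?thesis by (intro exI[of _ v] exI[of _ "Inr u"]) (simp add: mr Inr)
    qed
  next
    case (5 v u k a)
    then show ?case
      by (cases u) (auto simp: ml mr over_sum_simps matchedD oact_bal_orbit[OF c] oact_bal_orbit[OF c']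
          bal_orbit_in_tot[OF c] bal_orbit_in_tot[OF c'])
  next
    case (6 v u)
    then show ?case
      by (cases u) (auto simp: ml mr over_sum_simps str_bal_orbit[OF c] str_bal_orbit[OF c'])
  qed
qed

text \<open>The orbit of ((g, x), u) is sent to g u. Matching forces x to be g applied to the left
  leg of u, so x carries no further information, and balancing by g turns the pair into ((1, x), g
  u).\<close>

lemma span_comp_id_left:
  assumes A: "finite_gset A" and B: "finite_gset B" and U: "over_base (ext_prod B A) U"
  shows "over_iso (ext_prod B A) (span_comp B B A (id_span B) U) U"
proof -
  interpret A: group "grp A" by (rule finite_gsetD[OF A])
  interpret B: group "grp B" by (rule finite_gsetD[OF B])
  note ud = over_baseD[OF U] and bd = finite_gsetD[OF B]
  have m: "matched (id_span B) U p u \<longleftrightarrow> u \<in> tot U \<and> (\<exists>g x. p = (g, x) \<and> g \<in> carrier (grp B) \<and> x \<in> pts B \<and>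
      x = act B g (fst (str U u)))" for p u
  proof -
    have "act B (inv\<^bsub>grp B\<^esub> g) x = y \<longleftrightarrow> x = act B g y"
      if "g \<in> carrier (grp B)" "x \<in> pts B" "y \<in> pts B" for g x y
      using that by (auto simp: bd(6)[symmetric] bd(5))
    then show ?thesis by (auto simp: matched_def id_span_def ud)
  qed
  have i: "oact (id_span B) (a, b) (g, x) = (a \<otimes>\<^bsub>grp B\<^esub> g \<otimes>\<^bsub>grp B\<^esub> inv\<^bsub>grp B\<^esub> b, act B a x)"
      "str (id_span B) (g, x) = (x, act B (inv\<^bsub>grp B\<^esub> g) x)"
    if "g \<in> carrier (grp B)" "x \<in> pts B" for a b g x
    using that by (auto simp: id_span_def)
  let ?F = "\<lambda>p u. oact U (fst p, \<one>\<^bsub>grp A\<^esub>) u"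
  show ?thesis
  proof (rule span_comp_isoI[OF A B B U over_base_id_span[OF B], where F = ?F], goal_cases)
    case (1 v u)
    then show ?case by (auto simp: m ud)
  next
    case (2 v u h)
    then show ?case by (auto simp: m ud i bd B.m_assoc)
  next
    case (3 v u v' u')
    obtain g g' where g: "g \<in> carrier (grp B)" "v = (g, act B g (fst (str U u)))" "u \<in> tot U"
        "g' \<in> carrier (grp B)" "v' = (g', act B g' (fst (str U u')))" "u' \<in> tot U"
      using 3(1,2) by (auto simp: m)
    have e: "oact U (g, \<one>\<^bsub>grp A\<^esub>) u = oact U (g', \<one>\<^bsub>grp A\<^esub>) u'" using 3(3) g by simp
    have "oact U (inv\<^bsub>grp B\<^esub> g', \<one>\<^bsub>grp A\<^esub>) (oact U (g', \<one>\<^bsub>grp A\<^esub>) u') = u'"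
      using g by (simp add: ud)
    then have u': "u' = oact U (inv\<^bsub>grp B\<^esub> g' \<otimes>\<^bsub>grp B\<^esub> g, \<one>\<^bsub>grp A\<^esub>) u"
      unfolding e[symmetric] using g by (simp add: ud)
    have "act B g (fst (str U u)) = act B g' (fst (str U u'))"
      using arg_cong[OF e, of "\<lambda>u. fst (str U u)"] g by (simp add: ud)
    \<comment> \<open>The balancing element h takes g to g h^-1 and has to produce g', hence h =
      g'^-1 g.\<close>
    then show ?case using g u'
      by (intro bexI[of _ "inv\<^bsub>grp B\<^esub> g' \<otimes>\<^bsub>grp B\<^esub> g"])
        (auto simp: i B.inv_mult_group B.m_assoc[symmetric] bd ud)
  next
    case (4 t)
    then show ?case
      by (intro exI[of _ "(\<one>\<^bsub>grp B\<^esub>, fst (str U t))"] exI[of _ t]) (auto simp: m ud bd)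
  next
    case (5 v u k a)
    then show ?case by (auto simp: m ud i bd)
  next
    case (6 v u)
    then show ?case by (auto simp: m ud i finite_gsetD[OF A] intro!: prod_eqI)
  qed
qed

text \<open>Both sides are orbits of triples (w, v, u) under the two middle groups. The actions of
  these groups on v commute, so the order in which the quotients are taken does not matter.\<close>

lemma span_comp_assoc:
  assumes A: "finite_gset A" and B: "finite_gset B" and C: "finite_gset C" and D: "finite_gset D"
    and U: "over_base (ext_prod B A) U" and V: "over_base (ext_prod C B) V"
    and W: "over_base (ext_prod D C) W"
  shows "over_iso (ext_prod D A) (span_comp D B A (span_comp D C B W V) U)
    (span_comp D C A W (span_comp C B A V U))"
proof -
  interpret A: group "grp A" by (rule finite_gsetD[OF A])
  interpret B: group "grp B" by (rule finite_gsetD[OF B])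
  interpret C: group "grp C" by (rule finite_gsetD[OF C])
  interpret D: group "grp D" by (rule finite_gsetD[OF D])
  note ud = over_baseD[OF U] and vd = over_baseD[OF V] and wd = over_baseD[OF W]
  let ?WV = "span_comp D C B W V" and ?VU = "span_comp C B A V U"
  have WV: "over_base (ext_prod D B) ?WV" by (rule over_base_span_comp[OF B C D W V])
  have VU: "over_base (ext_prod C A) ?VU" by (rule over_base_span_comp[OF A B C V U])
  let ?wv = "bal_orbit D C B W V" and ?vu = "bal_orbit C B A V U"
  let ?o = "bal_orbit D C A W ?VU"
  note cwv = B C D V W and cvu = A B C U V and c = A C D VU W and c' = A B D U WV
  \<comment> \<open>The inner composite on the left hands over a whole orbit of pairs (w, v), so a
    member is chosen; the fact \<open>F\<close> below shows that another choice gives the same orbit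
    on the right.\<close>
  define F where "F \<omega> u = (case (SOME p. p \<in> \<omega>) of (w, v) \<Rightarrow> ?o w (?vu v u))" for \<omega> u
  have mm: "matched W V w v \<and> matched V U v u"
    if "matched ?WV U (?wv w v) u" "matched W V w v" for w v u
    using that matchedD[OF that(1)] by (auto simp: str_bal_orbit[OF cwv] matched_def)
  have mm': "matched ?WV U (?wv w v) u" if "matched W V w v" "matched V U v u" for w v u
    unfolding matched_def[of ?WV] str_bal_orbit[OF cwv that(1)]
    using bal_orbit_in_tot[OF cwv that(1)] matchedD[OF that(2)] by simp
  have mo: "matched W ?VU w (?vu v u)" if "matched W V w v" "matched V U v u" for w v u
    unfolding matched_def[of W] str_bal_orbit[OF cvu that(2)]
    using bal_orbit_in_tot[OF cvu that(2)] matchedD[OF that(1)] by simp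
  have F: "F (?wv w v) u = ?o w (?vu v u)" if m: "matched W V w v" "matched V U v u" for w v u
  proof -
    have "(SOME p. p \<in> ?wv w v) \<in> ?wv w v"
      by (rule someI[of "\<lambda>p. p \<in> ?wv w v" "(w, v)"])
        (rule bal_orbit_refl[OF cwv matchedD(1,2)[OF m(1)]])
    then obtain h where h: "h \<in> carrier (grp C)"
        "(SOME p. p \<in> ?wv w v) = (oact W (\<one>\<^bsub>grp D\<^esub>, h) w, oact V (h, \<one>\<^bsub>grp B\<^esub>) v)"
      unfolding bal_orbit_alt[OF cwv] by auto
    have m': "matched V U (oact V (h, \<one>\<^bsub>grp B\<^esub>) v) u"
      using matched_act[OF cvu m(2), of "\<one>\<^bsub>grp B\<^esub>" h "\<one>\<^bsub>grp A\<^esub>"] h matchedD[OF m(2)] by (simp add: ud)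
    have m'': "matched W V (oact W (\<one>\<^bsub>grp D\<^esub>, h) w) (oact V (h, \<one>\<^bsub>grp B\<^esub>) v)"
      using matched_act[OF cwv m(1)] h by simp
    have "?o w (?vu v u) = ?o (oact W (\<one>\<^bsub>grp D\<^esub>, h) w) (?vu (oact V (h, \<one>\<^bsub>grp B\<^esub>) v) u)"
      unfolding bal_orbit_eq_iff[OF c matchedD(1,2)[OF mo[OF m]] matchedD(1,2)[OF mo[OF m'' m']]]
      using h m matchedD[OF m(2)] by (intro bexI[of _ h]) (auto simp: oact_bal_orbit[OF cvu] ud)
    then show ?thesis by (simp add: F_def h)
  qed
  have E: "\<exists>w v. \<omega> = ?wv w v \<and> matched W V w v \<and> matched V U v u"
    if "matched ?WV U \<omega> u" for \<omega> u
    using tot_span_compE[OF cwv matchedD(1)[OF that]] mm that by metis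
  show ?thesis
  proof (rule span_comp_isoI[OF A B D U WV, where F = F], goal_cases)
    case (1 \<omega> u)
    then show ?case using E[OF 1] by (auto simp: F mo bal_orbit_in_tot[OF c])
  next
    case (2 \<omega> u h)
    then obtain w v where w: "\<omega> = ?wv w v" "matched W V w v" "matched V U v u" using E by blast
    have m: "matched V U (oact V (\<one>\<^bsub>grp C\<^esub>, h) v) (oact U (h, \<one>\<^bsub>grp A\<^esub>) u)"
      using matched_act[OF cvu w(3)] 2 by simp
    have m': "matched W V w (oact V (\<one>\<^bsub>grp C\<^esub>, h) v)"
      using matched_act[OF cwv w(2), of "\<one>\<^bsub>grp C\<^esub>" "\<one>\<^bsub>grp D\<^esub>" h] 2 w(2) by (simp add: wd matchedD)
    have "?vu (oact V (\<one>\<^bsub>grp C\<^esub>, h) v) (oact U (h, \<one>\<^bsub>grp A\<^esub>) u) = ?vu v u"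
      by (rule bal_orbit_act[OF cvu w(3) 2(2)])
    then show ?case using w m m' 2(2)
      by (simp add: oact_bal_orbit[OF cwv] wd matchedD F)
  next
    case (3 \<omega> u \<omega>' u')
    obtain w v where w: "\<omega> = ?wv w v" "matched W V w v" "matched V U v u" using E[OF 3(1)] by blast
    obtain w' v' where w': "\<omega>' = ?wv w' v'" "matched W V w' v'" "matched V U v' u'" using E[OF 3(2)] by blast
    have "?o w (?vu v u) = ?o w' (?vu v' u')" using 3(3) w w' by (simp add: F)
    then obtain h where h: "h \<in> carrier (grp C)" "w' = oact W (\<one>\<^bsub>grp D\<^esub>, h) w"
        "?vu v' u' = ?vu (oact V (h, \<one>\<^bsub>grp B\<^esub>) v) u"
      using bal_orbit_eq_iff[OF c matchedD(1,2)[OF mo[OF w(2,3)]] matchedD(1,2)[OF mo[OF w'(2,3)]]] w(3)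
      by (auto simp: oact_bal_orbit[OF cvu] ud matchedD)
    have m': "matched V U (oact V (h, \<one>\<^bsub>grp B\<^esub>) v) u"
      using matched_act[OF cvu w(3), of "\<one>\<^bsub>grp B\<^esub>" h "\<one>\<^bsub>grp A\<^esub>"] h w(3) by (simp add: ud matchedD)
    obtain b where b: "b \<in> carrier (grp B)" "v' = oact V (\<one>\<^bsub>grp C\<^esub>, b) (oact V (h, \<one>\<^bsub>grp B\<^esub>) v)"
        "u' = oact U (b, \<one>\<^bsub>grp A\<^esub>) u"
      using h(3)[symmetric] unfolding bal_orbit_eq_iff[OF cvu matchedD(1,2)[OF m'] matchedD(1,2)[OF w'(3)]] by blast
    have m2: "matched W V w (oact V (\<one>\<^bsub>grp C\<^esub>, b) v)"
      using matched_act[OF cwv w(2), of "\<one>\<^bsub>grp C\<^esub>" "\<one>\<^bsub>grp D\<^esub>" b] b w(2) by (simp add: wd matchedD)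
    \<comment> \<open>Commuting b past h lets h be absorbed by the balancing over \<open>C\<close>,
      which leaves b as the balancing element over \<open>B\<close>.\<close>
    have "v' = oact V (h, \<one>\<^bsub>grp B\<^esub>) (oact V (\<one>\<^bsub>grp C\<^esub>, b) v)"
      using b h w(2) by (simp add: vd matchedD)
    then have "?wv w' v' = ?wv w (oact V (\<one>\<^bsub>grp C\<^esub>, b) v)"
      using h bal_orbit_eq_iff[OF cwv matchedD(1,2)[OF m2] matchedD(1,2)[OF w'(2)]] by auto
    then show ?case using b w w' by (intro bexI[of _ b]) (auto simp: oact_bal_orbit[OF cwv] wd matchedD)
  next
    case (4 t)
    then obtain w \<nu> where w: "matched W ?VU w \<nu>" "t = ?o w \<nu>" using tot_span_compE[OF c] by blast
    obtain v u where v: "matched V U v u" "\<nu> = ?vu v u" using tot_span_compE[OF cvu matchedD(2)[OF w(1)]] by blast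
    have "matched W V w v" using matchedD[OF w(1)] v by (auto simp: str_bal_orbit[OF cvu] matched_def)
    then show ?case using v w(2) mm' F by (intro exI[of _ "?wv w v"] exI[of _ u]) auto
  next
    case (5 \<omega> u k a)
    then obtain w v where w: "\<omega> = ?wv w v" "matched W V w v" "matched V U v u" using E by blast
    have m: "matched V U v (oact U (\<one>\<^bsub>grp B\<^esub>, a) u)"
      using matched_act[OF cvu w(3), of "\<one>\<^bsub>grp B\<^esub>" "\<one>\<^bsub>grp C\<^esub>" a] 5 w(3) by (simp add: vd matchedD)
    have m': "matched W V (oact W (k, \<one>\<^bsub>grp C\<^esub>) w) v"
      using matched_act[OF cwv w(2), of "\<one>\<^bsub>grp C\<^esub>" k "\<one>\<^bsub>grp B\<^esub>"] 5 w(2) by (simp add: vd matchedD)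
    show ?case using w m m' mo[OF w(2,3)] 5
      by (simp add: oact_bal_orbit[OF cwv] oact_bal_orbit[OF cvu] oact_bal_orbit[OF c] F vd matchedD)
  next
    case (6 \<omega> u)
    then obtain w v where w: "\<omega> = ?wv w v" "matched W V w v" "matched V U v u" using E by blast
    then show ?case using mo[OF w(2,3)]
      by (simp add: F str_bal_orbit[OF cwv] str_bal_orbit[OF cvu] str_bal_orbit[OF c])
  qed
qed

section \<open>Quotients of free abelian groups\<close>

text \<open>Subgroups are taken in the additive type itself, so that kernels of functionals and
  generated groups of relations share one notion that does not mention a set of free
  generators.\<close>

definition frag_subgroup :: "('a \<Rightarrow>\<^sub>0 int) set \<Rightarrow> bool" where
  "frag_subgroup K \<longleftrightarrow> 0 \<in> K \<and> (\<forall>x \<in> K. \<forall>y \<in> K. x - y \<in> K)"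

lemma frag_subgroupD:
  assumes "frag_subgroup K"
  shows "0 \<in> K"
    and "\<And>x y. x \<in> K \<Longrightarrow> y \<in> K \<Longrightarrow> x - y \<in> K"
    and "\<And>x. x \<in> K \<Longrightarrow> - x \<in> K"
    and "\<And>x y. x \<in> K \<Longrightarrow> y \<in> K \<Longrightarrow> x + y \<in> K"
proof -
  show z: "0 \<in> K" and d: "\<And>x y. x \<in> K \<Longrightarrow> y \<in> K \<Longrightarrow> x - y \<in> K"
    using assms by (auto simp: frag_subgroup_def)
  show m: "- x \<in> K" if "x \<in> K" for x using d[OF z that] by simp
  show "x + y \<in> K" if "x \<in> K" "y \<in> K" for x y using d[OF that(1) m[OF that(2)]] by simp
qed

lemma frag_subgroup_frag_cmul:
  assumes K: "frag_subgroup K" and x: "x \<in> K"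
  shows "frag_cmul c x \<in> K"
proof -
  have n: "frag_cmul (int n) x \<in> K" for n
    by (induction n) (use x in \<open>auto simp: frag_cmul_distrib frag_subgroupD[OF K]\<close>)
  show ?thesis
    by (cases c rule: int_cases2) (use n frag_subgroupD(3)[OF K n] in auto)
qed

lemma frag_subgroup_frag_extend:
  assumes K: "frag_subgroup K" and f: "\<And>x. x \<in> Poly_Mapping.keys p \<Longrightarrow> f x \<in> K"
  shows "frag_extend f p \<in> K"
proof -
  have "(\<Sum>i\<in>I. frag_cmul (poly_mapping.lookup p i) (f i)) \<in> K"
    if "finite I" "I \<subseteq> Poly_Mapping.keys p" for I
    using that
    by (induction I rule: finite_induct) (auto simp: frag_subgroupD[OF K] f frag_subgroup_frag_cmul[OF K])
  then show ?thesis unfolding frag_extend_def by simp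
qed

lemma frag_extend_swap:
  "frag_extend (\<lambda>x. frag_extend (\<lambda>y. f x y) p) q = frag_extend (\<lambda>y. frag_extend (\<lambda>x. f x y) q) p"
  unfolding frag_extend_def
  by (simp add: frag_cmul_sum sum.swap[of _ "Poly_Mapping.keys q"] mult.commute)

lemma frag_subgroup_generate:
  assumes X: "X \<subseteq> carrier (free_Abelian_group S)"
  shows "frag_subgroup (generate (free_Abelian_group S) X)"
    and "generate (free_Abelian_group S) X \<subseteq> carrier (free_Abelian_group S)"
proof -
  interpret G: group "free_Abelian_group S" by (rule group_free_Abelian_group)
  interpret H: subgroup "generate (free_Abelian_group S) X" "free_Abelian_group S"
    by (rule G.generate_is_subgroup[OF X])
  have "x + y \<in> generate (free_Abelian_group S) X"
    if "x \<in> generate (free_Abelian_group S) X" "y \<in> generate (free_Abelian_group S) X" for x y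
    using H.m_closed[OF that] by simp
  moreover have "- x \<in> generate (free_Abelian_group S) X"
    if "x \<in> generate (free_Abelian_group S) X" for x
  proof -
    have "x \<in> carrier (free_Abelian_group S)" using H.subset that by blast
    then show ?thesis using H.m_inv_closed[OF that] by simp
  qed
  ultimately show "frag_subgroup (generate (free_Abelian_group S) X)"
    using H.one_closed by (auto simp: frag_subgroup_def diff_conv_add_uminus simp del: add_uminus_conv_diff)
  show "generate (free_Abelian_group S) X \<subseteq> carrier (free_Abelian_group S)" by (rule H.subset)
qed

text \<open>The preimage of \<open>K\<close> under an additive map is again a subgroup, so the
  generators decide. This turns the later well-definedness proofs into checks on the defining
  relations.\<close>

lemma generate_free_Abelian_group_hom:
  assumes X: "X \<subseteq> carrier (free_Abelian_group S)" and K: "frag_subgroup K"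
    and h: "\<And>x y. h (x - y) = h x - h y" and gen: "\<And>x. x \<in> X \<Longrightarrow> h x \<in> K"
    and r: "r \<in> generate (free_Abelian_group S) X"
  shows "h r \<in> K"
proof -
  have h0: "h 0 = 0" using h[of 0 0] by simp
  have hm: "h (- x) = - h x" for x using h[of 0 x] h0 by simp
  have ha: "h (x + y) = h x + h y" for x y using h[of x "- y"] hm by simp
  show ?thesis using r
  proof (induction rule: generate.induct)
    case (inv x)
    then have "x \<in> carrier (free_Abelian_group S)" using X by blast
    then have "inv\<^bsub>free_Abelian_group S\<^esub> x = - x" by (intro inv_free_Abelian_group) simp
    then show ?case using gen[OF inv] frag_subgroupD[OF K] by (simp add: hm)
  qed (auto simp: h0 ha frag_subgroupD[OF K] gen)
qed

definition frag_coset :: "('a \<Rightarrow>\<^sub>0 int) set \<Rightarrow> ('a \<Rightarrow>\<^sub>0 int) \<Rightarrow> ('a \<Rightarrow>\<^sub>0 int) set" where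
  "frag_coset K x = (\<lambda>r. r + x) ` K"

lemma r_coset_free_Abelian_group: "K #>\<^bsub>free_Abelian_group S\<^esub> x = frag_coset K x"
  by (auto simp: r_coset_def frag_coset_def)

lemma mem_frag_coset: "y \<in> frag_coset K x \<longleftrightarrow> y - x \<in> K"
proof
  assume "y - x \<in> K"
  then show "y \<in> frag_coset K x"
    unfolding frag_coset_def by (intro image_eqI[of _ _ "y - x"]) auto
qed (auto simp: frag_coset_def)

lemma frag_coset_self: "frag_subgroup K \<Longrightarrow> x \<in> frag_coset K x"
  by (simp add: mem_frag_coset frag_subgroupD(1))

lemma frag_coset_eq_iff:
  assumes K: "frag_subgroup K"
  shows "frag_coset K x = frag_coset K y \<longleftrightarrow> x - y \<in> K"
proof
  assume "frag_coset K x = frag_coset K y"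
  then show "x - y \<in> K" using frag_coset_self[OF K, of x] by (simp add: mem_frag_coset)
next
  assume xy: "x - y \<in> K"
  have "z - x \<in> K \<longleftrightarrow> z - y \<in> K" for z
    using frag_subgroupD(4)[OF K _ xy, of "z - x"] frag_subgroupD(2)[OF K _ xy, of "z - y"] by auto
  then show "frag_coset K x = frag_coset K y" by (auto simp: mem_frag_coset)
qed

lemma frag_coset_representative:
  assumes K: "frag_subgroup K" "K \<subseteq> {c. Poly_Mapping.keys c \<subseteq> S}"
    and a: "a \<in> frag_coset K ` {c. Poly_Mapping.keys c \<subseteq> S}" and p: "p \<in> a"
  shows "Poly_Mapping.keys p \<subseteq> S" "a = frag_coset K p"
proof -
  obtain c where c: "a = frag_coset K c" "Poly_Mapping.keys c \<subseteq> S" using a by auto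
  have pc: "p - c \<in> K" using p c by (simp add: mem_frag_coset)
  show "a = frag_coset K p" using pc frag_coset_eq_iff[OF K(1)] c(1) by metis
  have "Poly_Mapping.keys ((p - c) + c) \<subseteq> S"
    using pc K(2) c(2) keys_add[of "p - c" c] by blast
  then show "Poly_Mapping.keys p \<subseteq> S" by simp
qed

lemma frag_coset_mult:
  assumes K: "frag_subgroup K"
  shows "frag_coset K x <#>\<^bsub>free_Abelian_group S\<^esub> frag_coset K y = frag_coset K (x + y)"
proof -
  have "z \<in> frag_coset K x <#>\<^bsub>free_Abelian_group S\<^esub> frag_coset K y"
    if "z \<in> frag_coset K (x + y)" for z
  proof -
    have "z - y \<in> frag_coset K x" "y \<in> frag_coset K y"
      using that frag_subgroupD(1)[OF K] by (auto simp: mem_frag_coset algebra_simps)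
    then show ?thesis by (force simp: set_mult_def)
  qed
  moreover have "z \<in> frag_coset K (x + y)"
    if z': "z \<in> frag_coset K x <#>\<^bsub>free_Abelian_group S\<^esub> frag_coset K y" for z
  proof -
    obtain a b where "a \<in> frag_coset K x" "b \<in> frag_coset K y" and z: "z = a + b"
      using z' by (auto simp: set_mult_def)
    then have ab: "a - x \<in> K" "b - y \<in> K" by (simp_all add: mem_frag_coset)
    show ?thesis using frag_subgroupD(4)[OF K ab] by (simp add: mem_frag_coset z algebra_simps)
  qed
  ultimately show ?thesis by blast
qed

definition frag_bilinear ::
  "('a \<Rightarrow> 'b \<Rightarrow> 'c \<Rightarrow>\<^sub>0 int) \<Rightarrow> ('a \<Rightarrow>\<^sub>0 int) \<Rightarrow> ('b \<Rightarrow>\<^sub>0 int) \<Rightarrow> 'c \<Rightarrow>\<^sub>0 int" where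
  "frag_bilinear f q p = frag_extend (\<lambda>v. frag_extend (f v) p) q"

lemma frag_bilinear_swap: "frag_bilinear f q p = frag_bilinear (\<lambda>u v. f v u) p q"
  unfolding frag_bilinear_def by (rule frag_extend_swap)

lemma frag_bilinear_of [simp]: "frag_bilinear f (frag_of v) (frag_of u) = f v u"
  by (simp add: frag_bilinear_def)

lemma frag_bilinear_left:
  "frag_bilinear f (q - q') p = frag_bilinear f q p - frag_bilinear f q' p"
  "frag_bilinear f (q + q') p = frag_bilinear f q p + frag_bilinear f q' p"
  by (simp_all add: frag_bilinear_def frag_extend_diff frag_extend_add)

lemma frag_bilinear_right:
  "frag_bilinear f q (p - p') = frag_bilinear f q p - frag_bilinear f q p'"
  "frag_bilinear f q (p + p') = frag_bilinear f q p + frag_bilinear f q p'"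
  by (simp_all add: frag_bilinear_swap[of f q] frag_bilinear_left)

lemma keys_frag_bilinear:
  assumes "\<And>v u. v \<in> Poly_Mapping.keys q \<Longrightarrow> u \<in> Poly_Mapping.keys p \<Longrightarrow> Poly_Mapping.keys (f v u) \<subseteq> S"
  shows "Poly_Mapping.keys (frag_bilinear f q p) \<subseteq> S"
  unfolding frag_bilinear_def
  by (intro order.trans[OF keys_frag_extend] UN_least assms)

lemma frag_bilinear_generate:
  assumes X: "X \<subseteq> carrier (free_Abelian_group S)" and K: "frag_subgroup K"
    and gen: "\<And>x u. x \<in> X \<Longrightarrow> u \<in> Poly_Mapping.keys p \<Longrightarrow> frag_extend (\<lambda>v. f v u) x \<in> K"
    and q: "q \<in> generate (free_Abelian_group S) X"
  shows "frag_bilinear f q p \<in> K"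
  unfolding frag_bilinear_swap[of f] unfolding frag_bilinear_def
  by (rule frag_subgroup_frag_extend[OF K generate_free_Abelian_group_hom[OF X K frag_extend_diff gen q]])

text \<open>Two pairs of representatives are compared by changing one argument at a time: f(q', p')
  - f(q, p) = f(q' - q, p') + f(q, p' - p). Hence all results lie in a single coset, and
  \<open>the_elem\<close> returns it. The compositions on Burnside groups and on tensor products are
  both instances.\<close>

lemma the_elem_frag_bilinear:
  assumes X: "X \<subseteq> carrier (free_Abelian_group S)" and Y: "Y \<subseteq> carrier (free_Abelian_group T)"
    and K: "frag_subgroup K"
    and left: "\<And>x u. x \<in> X \<Longrightarrow> u \<in> T \<Longrightarrow> frag_extend (\<lambda>v. f v u) x \<in> K"
    and right: "\<And>y v. y \<in> Y \<Longrightarrow> v \<in> S \<Longrightarrow> frag_extend (f v) y \<in> K"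
    and b: "b = frag_coset (generate (free_Abelian_group S) X) q" "Poly_Mapping.keys q \<subseteq> S"
    and a: "a = frag_coset (generate (free_Abelian_group T) Y) p" "Poly_Mapping.keys p \<subseteq> T"
  shows "the_elem ((\<lambda>(q, p). frag_coset K (frag_bilinear f q p)) ` (b \<times> a)) =
    frag_coset K (frag_bilinear f q p)" (is "the_elem (?F ` _) = _")
proof -
  have y: "frag_bilinear f q' p' - frag_bilinear f q p \<in> K" if "q' \<in> b" "p' \<in> a" for q' p'
  proof -
    have q: "q' - q \<in> generate (free_Abelian_group S) X" and p: "p' - p \<in> generate (free_Abelian_group T) Y"
      using that a(1) b(1) by (simp_all add: mem_frag_coset)
    \<comment> \<open>The hypothesis \<open>left\<close> speaks only about u in \<open>T\<close>, so
      the changed representative must still be supported there.\<close>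
    have "Poly_Mapping.keys ((p' - p) + p) \<subseteq> T"
      using p a(2) frag_subgroup_generate(2)[OF Y] keys_add[of "p' - p" p] by fastforce
    then have p': "Poly_Mapping.keys p' \<subseteq> T" by simp
    have "frag_bilinear f (q' - q) p' \<in> K"
      by (rule frag_bilinear_generate[OF X K left q]) (use p' in auto)
    moreover have "frag_bilinear f q (p' - p) \<in> K"
      unfolding frag_bilinear_swap[of f q]
      by (rule frag_bilinear_generate[OF Y K right p]) (use b(2) in auto)
    ultimately have "frag_bilinear f (q' - q) p' + frag_bilinear f q (p' - p) \<in> K"
      by (rule frag_subgroupD(4)[OF K])
    then show ?thesis by (simp add: frag_bilinear_left frag_bilinear_right)
  qed
  have "?F z = ?F (q, p)" if "z \<in> b \<times> a" for z
    using that y[of "fst z" "snd z"] by (simp add: case_prod_unfold mem_Times_iff frag_coset_eq_iff[OF K])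
  moreover have "(q, p) \<in> b \<times> a"
    unfolding a(1) b(1) by (intro SigmaI frag_coset_self frag_subgroup_generate X Y)
  ultimately have "?F ` (b \<times> a) = {?F (q, p)}" by blast
  then show ?thesis by simp
qed

section \<open>Composition on Burnside groups\<close>

context
  fixes Z :: "('g, 'z) gset"
begin

lemma burnside_gens:
  "({frag_of S - frag_of T | S T. over_base Z S \<and> over_base Z T \<and> over_iso Z S T} \<union>
    {frag_of W - frag_of S - frag_of T | W S T.
       over_base Z W \<and> over_base Z S \<and> over_base Z T \<and> over_iso Z W (over_sum S T)})
   \<subseteq> carrier (free_Abelian_group {S :: ('g, nat, 'z) over. over_base Z S})"
proof -
  show ?thesis by (auto dest!: subsetD[OF keys_diff])
qed

lemma frag_subgroup_burnside_rel: "frag_subgroup (burnside_rel Z)"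
  and burnside_rel_subset: "burnside_rel Z \<subseteq> {c. Poly_Mapping.keys c \<subseteq> {S. over_base Z S}}"
  unfolding burnside_rel_def burnside_free_def
  using frag_subgroup_generate[OF burnside_gens] by (blast, fastforce)

lemma burnside_rel_hom:
  assumes "frag_subgroup K" "\<And>x y. h (x - y) = h x - h y"
    and "\<And>S T. over_base Z S \<Longrightarrow> over_base Z T \<Longrightarrow> over_iso Z S T \<Longrightarrow> h (frag_of S - frag_of T) \<in> K"
    and "\<And>W S T. over_base Z W \<Longrightarrow> over_base Z S \<Longrightarrow> over_base Z T \<Longrightarrow> over_iso Z W (over_sum S T) \<Longrightarrow>
      h (frag_of W - frag_of S - frag_of T) \<in> K"
    and "r \<in> burnside_rel Z"
  shows "h r \<in> K"
  using generate_free_Abelian_group_hom[OF burnside_gens assms(1,2) _ assms(5)[unfolded burnside_rel_def burnside_free_def]]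
    assms(3,4) by blast

lemma burnside_class_eq: "burnside_class Z S = frag_coset (burnside_rel Z) (frag_of (nat_copy Z S))"
  by (simp add: burnside_class_def burnside_free_def r_coset_free_Abelian_group)

lemma nat_copy_in_burnside_class: "frag_of (nat_copy Z S) \<in> burnside_class Z S"
  unfolding burnside_class_eq by (rule frag_coset_self[OF frag_subgroup_burnside_rel])

lemma carrier_burnside:
  "carrier (burnside Z) = frag_coset (burnside_rel Z) ` {c. Poly_Mapping.keys c \<subseteq> {S. over_base Z S}}"
  by (auto simp: burnside_def FactGroup_def RCOSETS_def burnside_free_def r_coset_free_Abelian_group)

lemma burnside_mult:
  "frag_coset (burnside_rel Z) x \<otimes>\<^bsub>burnside Z\<^esub> frag_coset (burnside_rel Z) y = frag_coset (burnside_rel Z) (x + y)"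
  by (simp add: burnside_def FactGroup_def burnside_free_def frag_coset_mult frag_subgroup_burnside_rel)

lemma carrier_burnsideD:
  assumes "a \<in> carrier (burnside Z)" "p \<in> a"
  shows "Poly_Mapping.keys p \<subseteq> {S. over_base Z S}" "a = frag_coset (burnside_rel Z) p"
  using frag_coset_representative[OF frag_subgroup_burnside_rel burnside_rel_subset _ assms(2)] assms(1)
  by (simp_all add: carrier_burnside)

lemma carrier_burnside_nonempty: "a \<in> carrier (burnside Z) \<Longrightarrow> \<exists>p. p \<in> a"
  using frag_subgroupD(1)[OF frag_subgroup_burnside_rel] by (auto simp: carrier_burnside frag_coset_def)

lemma burnside_rel_nat_copy_iso:
  assumes "over_base Z S" "over_base Z T" "over_iso Z S T"
  shows "frag_of (nat_copy Z S) - frag_of (nat_copy Z T) \<in> burnside_rel Z"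
proof -
  have "over_iso Z (nat_copy Z S) (nat_copy Z T)"
    using over_iso_sym[OF assms(1) conjunct2[OF nat_copy[OF assms(1)]]]
      over_iso_trans[OF assms(3) conjunct2[OF nat_copy[OF assms(2)]]] by (rule over_iso_trans)
  then show ?thesis unfolding burnside_rel_def
    using nat_copy[OF assms(1)] nat_copy[OF assms(2)] by (intro generate.incl UnI1) blast
qed

lemma burnside_rel_nat_copy_sum:
  assumes "over_base Z W" "over_base Z S" "over_base Z T" "over_iso Z W (over_sum S T)"
  shows "frag_of (nat_copy Z W) - frag_of (nat_copy Z S) - frag_of (nat_copy Z T) \<in> burnside_rel Z"
proof -
  have "over_iso Z (nat_copy Z W) (over_sum (nat_copy Z S) (nat_copy Z T))"
    using over_iso_sym[OF assms(1) conjunct2[OF nat_copy[OF assms(1)]]]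
      over_iso_trans[OF assms(4) over_iso_over_sum[OF conjunct2[OF nat_copy[OF assms(2)]]
          conjunct2[OF nat_copy[OF assms(3)]]]] by (rule over_iso_trans)
  then show ?thesis unfolding burnside_rel_def
    using nat_copy[OF assms(1)] nat_copy[OF assms(2)] nat_copy[OF assms(3)]
    by (intro generate.incl UnI2) blast
qed

end

lemma burnside_mult_reps:
  assumes "a \<in> carrier (burnside Z)" "p \<in> a" "a' \<in> carrier (burnside Z)" "p' \<in> a'"
  shows "a \<otimes>\<^bsub>burnside Z\<^esub> a' \<in> carrier (burnside Z)" "p + p' \<in> a \<otimes>\<^bsub>burnside Z\<^esub> a'"
proof -
  note d = carrier_burnsideD[OF assms(1,2)] and d' = carrier_burnsideD[OF assms(3,4)]
  have e: "a \<otimes>\<^bsub>burnside Z\<^esub> a' = frag_coset (burnside_rel Z) (p + p')"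
    unfolding d(2) d'(2) burnside_mult ..
  show "a \<otimes>\<^bsub>burnside Z\<^esub> a' \<in> carrier (burnside Z)"
    unfolding e carrier_burnside using d(1) d'(1) keys_add[of p p'] by blast
  show "p + p' \<in> a \<otimes>\<^bsub>burnside Z\<^esub> a'"
    unfolding e by (rule frag_coset_self[OF frag_subgroup_burnside_rel])
qed

lemma burnside_class_closed:
  "over_base Z S \<Longrightarrow> burnside_class Z S \<in> carrier (burnside Z)"
  unfolding burnside_class_eq carrier_burnside using nat_copy by fastforce

definition frag_comp ::
  "('k, 'z) gset \<Rightarrow> ('h, 'y) gset \<Rightarrow> ('g, 'x) gset \<Rightarrow>
   ('k \<times> 'h, 'z \<times> 'y) fsum \<Rightarrow> ('h \<times> 'g, 'y \<times> 'x) fsum \<Rightarrow> ('k \<times> 'g, 'z \<times> 'x) fsum" where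
  "frag_comp C B A = frag_bilinear (\<lambda>V U. frag_of (nat_copy (ext_prod C A) (span_comp C B A V U)))"

context
  fixes A :: "('g, 'x) gset" and B :: "('h, 'y) gset" and C :: "('k, 'z) gset"
  assumes A: "finite_gset A" and B: "finite_gset B" and C: "finite_gset C"
begin

text \<open>The relations come from isomorphisms and from disjoint unions;
  \<open>span_comp_cong\<close> settles the former, distributivity of composition the latter, in
  each argument separately. From here on any pair of representatives computes the composite.\<close>

lemma burnside_comp_eq:
  assumes b: "b \<in> carrier (burnside (ext_prod C B))" "q \<in> b"
    and a: "a \<in> carrier (burnside (ext_prod B A))" "p \<in> a"
  shows "burnside_comp C B A b a = frag_coset (burnside_rel (ext_prod C A)) (frag_comp C B A q p)"
proof -
  note B' = burnside_rel_def burnside_free_def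
  have "the_elem ((\<lambda>(q, p). frag_coset (burnside_rel (ext_prod C A)) (frag_comp C B A q p)) ` (b \<times> a)) =
      frag_coset (burnside_rel (ext_prod C A)) (frag_comp C B A q p)"
    unfolding frag_comp_def
  proof (rule the_elem_frag_bilinear[OF burnside_gens burnside_gens frag_subgroup_burnside_rel _ _
        carrier_burnsideD(2)[OF b, unfolded B'] carrier_burnsideD(1)[OF b]
        carrier_burnsideD(2)[OF a, unfolded B'] carrier_burnsideD(1)[OF a]], goal_cases)
    case (1 x U)
    then have U: "over_base (ext_prod B A) U" by simp
    from 1(1) show ?case
    proof (elim UnE CollectE exE conjE)
      fix S T assume "x = frag_of S - frag_of T" and ST: "over_base (ext_prod C B) S"
        "over_base (ext_prod C B) T" "over_iso (ext_prod C B) S T"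
      then show ?thesis
        by (simp add: frag_extend_diff)
          (intro burnside_rel_nat_copy_iso over_base_span_comp[OF A B C] span_comp_cong[OF A B C] over_iso_refl U ST)
    next
      fix W S T assume "x = frag_of W - frag_of S - frag_of T" and WST: "over_base (ext_prod C B) W"
        "over_base (ext_prod C B) S" "over_base (ext_prod C B) T" "over_iso (ext_prod C B) W (over_sum S T)"
      then show ?thesis
        by (simp add: frag_extend_diff)
          (rule burnside_rel_nat_copy_sum over_base_span_comp[OF A B C] U WST
            over_iso_trans[OF span_comp_cong[OF A B C U _ U over_base_over_sum _ over_iso_refl]
              span_comp_over_sum_left[OF A B C U]])+
    qed
  next
    case (2 x V)
    then have V: "over_base (ext_prod C B) V" by simp
    from 2(1) show ?case
    proof (elim UnE CollectE exE conjE)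
      fix S T assume "x = frag_of S - frag_of T" and ST: "over_base (ext_prod B A) S"
        "over_base (ext_prod B A) T" "over_iso (ext_prod B A) S T"
      then show ?thesis
        by (simp add: frag_extend_diff)
          (intro burnside_rel_nat_copy_iso over_base_span_comp[OF A B C] span_comp_cong[OF A B C] over_iso_refl V ST)
    next
      fix W S T assume "x = frag_of W - frag_of S - frag_of T" and WST: "over_base (ext_prod B A) W"
        "over_base (ext_prod B A) S" "over_base (ext_prod B A) T" "over_iso (ext_prod B A) W (over_sum S T)"
      then show ?thesis
        by (simp add: frag_extend_diff)
          (rule burnside_rel_nat_copy_sum over_base_span_comp[OF A B C] V WST
            over_iso_trans[OF span_comp_cong[OF A B C _ V over_base_over_sum V over_iso_refl]
              span_comp_over_sum_right[OF A B C]])+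
    qed
  qed
  then show ?thesis
    by (simp add: burnside_comp_def frag_comp_def frag_bilinear_def burnside_free_def r_coset_free_Abelian_group)
qed

lemma keys_frag_comp:
  assumes q: "Poly_Mapping.keys q \<subseteq> {V. over_base (ext_prod C B) V}"
    and p: "Poly_Mapping.keys p \<subseteq> {U. over_base (ext_prod B A) U}"
  shows "Poly_Mapping.keys (frag_comp C B A q p) \<subseteq> {T. over_base (ext_prod C A) T}"
  unfolding frag_comp_def
proof (rule keys_frag_bilinear)
  fix V U assume "V \<in> Poly_Mapping.keys q" "U \<in> Poly_Mapping.keys p"
  then have "over_base (ext_prod C A) (nat_copy (ext_prod C A) (span_comp C B A V U))"
    using nat_copy[OF over_base_span_comp(1)[OF A B C, of V U]] q p by auto
  then show "Poly_Mapping.keys (frag_of (nat_copy (ext_prod C A) (span_comp C B A V U))) \<subseteq>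
      {T. over_base (ext_prod C A) T}" by simp
qed

lemma burnside_comp_closed:
  assumes b: "b \<in> carrier (burnside (ext_prod C B))" and a: "a \<in> carrier (burnside (ext_prod B A))"
  shows "burnside_comp C B A b a \<in> carrier (burnside (ext_prod C A))"
proof -
  obtain q p where qp: "q \<in> b" "p \<in> a"
    using carrier_burnside_nonempty[OF a] carrier_burnside_nonempty[OF b] by blast
  show ?thesis
    unfolding burnside_comp_eq[OF b qp(1) a qp(2)] carrier_burnside
    using keys_frag_comp[OF carrier_burnsideD(1)[OF b qp(1)] carrier_burnsideD(1)[OF a qp(2)]] by blast
qed

lemma burnside_comp_mult_left:
  assumes b: "b \<in> carrier (burnside (ext_prod C B))" "b' \<in> carrier (burnside (ext_prod C B))"
    and a: "a \<in> carrier (burnside (ext_prod B A))"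
  shows "burnside_comp C B A (b \<otimes>\<^bsub>burnside (ext_prod C B)\<^esub> b') a =
    burnside_comp C B A b a \<otimes>\<^bsub>burnside (ext_prod C A)\<^esub> burnside_comp C B A b' a"
proof -
  obtain q q' p where qp: "q \<in> b" "q' \<in> b'" "p \<in> a"
    using carrier_burnside_nonempty[OF a] carrier_burnside_nonempty[OF b(1)]
      carrier_burnside_nonempty[OF b(2)] by blast
  note m = burnside_mult_reps[OF b(1) qp(1) b(2) qp(2)]
  show ?thesis
    by (simp add: burnside_comp_eq[OF m a qp(3)] burnside_comp_eq[OF b(1) qp(1) a qp(3)]
        burnside_comp_eq[OF b(2) qp(2) a qp(3)] burnside_mult frag_comp_def frag_bilinear_left)
qed

lemma burnside_comp_mult_right:
  assumes b: "b \<in> carrier (burnside (ext_prod C B))"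
    and a: "a \<in> carrier (burnside (ext_prod B A))" "a' \<in> carrier (burnside (ext_prod B A))"
  shows "burnside_comp C B A b (a \<otimes>\<^bsub>burnside (ext_prod B A)\<^esub> a') =
    burnside_comp C B A b a \<otimes>\<^bsub>burnside (ext_prod C A)\<^esub> burnside_comp C B A b a'"
proof -
  obtain q p p' where qp: "q \<in> b" "p \<in> a" "p' \<in> a'"
    using carrier_burnside_nonempty[OF a(1)] carrier_burnside_nonempty[OF a(2)]
      carrier_burnside_nonempty[OF b] by blast
  note m = burnside_mult_reps[OF a(1) qp(2) a(2) qp(3)]
  show ?thesis
    by (simp add: burnside_comp_eq[OF b qp(1) m] burnside_comp_eq[OF b qp(1) a(1) qp(2)]
        burnside_comp_eq[OF b qp(1) a(2) qp(3)] burnside_mult frag_comp_def frag_bilinear_right)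
qed

text \<open>\<open>burnside_class\<close> replaces a span by its copy on natural numbers, so the
  composite of two copies has to be compared with the copy of the composite; congruence of
  composition makes them isomorphic.\<close>

lemma burnside_comp_class:
  assumes V: "over_base (ext_prod C B) V" and U: "over_base (ext_prod B A) U"
  shows "burnside_comp C B A (burnside_class (ext_prod C B) V) (burnside_class (ext_prod B A) U) =
    burnside_class (ext_prod C A) (span_comp C B A V U)"
proof -
  let ?V = "nat_copy (ext_prod C B) V" and ?U = "nat_copy (ext_prod B A) U"
  note mem = nat_copy_in_burnside_class
  have n: "over_base (ext_prod C B) ?V" "over_base (ext_prod B A) ?U"
      "over_iso (ext_prod C B) V ?V" "over_iso (ext_prod B A) U ?U"
    using nat_copy[OF V] nat_copy[OF U] by auto
  have "burnside_comp C B A (burnside_class (ext_prod C B) V) (burnside_class (ext_prod B A) U) =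
      frag_coset (burnside_rel (ext_prod C A)) (frag_of (nat_copy (ext_prod C A) (span_comp C B A ?V ?U)))"
    by (subst burnside_comp_eq[OF burnside_class_closed[OF V] mem burnside_class_closed[OF U] mem])
      (simp add: frag_comp_def)
  also have "\<dots> = burnside_class (ext_prod C A) (span_comp C B A V U)"
    unfolding burnside_class_eq frag_coset_eq_iff[OF frag_subgroup_burnside_rel]
    by (intro burnside_rel_nat_copy_iso over_base_span_comp[OF A B C] n V U
        over_iso_sym[OF _ span_comp_cong[OF A B C U V n(2,1) n(3,4)]])
  finally show ?thesis .
qed

end

section \<open>Composition on tensor products\<close>

text \<open>Closure under products keeps the biadditivity relations inside the free group on pairs
  (r, a) with a in the carrier, so that \<open>generate\<close> yields a subgroup of it.\<close>

definition mult_closed :: "'m monoid \<Rightarrow> bool" where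
  "mult_closed M \<longleftrightarrow> (\<forall>a \<in> carrier M. \<forall>b \<in> carrier M. a \<otimes>\<^bsub>M\<^esub> b \<in> carrier M)"

context
  fixes M :: "'m monoid"
  assumes M: "mult_closed M"
begin

lemma tensor_gens:
  "({frag_of (r + s, a) - frag_of (r, a) - frag_of (s, a) | r s a. a \<in> carrier M} \<union>
    {frag_of (r, a \<otimes>\<^bsub>M\<^esub> b) - frag_of (r, a) - frag_of (r, b) | r a b.
       a \<in> carrier M \<and> b \<in> carrier M})
   \<subseteq> carrier (free_Abelian_group ((UNIV :: 'r::comm_ring_1 set) \<times> carrier M))"
  using M by (auto dest!: subsetD[OF keys_diff] simp: mult_closed_def)

lemma frag_subgroup_tensor_rel: "frag_subgroup (tensor_rel M :: ('r::comm_ring_1, 'm) tens set)"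
  and tensor_rel_subset: "(tensor_rel M :: ('r, 'm) tens set) \<subseteq> {c. Poly_Mapping.keys c \<subseteq> UNIV \<times> carrier M}"
  unfolding tensor_rel_def tensor_free_def
  using frag_subgroup_generate[OF tensor_gens] by (blast, fastforce)

lemma tensor_rel_hom:
  assumes "frag_subgroup K" "\<And>x y. h (x - y) = h x - h y"
    and "\<And>r s a. a \<in> carrier M \<Longrightarrow> h (frag_of (r + s, a) - frag_of (r, a) - frag_of (s, a)) \<in> K"
    and "\<And>r a b. a \<in> carrier M \<Longrightarrow> b \<in> carrier M \<Longrightarrow>
      h (frag_of (r, a \<otimes>\<^bsub>M\<^esub> b) - frag_of (r, a) - frag_of (r, b)) \<in> K"
    and "x \<in> (tensor_rel M :: ('r::comm_ring_1, 'm) tens set)"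
  shows "h x \<in> K"
  using generate_free_Abelian_group_hom[OF tensor_gens assms(1,2) _ assms(5)[unfolded tensor_rel_def tensor_free_def]]
    assms(3,4) by blast

lemma pure_tensor_eq: "pure_tensor M r a = frag_coset (tensor_rel M) (frag_of (r, a))"
  by (simp add: pure_tensor_def tensor_free_def r_coset_free_Abelian_group)

lemma carrier_tensor:
  "carrier (tensor M :: ('r::comm_ring_1, 'm) tens set monoid) =
    frag_coset (tensor_rel M) ` {c. Poly_Mapping.keys c \<subseteq> UNIV \<times> carrier M}"
  by (auto simp: tensor_def FactGroup_def RCOSETS_def tensor_free_def r_coset_free_Abelian_group)

lemma carrier_tensorD:
  assumes "a \<in> carrier (tensor M :: ('r::comm_ring_1, 'm) tens set monoid)" "p \<in> a"
  shows "Poly_Mapping.keys p \<subseteq> UNIV \<times> carrier M" "a = frag_coset (tensor_rel M) p"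
  using frag_coset_representative[OF frag_subgroup_tensor_rel tensor_rel_subset _ assms(2)] assms(1)
  by (simp_all add: carrier_tensor)

lemma carrier_tensor_nonempty:
  "a \<in> carrier (tensor M :: ('r::comm_ring_1, 'm) tens set monoid) \<Longrightarrow> \<exists>p. p \<in> a"
  using frag_subgroupD(1)[OF frag_subgroup_tensor_rel] by (auto simp: carrier_tensor frag_coset_def)

end

lemma mult_closed_burnside: "mult_closed (burnside Z)"
  unfolding mult_closed_def using burnside_mult_reps(1) carrier_burnside_nonempty by metis

definition tens_comp ::
  "('k, 'z) gset \<Rightarrow> ('h, 'y) gset \<Rightarrow> ('g, 'x) gset \<Rightarrow>
   ('r::comm_ring_1, ('k \<times> 'h, 'z \<times> 'y) fsum set) tens \<Rightarrow> ('r, ('h \<times> 'g, 'y \<times> 'x) fsum set) tens \<Rightarrow>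
   ('r, ('k \<times> 'g, 'z \<times> 'x) fsum set) tens" where
  "tens_comp C B A = frag_bilinear (\<lambda>(r, b) (s, a). frag_of (r * s, burnside_comp C B A b a))"

context
  fixes A :: "('g, 'x) gset" and B :: "('h, 'y) gset" and C :: "('k, 'z) gset"
  assumes A: "finite_gset A" and B: "finite_gset B" and C: "finite_gset C"
begin

text \<open>The same scheme one level higher: distributivity in R accounts for sums of scalars,
  biadditivity of \<open>burnside_comp\<close> for products in the Burnside groups.\<close>

lemma comp_C_eq:
  fixes \<psi> :: "('r::comm_ring_1, 'k, 'z, 'h, 'y) morph" and \<phi> :: "('r, 'h, 'y, 'g, 'x) morph"
  assumes b: "\<psi> \<in> Hom_C B C" "q \<in> \<psi>" and a: "\<phi> \<in> Hom_C A B" "p \<in> \<phi>"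
  shows "comp_C C B A \<psi> \<phi> = frag_coset (tensor_rel (burnside (ext_prod C A))) (tens_comp C B A q p)"
proof -
  note K = frag_subgroup_tensor_rel[OF mult_closed_burnside]
  note d = carrier_tensorD[OF mult_closed_burnside]
  note b = b[unfolded Hom_C_def] and a = a[unfolded Hom_C_def] and T = tensor_rel_def tensor_free_def
  have "the_elem ((\<lambda>(q, p). frag_coset (tensor_rel (burnside (ext_prod C A))) (tens_comp C B A q p)) ` (\<psi> \<times> \<phi>)) =
      frag_coset (tensor_rel (burnside (ext_prod C A))) (tens_comp C B A q p)"
    unfolding tens_comp_def
  proof (rule the_elem_frag_bilinear[OF tensor_gens[OF mult_closed_burnside] tensor_gens[OF mult_closed_burnside]
        K _ _ d(2)[OF b, unfolded T] d(1)[OF b] d(2)[OF a, unfolded T] d(1)[OF a]], goal_cases)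
    case (1 x u)
    then obtain s a where u: "u = (s, a)" "a \<in> carrier (burnside (ext_prod B A))" by auto
    note cl = burnside_comp_closed[OF A B C _ u(2)]
    from 1(1) show ?case
    proof (elim UnE CollectE exE conjE)
      fix r r' b assume "x = frag_of (r + r', b) - frag_of (r, b) - frag_of (r', b)"
        and "b \<in> carrier (burnside (ext_prod C B))"
      then show ?thesis unfolding T u(1) using cl
        by (simp add: frag_extend_diff distrib_right) (rule generate.incl, blast)
    next
      fix r b b' assume "x = frag_of (r, b \<otimes>\<^bsub>burnside (ext_prod C B)\<^esub> b') - frag_of (r, b) - frag_of (r, b')"
        and b: "b \<in> carrier (burnside (ext_prod C B))" "b' \<in> carrier (burnside (ext_prod C B))"
      then show ?thesis unfolding T u(1) using cl[OF b(1)] cl[OF b(2)]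
        by (simp add: frag_extend_diff burnside_comp_mult_left[OF A B C b u(2)]) (rule generate.incl, blast)
    qed
  next
    case (2 x v)
    then obtain r b where v: "v = (r, b)" "b \<in> carrier (burnside (ext_prod C B))" by auto
    note cl = burnside_comp_closed[OF A B C v(2)]
    from 2(1) show ?case
    proof (elim UnE CollectE exE conjE)
      fix s s' a assume "x = frag_of (s + s', a) - frag_of (s, a) - frag_of (s', a)"
        and "a \<in> carrier (burnside (ext_prod B A))"
      then show ?thesis unfolding T v(1) using cl
        by (simp add: frag_extend_diff distrib_left) (rule generate.incl, blast)
    next
      fix s a a' assume "x = frag_of (s, a \<otimes>\<^bsub>burnside (ext_prod B A)\<^esub> a') - frag_of (s, a) - frag_of (s, a')"
        and a: "a \<in> carrier (burnside (ext_prod B A))" "a' \<in> carrier (burnside (ext_prod B A))"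
      then show ?thesis unfolding T v(1) using cl[OF a(1)] cl[OF a(2)]
        by (simp add: frag_extend_diff burnside_comp_mult_right[OF A B C v(2) a]) (rule generate.incl, blast)
    qed
  qed
  then show ?thesis
    by (simp add: comp_C_def tens_comp_def frag_bilinear_def tensor_free_def r_coset_free_Abelian_group case_prod_unfold)
qed

end

definition span_hom :: "('g, 'x) gset \<Rightarrow> ('h, 'y) gset \<Rightarrow> ('h, 'y, 'g, 'x, 'u) span \<Rightarrow>
    ('r::comm_ring_1, 'h, 'y, 'g, 'x) morph" where
  "span_hom A B U = pure_tensor (burnside (ext_prod B A)) 1 (burnside_class (ext_prod B A) U)"

lemma span_hom_in_Hom_C:
  assumes "over_base (ext_prod B A) U"
  shows "span_hom A B U \<in> Hom_C A B"
    and "frag_of (1, burnside_class (ext_prod B A) U) \<in> span_hom A B U"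
proof -
  show "frag_of (1, burnside_class (ext_prod B A) U) \<in> span_hom A B U"
    unfolding span_hom_def pure_tensor_eq[OF mult_closed_burnside] mem_frag_coset
    using frag_subgroupD(1)[OF frag_subgroup_tensor_rel[OF mult_closed_burnside]] by simp
  show "span_hom A B U \<in> Hom_C A B"
    unfolding span_hom_def pure_tensor_eq[OF mult_closed_burnside] Hom_C_def carrier_tensor[OF mult_closed_burnside]
    using burnside_class_closed[OF assms] by (intro imageI) simp
qed

lemma comp_C_span_hom:
  assumes A: "finite_gset A" and B: "finite_gset B" and C: "finite_gset C"
    and U: "over_base (ext_prod B A) U" and V: "over_base (ext_prod C B) V"
  shows "comp_C C B A (span_hom B C V) (span_hom A B U :: ('r::comm_ring_1, 'h, 'y, 'g, 'x) morph) =
    span_hom A C (span_comp C B A V U)"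
  by (subst comp_C_eq[OF A B C span_hom_in_Hom_C[OF V] span_hom_in_Hom_C[OF U]])
    (simp add: tens_comp_def burnside_comp_class[OF A B C V U] span_hom_def pure_tensor_eq mult_closed_burnside)

lemma span_hom_cong:
  assumes "over_base (ext_prod B A) U" "over_base (ext_prod B A) U'" "over_iso (ext_prod B A) U U'"
  shows "span_hom A B U = span_hom A B U'"
proof -
  have "burnside_class (ext_prod B A) U = burnside_class (ext_prod B A) U'"
    unfolding burnside_class_eq frag_coset_eq_iff[OF frag_subgroup_burnside_rel]
    by (rule burnside_rel_nat_copy_iso[OF assms])
  then show ?thesis by (simp add: span_hom_def)
qed

lemma iso_C_spanI:
  assumes A: "finite_gset A" and B: "finite_gset B"
    and U: "over_base (ext_prod B A) U" and V: "over_base (ext_prod A B) V"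
    and VU: "over_iso (ext_prod A A) (span_comp A B A V U) (id_span A)"
    and UV: "over_iso (ext_prod B B) (span_comp B A B U V) (id_span B)"
  shows "iso_C TYPE('r::comm_ring_1) A B"
proof -
  have "comp_C A B A (span_hom B A V) (span_hom A B U) =
      (id_C A :: ('r, _, _, _, _) morph)"
    unfolding comp_C_span_hom[OF A B A U V] span_hom_cong[OF over_base_span_comp(1)[OF A B A V U]
        over_base_id_span[OF A] VU] by (simp add: span_hom_def id_C_def)
  moreover have "comp_C B A B (span_hom A B U) (span_hom B A V) =
      (id_C B :: ('r, _, _, _, _) morph)"
    unfolding comp_C_span_hom[OF B A B V U] span_hom_cong[OF over_base_span_comp(1)[OF B A B U V]
        over_base_id_span[OF B] UV] by (simp add: span_hom_def id_C_def)
  ultimately show ?thesis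
    unfolding iso_C_def using span_hom_in_Hom_C(1)[OF U] span_hom_in_Hom_C(1)[OF V] by blast
qed

section \<open>Ring-valued functionals on formal sums\<close>

text \<open>\<open>frag_extend\<close> takes values in formal sums; here the values lie in R, and
  the integer coefficients are read there through \<open>of_int\<close>.\<close>

definition frag_eval :: "('a \<Rightarrow> 'r::comm_ring_1) \<Rightarrow> ('a \<Rightarrow>\<^sub>0 int) \<Rightarrow> 'r" where
  "frag_eval f p = (\<Sum>k \<in> Poly_Mapping.keys p. of_int (poly_mapping.lookup p k) * f k)"

lemma frag_eval_superset:
  assumes "finite S" "Poly_Mapping.keys p \<subseteq> S"
  shows "frag_eval f p = (\<Sum>k \<in> S. of_int (poly_mapping.lookup p k) * f k)"
  unfolding frag_eval_def
  by (rule sum.mono_neutral_left) (use assms in \<open>auto simp: in_keys_iff\<close>)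

lemma frag_eval_diff: "frag_eval f (p - q) = frag_eval f p - frag_eval f q"
proof -
  let ?S = "Poly_Mapping.keys p \<union> Poly_Mapping.keys q"
  have "Poly_Mapping.keys (p - q) \<subseteq> ?S" by (rule keys_diff)
  then show ?thesis
    by (simp add: frag_eval_superset[of ?S] lookup_minus left_diff_distrib sum_subtractf)
qed

lemma frag_eval_0 [simp]: "frag_eval f 0 = 0"
  and frag_eval_of [simp]: "frag_eval f (frag_of a) = f a"
  by (simp_all add: frag_eval_def)

lemma frag_eval_frag_extend: "frag_eval f (frag_extend g p) = frag_eval (\<lambda>k. frag_eval f (g k)) p"
  by (rule frag_induction[of p UNIV]) (auto simp: frag_extend_diff frag_eval_diff)

lemma frag_eval_cong: "(\<And>k. k \<in> Poly_Mapping.keys p \<Longrightarrow> f k = g k) \<Longrightarrow> frag_eval f p = frag_eval g p"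
  by (simp add: frag_eval_def)

lemma frag_eval_mult_left: "frag_eval (\<lambda>k. c * f k) p = c * frag_eval f p"
  unfolding frag_eval_def sum_distrib_left by (rule sum.cong) (simp_all add: mult_ac)

lemma frag_eval_mult_right: "frag_eval (\<lambda>k. f k * c) p = frag_eval f p * c"
  unfolding frag_eval_def sum_distrib_right by (rule sum.cong) (simp_all add: mult_ac)

lemma frag_eval_sum: "frag_eval (\<lambda>k. \<Sum>d\<in>D. f d k) p = (\<Sum>d\<in>D. frag_eval (f d) p)"
  unfolding frag_eval_def sum_distrib_left by (rule sum.swap)

lemma frag_subgroup_kernel: "frag_subgroup {p. frag_eval f p = 0}"
  by (simp add: frag_subgroup_def frag_eval_diff)

lemma frag_eval_burnside_rel:
  assumes iso: "\<And>S T. over_base Z S \<Longrightarrow> over_base Z T \<Longrightarrow> over_iso Z S T \<Longrightarrow> f S = f T"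
    and sum: "\<And>W S T. over_base Z W \<Longrightarrow> over_base Z S \<Longrightarrow> over_base Z T \<Longrightarrow> over_iso Z W (over_sum S T) \<Longrightarrow>
      f W = f S + f T"
    and r: "r \<in> burnside_rel Z"
  shows "frag_eval f r = 0"
  using burnside_rel_hom[where h = id and K = "{p. frag_eval f p = 0}", OF frag_subgroup_kernel _ _ _ r]
  by (auto simp: frag_eval_diff iso sum)

text \<open>For additive f the functional (s, a) \<mapsto> s f(a) is biadditive, so it kills the
  generating relations, and its kernel is a subgroup.\<close>

lemma frag_eval_tensor_rel:
  assumes M: "mult_closed M"
    and f: "\<And>a b. a \<in> carrier M \<Longrightarrow> b \<in> carrier M \<Longrightarrow> f (a \<otimes>\<^bsub>M\<^esub> b) = f a + f b"
    and r: "r \<in> tensor_rel M"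
  shows "frag_eval (\<lambda>(s, a). s * f a) r = 0"
  using tensor_rel_hom[where h = id and K = "{p. frag_eval (\<lambda>(s, a). s * f a) p = 0}", OF M frag_subgroup_kernel _ _ _ r]
  by (simp add: frag_eval_diff f distrib_left distrib_right)

section \<open>Orbit types\<close>

definition orb :: "('g, 'z) gset \<Rightarrow> ('g, 's, 'z) over \<Rightarrow> 's \<Rightarrow> 's set" where
  "orb Z S s = (\<lambda>g. oact S g s) ` carrier (grp Z)"

text \<open>Base point and stabilizer: up to simultaneous translation and conjugation (see
  \<open>tclass\<close>), this pair determines a transitive set over \<open>Z\<close>.\<close>

definition otyp :: "('g, 'z) gset \<Rightarrow> ('g, 's, 'z) over \<Rightarrow> 's \<Rightarrow> 'z \<times> 'g set" where
  "otyp Z S s = (str S s, {g \<in> carrier (grp Z). oact S g s = s})"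

text \<open>The type of an orbit is the whole set of pairs met along it, a full class under
  translation and conjugation, so no base point has to be chosen.\<close>

definition ocount :: "('g, 'z) gset \<Rightarrow> ('z \<times> 'g set) set \<Rightarrow> ('g, 's, 'z) over \<Rightarrow> nat" where
  "ocount Z c S = card {X \<in> orb Z S ` tot S. otyp Z S ` X = c}"

definition otransitive :: "('g, 'z) gset \<Rightarrow> ('g, 's, 'z) over \<Rightarrow> bool" where
  "otransitive Z S \<longleftrightarrow> (\<exists>s \<in> tot S. tot S = orb Z S s)"

lemma over_isoE:
  assumes S: "over_base Z S" and ST: "over_iso Z S T"
  obtains f where "bij_betw f (tot S) (tot T)"
    "\<And>g s. g \<in> carrier (grp Z) \<Longrightarrow> s \<in> tot S \<Longrightarrow> f (oact S g s) = oact T g (f s)"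
    "\<And>s. s \<in> tot S \<Longrightarrow> otyp Z T (f s) = otyp Z S s"
    "\<And>s. s \<in> tot S \<Longrightarrow> orb Z T (f s) = f ` orb Z S s"
proof -
  obtain f where f: "bij_betw f (tot S) (tot T)"
      "\<And>g s. g \<in> carrier (grp Z) \<Longrightarrow> s \<in> tot S \<Longrightarrow> f (oact S g s) = oact T g (f s)"
      "\<And>s. s \<in> tot S \<Longrightarrow> str T (f s) = str S s"
    using ST unfolding over_iso_def by metis
  have ga: "group_action (grp Z) (tot S) (oact S)" using S by (simp add: over_base_def)
  have "oact T g (f s) = f s \<longleftrightarrow> oact S g s = s" if "g \<in> carrier (grp Z)" "s \<in> tot S" for g s
    using f(2)[OF that] inj_on_eq_iff[OF bij_betw_imp_inj_on[OF f(1)] group_actionD(3)[OF ga that] that(2)]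
    by metis
  then have "otyp Z T (f s) = otyp Z S s" if "s \<in> tot S" for s
    using that f(3) by (auto simp: otyp_def)
  moreover have "orb Z T (f s) = f ` orb Z S s" if "s \<in> tot S" for s
    unfolding orb_def image_image using that f(2) by (intro image_cong) auto
  ultimately show ?thesis using that f(1,2) by blast
qed

lemma orb_subset:
  assumes S: "over_base Z S" and s: "s \<in> tot S"
  shows "orb Z S s \<subseteq> tot S"
  using assms group_actionD(3)[of "grp Z" "tot S" "oact S"] by (auto simp: orb_def over_base_def)

lemma orb_refl:
  assumes S: "over_base Z S" and s: "s \<in> tot S"
  shows "s \<in> orb Z S s"
proof -
  have ga: "group_action (grp Z) (tot S) (oact S)" using S by (simp add: over_base_def)
  interpret group "grp Z" by (rule group_actionD[OF ga])
  show ?thesis unfolding orb_def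
    by (rule image_eqI[of _ _ "\<one>\<^bsub>grp Z\<^esub>"]) (use group_actionD(4)[OF ga s] in auto)
qed

lemma orb_closed:
  assumes S: "over_base Z S" and s: "s \<in> tot S" and g: "g \<in> carrier (grp Z)" and x: "x \<in> orb Z S s"
  shows "oact S g x \<in> orb Z S s"
proof -
  have ga: "group_action (grp Z) (tot S) (oact S)" using S by (simp add: over_base_def)
  interpret group "grp Z" by (rule group_actionD[OF ga])
  show ?thesis using x g s by (auto simp: orb_def group_actionD(5)[OF ga, symmetric])
qed

lemma orb_eq:
  assumes S: "over_base Z S" and s: "s \<in> tot S" and x: "x \<in> orb Z S s"
  shows "orb Z S x = orb Z S s"
proof -
  have ga: "group_action (grp Z) (tot S) (oact S)" using S by (simp add: over_base_def)
  interpret group "grp Z" by (rule group_actionD[OF ga])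
  obtain g where g: "g \<in> carrier (grp Z)" "x = oact S g s" using x by (auto simp: orb_def)
  have "s = oact S (inv\<^bsub>grp Z\<^esub> g) x"
    using g s by (simp add: group_actionD(4,5)[OF ga] group_actionD(5)[OF ga, symmetric])
  then have "s \<in> orb Z S x" using g by (auto simp: orb_def)
  moreover have "x \<in> tot S" using orb_subset[OF S s] x by blast
  moreover have "orb Z S y \<subseteq> orb Z S y'" if "y' \<in> tot S" "y \<in> orb Z S y'" for y y'
    using orb_closed[OF S that(1) _ that(2)] by (auto simp: orb_def[of _ _ y])
  ultimately show ?thesis using x s by blast
qed

lemma orbits_subset:
  assumes S: "over_base Z S" and X: "X \<in> orb Z S ` tot S"
  shows "X \<subseteq> tot S"
  using orb_subset[OF S] X by blast

lemma otransitiveD: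
  assumes S: "over_base Z S" and tr: "otransitive Z S" and s: "s \<in> tot S"
  shows "orb Z S s = tot S"
proof -
  obtain x where "x \<in> tot S" "tot S = orb Z S x" using tr unfolding otransitive_def by blast
  then show ?thesis using orb_eq[OF S, of x s] s by simp
qed

lemma ocount_over_iso:
  assumes S: "over_base Z S" and ST: "over_iso Z S T"
  shows "ocount Z c S = ocount Z c T"
proof -
  obtain f where f: "bij_betw f (tot S) (tot T)"
      and "\<And>g s. g \<in> carrier (grp Z) \<Longrightarrow> s \<in> tot S \<Longrightarrow> f (oact S g s) = oact T g (f s)"
      and f_typ: "\<And>s. s \<in> tot S \<Longrightarrow> otyp Z T (f s) = otyp Z S s"
      and f_orb: "\<And>s. s \<in> tot S \<Longrightarrow> orb Z T (f s) = f ` orb Z S s"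
    by (fact over_isoE[OF assms])
  have ty: "otyp Z T ` f ` X = otyp Z S ` X" if "X \<in> orb Z S ` tot S" for X
    unfolding image_image using f_typ orbits_subset[OF S that] by (intro image_cong) auto
  have "bij_betw (image f) {X \<in> orb Z S ` tot S. otyp Z S ` X = c} {X \<in> orb Z T ` tot T. otyp Z T ` X = c}"
  proof (rule bij_betw_imageI)
    show "inj_on (image f) {X \<in> orb Z S ` tot S. otyp Z S ` X = c}"
    proof (rule inj_onI, clarify)
      fix x y assume "x \<in> tot S" "y \<in> tot S" "f ` orb Z S x = f ` orb Z S y"
      then show "orb Z S x = orb Z S y"
        using inj_on_image_eq_iff[OF bij_betw_imp_inj_on[OF f] orb_subset[OF S] orb_subset[OF S]] by simp
    qed
    have "orb Z T ` tot T = image f ` orb Z S ` tot S"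
      unfolding bij_betw_imp_surj_on[OF f, symmetric] image_image using f_orb by (intro image_cong) auto
    then show "image f ` {X \<in> orb Z S ` tot S. otyp Z S ` X = c} = {X \<in> orb Z T ` tot T. otyp Z T ` X = c}"
    proof -
      assume O: "orb Z T ` tot T = image f ` orb Z S ` tot S"
      have "{X \<in> orb Z T ` tot T. otyp Z T ` X = c} =
          image f ` {X \<in> orb Z S ` tot S. otyp Z T ` f ` X = c}"
        unfolding O by blast
      also have "{X \<in> orb Z S ` tot S. otyp Z T ` f ` X = c} = {X \<in> orb Z S ` tot S. otyp Z S ` X = c}"
        by (intro Collect_cong conj_cong refl) (simp add: ty)
      finally show ?thesis ..
    qed
  qed
  then show ?thesis unfolding ocount_def by (rule bij_betw_same_card)
qed

text \<open>Each orbit of a disjoint union lies in one summand. Together with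
  \<open>ocount_over_iso\<close> this is the additivity that makes orbit counts functions on the
  Grothendieck group.\<close>

lemma ocount_over_sum:
  fixes S :: "('g, 's, 'z) over" and T :: "('g, 't, 'z) over"
  assumes S: "over_base Z S" and T: "over_base Z T"
  shows "ocount Z c (over_sum S T) = ocount Z c S + ocount Z c T"
proof -
  let ?W = "over_sum S T"
  have o: "orb Z ?W (Inl s) = Inl ` orb Z S s" "otyp Z ?W (Inl s) = otyp Z S s" if "s \<in> tot S" for s
    using that by (auto simp: orb_def otyp_def over_sum_simps image_image)
  have o': "orb Z ?W (Inr t) = Inr ` orb Z T t" "otyp Z ?W (Inr t) = otyp Z T t" if "t \<in> tot T" for t
    using that by (auto simp: orb_def otyp_def over_sum_simps image_image)
  have t: "otyp Z ?W ` Inl ` X = otyp Z S ` X" if "X \<in> orb Z S ` tot S" for X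
    unfolding image_image using o(2) orbits_subset[OF S that] by (intro image_cong) auto
  have t': "otyp Z ?W ` Inr ` X = otyp Z T ` X" if "X \<in> orb Z T ` tot T" for X
    unfolding image_image using o'(2) orbits_subset[OF T that] by (intro image_cong) auto
  let ?S = "{X \<in> orb Z S ` tot S. otyp Z S ` X = c}" and ?T = "{X \<in> orb Z T ` tot T. otyp Z T ` X = c}"
  have W: "orb Z ?W ` tot ?W = image Inl ` orb Z S ` tot S \<union> image Inr ` orb Z T ` tot T"
    by (auto simp: over_sum_simps Plus_def image_Un image_image o o')
  have "{X \<in> orb Z ?W ` tot ?W. otyp Z ?W ` X = c} = image Inl ` ?S \<union> image Inr ` ?T"
  proof -
    have "{X \<in> orb Z ?W ` tot ?W. otyp Z ?W ` X = c} =
        image Inl ` {X \<in> orb Z S ` tot S. otyp Z ?W ` Inl ` X = c} \<union>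
        image Inr ` {X \<in> orb Z T ` tot T. otyp Z ?W ` Inr ` X = c}"
      unfolding W by blast
    also have "{X \<in> orb Z S ` tot S. otyp Z ?W ` Inl ` X = c} = ?S"
      by (intro Collect_cong conj_cong refl) (simp add: t)
    also have "{X \<in> orb Z T ` tot T. otyp Z ?W ` Inr ` X = c} = ?T"
      by (intro Collect_cong conj_cong refl) (simp add: t')
    finally show ?thesis .
  qed
  moreover have "image Inl ` ?S \<inter> image Inr ` ?T = {}"
  proof -
    \<comment> \<open>Orbits are nonempty, so an orbit on the left is never one on the
      right.\<close>
    have "Inl ` orb Z S s \<noteq> Inr ` orb Z T t" if "s \<in> tot S" for s t
      using orb_refl[OF S that] by blast
    then show ?thesis by auto
  qed
  moreover have "card (image (Inl :: 's \<Rightarrow> 's + 't) ` ?S) = card ?S"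
      "card (image (Inr :: 't \<Rightarrow> 's + 't) ` ?T) = card ?T"
    by (auto intro!: card_image inj_onI simp: inj_image_eq_iff)
  moreover have "finite ?S" "finite ?T" using S T by (simp_all add: over_base_def)
  ultimately show ?thesis
    unfolding ocount_def by (simp only: card_Un_disjoint finite_imageI)
qed

lemma ocount_otransitive:
  assumes S: "over_base Z S" and tr: "otransitive Z S"
  shows "ocount Z c S = (if otyp Z S ` tot S = c then 1 else 0)"
proof -
  have "orb Z S ` tot S = {tot S}"
    using tr otransitiveD[OF S tr] by (auto simp: otransitive_def)
  moreover have "{X \<in> {tot S}. otyp Z S ` X = c} = (if otyp Z S ` tot S = c then {tot S} else {})"
    by auto
  ultimately show ?thesis by (simp add: ocount_def)
qed

lemma otransitive_over_iso:
  assumes S: "over_base Z S" and ST: "over_iso Z S T" and tr: "otransitive Z S"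
  shows "otransitive Z T" "otyp Z T ` tot T = otyp Z S ` tot S"
proof -
  obtain f where f: "bij_betw f (tot S) (tot T)"
      and "\<And>g s. g \<in> carrier (grp Z) \<Longrightarrow> s \<in> tot S \<Longrightarrow> f (oact S g s) = oact T g (f s)"
      and f_typ: "\<And>s. s \<in> tot S \<Longrightarrow> otyp Z T (f s) = otyp Z S s"
      and f_orb: "\<And>s. s \<in> tot S \<Longrightarrow> orb Z T (f s) = f ` orb Z S s"
    by (fact over_isoE[OF S ST])
  have T: "tot T = f ` tot S" using f by (simp add: bij_betw_def)
  show "otransitive Z T" using tr f_orb unfolding otransitive_def T by force
  show "otyp Z T ` tot T = otyp Z S ` tot S" unfolding T image_image using f_typ by (intro image_cong) auto
qed

lemma action_eq_iff_stabilizes: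
  assumes act: "group_action G E \<phi>" and s: "s \<in> E" and gh: "g \<in> carrier G" "h \<in> carrier G"
  shows "\<phi> g s = \<phi> h s \<longleftrightarrow> \<phi> (inv\<^bsub>G\<^esub> h \<otimes>\<^bsub>G\<^esub> g) s = s"
proof -
  note d = group_actionD[OF act]
  interpret group G by (rule d)
  show ?thesis
  proof
    assume "\<phi> g s = \<phi> h s"
    then have "\<phi> (inv\<^bsub>G\<^esub> h) (\<phi> g s) = \<phi> (inv\<^bsub>G\<^esub> h) (\<phi> h s)" by simp
    then show "\<phi> (inv\<^bsub>G\<^esub> h \<otimes>\<^bsub>G\<^esub> g) s = s" using gh s by (simp add: d(4) flip: d(5))
  next
    assume "\<phi> (inv\<^bsub>G\<^esub> h \<otimes>\<^bsub>G\<^esub> g) s = s"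
    then have "\<phi> h (\<phi> (inv\<^bsub>G\<^esub> h \<otimes>\<^bsub>G\<^esub> g) s) = \<phi> h s" by simp
    then show "\<phi> g s = \<phi> h s" using gh s by (simp flip: d(5) m_assoc)
  qed
qed

text \<open>The map is g s \<mapsto> g t: equal stabilizers make it well defined and injective,
  equal base points make it a map over \<open>Z\<close>.\<close>

lemma otransitive_iso:
  assumes S: "over_base Z S" "otransitive Z S" and T: "over_base Z T" "otransitive Z T"
    and st: "s \<in> tot S" "t \<in> tot T" "otyp Z S s = otyp Z T t"
  shows "over_iso Z S T"
proof -
  have ga: "group_action (grp Z) (tot S) (oact S)" and gb: "group_action (grp Z) (tot T) (oact T)"
    using S T by (simp_all add: over_base_def)
  note sd = group_actionD[OF ga] and td = group_actionD[OF gb]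
  interpret group "grp Z" by (rule sd)
  have totS: "tot S = (\<lambda>g. oact S g s) ` carrier (grp Z)" and totT: "tot T = (\<lambda>g. oact T g t) ` carrier (grp Z)"
    using otransitiveD[OF S st(1)] otransitiveD[OF T st(2)] by (simp_all add: orb_def)
  have stab: "oact S g s = s \<longleftrightarrow> oact T g t = t" if "g \<in> carrier (grp Z)" for g
    using st(3) that by (auto simp: otyp_def)
  have eq: "oact S g s = oact S h s \<longleftrightarrow> oact T g t = oact T h t"
    if gh: "g \<in> carrier (grp Z)" "h \<in> carrier (grp Z)" for g h
    using action_eq_iff_stabilizes[OF ga st(1) gh] action_eq_iff_stabilizes[OF gb st(2) gh]
      stab[of "inv\<^bsub>grp Z\<^esub> h \<otimes>\<^bsub>grp Z\<^esub> g"] gh by simp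
  define f where "f x = oact T (SOME g. g \<in> carrier (grp Z) \<and> x = oact S g s) t" for x
  have f: "f (oact S g s) = oact T g t" if g: "g \<in> carrier (grp Z)" for g
  proof -
    let ?g = "SOME g'. g' \<in> carrier (grp Z) \<and> oact S g s = oact S g' s"
    have "?g \<in> carrier (grp Z) \<and> oact S g s = oact S ?g s"
      by (rule someI[of "\<lambda>g'. g' \<in> carrier (grp Z) \<and> oact S g s = oact S g' s" g]) (use g in simp)
    then have "oact T g t = oact T ?g t" using eq[OF g, of ?g] by simp
    then show ?thesis by (simp add: f_def)
  qed
  have "bij_betw f (tot S) (tot T)"
  proof (rule bij_betw_imageI)
    show "inj_on f (tot S)" unfolding totS by (rule inj_onI) (auto simp: f eq)
    show "f ` tot S = tot T" unfolding totS totT image_image by (intro image_cong) (auto simp: f)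
  qed
  moreover have "f (oact S g x) = oact T g (f x)" if "g \<in> carrier (grp Z)" "x \<in> tot S" for g x
    using that unfolding totS using st by (auto simp: f simp flip: sd(5) td(5))
  moreover have "str T (f x) = str S x" if "x \<in> tot S" for x
  proof -
    obtain g where g: "g \<in> carrier (grp Z)" "x = oact S g s" using \<open>x \<in> tot S\<close> unfolding totS by blast
    then show ?thesis using S(1) T(1) st by (simp add: f over_base_def otyp_def)
  qed
  ultimately show ?thesis unfolding over_iso_def by blast
qed

section \<open>Classes of pairs (point, subgroup) and the transitive sets realizing them\<close>

definition tclass :: "('g, 'z) gset \<Rightarrow> 'z \<times> 'g set \<Rightarrow> ('z \<times> 'g set) set" where
  "tclass Z p = (\<lambda>g. (act Z g (fst p), (\<lambda>e. g \<otimes>\<^bsub>grp Z\<^esub> e \<otimes>\<^bsub>grp Z\<^esub> inv\<^bsub>grp Z\<^esub> g) ` snd p)) ` carrier (grp Z)"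

lemma otyp_oact:
  assumes S: "over_base Z S" and s: "s \<in> tot S" and g: "g \<in> carrier (grp Z)"
  shows "otyp Z S (oact S g s) =
    (act Z g (str S s), (\<lambda>e. g \<otimes>\<^bsub>grp Z\<^esub> e \<otimes>\<^bsub>grp Z\<^esub> inv\<^bsub>grp Z\<^esub> g) ` snd (otyp Z S s))"
proof -
  have ga: "group_action (grp Z) (tot S) (oact S)" using S by (simp add: over_base_def)
  note sd = group_actionD[OF ga]
  interpret group "grp Z" by (rule sd)
  have "{h \<in> carrier (grp Z). oact S h (oact S g s) = oact S g s} =
      (\<lambda>e. g \<otimes>\<^bsub>grp Z\<^esub> e \<otimes>\<^bsub>grp Z\<^esub> inv\<^bsub>grp Z\<^esub> g) ` {e \<in> carrier (grp Z). oact S e s = s}"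
  proof (intro equalityI subsetI)
    fix h assume "h \<in> {h \<in> carrier (grp Z). oact S h (oact S g s) = oact S g s}"
    then have h: "h \<in> carrier (grp Z)" "oact S h (oact S g s) = oact S g s" by auto
    then have "oact S (inv\<^bsub>grp Z\<^esub> g) (oact S h (oact S g s)) = oact S (inv\<^bsub>grp Z\<^esub> g) (oact S g s)" by simp
    then have "oact S (inv\<^bsub>grp Z\<^esub> g \<otimes>\<^bsub>grp Z\<^esub> (h \<otimes>\<^bsub>grp Z\<^esub> g)) s = s"
      using h(1) g s by (simp add: sd(4) flip: sd(5))
    then show "h \<in> (\<lambda>e. g \<otimes>\<^bsub>grp Z\<^esub> e \<otimes>\<^bsub>grp Z\<^esub> inv\<^bsub>grp Z\<^esub> g) ` {e \<in> carrier (grp Z). oact S e s = s}"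
    proof (intro image_eqI)
      have "g \<otimes>\<^bsub>grp Z\<^esub> (inv\<^bsub>grp Z\<^esub> g \<otimes>\<^bsub>grp Z\<^esub> (h \<otimes>\<^bsub>grp Z\<^esub> g)) = h \<otimes>\<^bsub>grp Z\<^esub> g"
        using h(1) g by (simp flip: m_assoc)
      then show "h = g \<otimes>\<^bsub>grp Z\<^esub> (inv\<^bsub>grp Z\<^esub> g \<otimes>\<^bsub>grp Z\<^esub> (h \<otimes>\<^bsub>grp Z\<^esub> g)) \<otimes>\<^bsub>grp Z\<^esub> inv\<^bsub>grp Z\<^esub> g"
        using h(1) g by (simp add: m_assoc)
    qed (use h(1) g in simp)
  next
    fix h assume "h \<in> (\<lambda>e. g \<otimes>\<^bsub>grp Z\<^esub> e \<otimes>\<^bsub>grp Z\<^esub> inv\<^bsub>grp Z\<^esub> g) ` {e \<in> carrier (grp Z). oact S e s = s}"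
    then obtain e where e: "e \<in> carrier (grp Z)" "oact S e s = s" "h = g \<otimes>\<^bsub>grp Z\<^esub> e \<otimes>\<^bsub>grp Z\<^esub> inv\<^bsub>grp Z\<^esub> g"
      by blast
    have "oact S h (oact S g s) = oact S (g \<otimes>\<^bsub>grp Z\<^esub> e) s"
      using e g s by (simp add: m_assoc flip: sd(5))
    also have "\<dots> = oact S g s" using e g s by (simp add: sd(5))
    finally show "h \<in> {h \<in> carrier (grp Z). oact S h (oact S g s) = oact S g s}" using e g by simp
  qed
  then show ?thesis using S s g by (simp add: otyp_def over_base_def)
qed

lemma otyp_orb:
  assumes S: "over_base Z S" and s: "s \<in> tot S"
  shows "otyp Z S ` orb Z S s = tclass Z (otyp Z S s)"
  unfolding orb_def tclass_def image_image using otyp_oact[OF S s]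
  by (intro image_cong) (auto simp: otyp_def)

lemma otyp_subgroup:
  assumes S: "over_base Z S" and s: "s \<in> tot S"
  shows "str S s \<in> pts Z" "subgroup (snd (otyp Z S s)) (grp Z)"
    "\<And>e. e \<in> snd (otyp Z S s) \<Longrightarrow> act Z e (str S s) = str S s"
proof -
  have ga: "group_action (grp Z) (tot S) (oact S)" using S by (simp add: over_base_def)
  note sd = group_actionD[OF ga]
  interpret group "grp Z" by (rule sd)
  show "str S s \<in> pts Z" using S s by (auto simp: over_base_def)
  show "act Z e (str S s) = str S s" if "e \<in> snd (otyp Z S s)" for e
  proof -
    have e: "e \<in> carrier (grp Z)" "oact S e s = s" using that by (auto simp: otyp_def)
    have "str S (oact S e s) = act Z e (str S s)" using S s e(1) by (simp add: over_base_def)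
    then show ?thesis by (simp add: e(2))
  qed
  show "subgroup (snd (otyp Z S s)) (grp Z)"
  proof (rule subgroupI)
    fix a assume "a \<in> snd (otyp Z S s)"
    then have a: "a \<in> carrier (grp Z)" "oact S a s = s" by (auto simp: otyp_def)
    have "oact S (inv\<^bsub>grp Z\<^esub> a) (oact S a s) = s" using a(1) s by (simp add: sd(4) flip: sd(5))
    then show "inv\<^bsub>grp Z\<^esub> a \<in> snd (otyp Z S s)" using a by (simp add: otyp_def)
  qed (use s in \<open>auto simp: otyp_def sd(5) intro: exI[of _ "\<one>\<^bsub>grp Z\<^esub>"] sd(4)\<close>)
qed

text \<open>The coset space of \<open>E\<close> with structure map gE \<mapsto> g z, which is well
  defined because \<open>E\<close> fixes z; the coset \<open>E\<close> itself has type (z, E). The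
  result is then transported to natural numbers.\<close>

lemma otransitive_exists:
  assumes Z: "finite_gset Z" and z: "z \<in> pts Z" and E: "subgroup E (grp Z)"
    and stab: "\<And>e. e \<in> E \<Longrightarrow> act Z e z = z"
  shows "\<exists>T :: ('g, nat, 'z) over. over_base Z T \<and> otransitive Z T \<and> otyp Z T ` tot T = tclass Z (z, E)"
proof -
  note zd = finite_gsetD[OF Z]
  interpret group "grp Z" by (rule zd)
  interpret E: subgroup E "grp Z" by (rule E)
  define X where "X = (\<lambda>g. g <#\<^bsub>grp Z\<^esub> E) ` carrier (grp Z)"
  define S where "S = \<lparr>tot = X, oact = (\<lambda>g. \<lambda>x \<in> X. g <#\<^bsub>grp Z\<^esub> x), str = (\<lambda>x. act Z (SOME g. g \<in> x) z)\<rparr>"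
  have mem: "g <#\<^bsub>grp Z\<^esub> E \<in> X" if "g \<in> carrier (grp Z)" for g using that by (auto simp: X_def)
  have assoc: "g <#\<^bsub>grp Z\<^esub> (h <#\<^bsub>grp Z\<^esub> E) = (g \<otimes>\<^bsub>grp Z\<^esub> h) <#\<^bsub>grp Z\<^esub> E"
    if "g \<in> carrier (grp Z)" "h \<in> carrier (grp Z)" for g h
    using lcos_m_assoc[OF E.subset that] .
  have str: "str S (g <#\<^bsub>grp Z\<^esub> E) = act Z g z" if g: "g \<in> carrier (grp Z)" for g
  proof -
    have "g \<in> g <#\<^bsub>grp Z\<^esub> E" using g by (force simp: l_coset_def)
    then have "(SOME h. h \<in> g <#\<^bsub>grp Z\<^esub> E) \<in> g <#\<^bsub>grp Z\<^esub> E" by (rule someI)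
    then obtain e where "e \<in> E" "(SOME h. h \<in> g <#\<^bsub>grp Z\<^esub> E) = g \<otimes>\<^bsub>grp Z\<^esub> e"
      by (auto simp: l_coset_def)
    then show ?thesis using g z E.subset by (simp add: S_def zd(6) stab subsetD)
  qed
  have oact: "oact S g (h <#\<^bsub>grp Z\<^esub> E) = (g \<otimes>\<^bsub>grp Z\<^esub> h) <#\<^bsub>grp Z\<^esub> E"
    if "g \<in> carrier (grp Z)" "h \<in> carrier (grp Z)" for g h
    using that by (simp add: S_def mem assoc)
  have one: "\<one>\<^bsub>grp Z\<^esub> <#\<^bsub>grp Z\<^esub> E = E" by (rule lcos_mult_one[OF E.subset])
  have "group_action (grp Z) X (\<lambda>g. \<lambda>x \<in> X. g <#\<^bsub>grp Z\<^esub> x)"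
  proof (rule group_actionI, goal_cases)
    case (5 g h x)
    then show ?case by (auto simp: X_def assoc m_assoc)
  qed (auto simp: X_def assoc)
  moreover have "str S (oact S g x) = act Z g (str S x)" "str S x \<in> pts Z"
    if gx: "g \<in> carrier (grp Z)" "x \<in> X" for g x
  proof -
    obtain h where h: "h \<in> carrier (grp Z)" "x = h <#\<^bsub>grp Z\<^esub> E" using gx(2) by (auto simp: X_def)
    show "str S (oact S g x) = act Z g (str S x)" "str S x \<in> pts Z"
      unfolding h(2) using gx(1) h(1) z by (simp_all add: oact str zd)
  qed
  moreover note calculation(3)[OF one_closed]
  moreover have "finite X" using zd(2) by (simp add: X_def)
  ultimately have S: "over_base Z S"
    unfolding over_base_def by (auto simp: S_def)
  have EX: "E \<in> X" using mem[OF one_closed] one by simp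
  have o: "oact S g E = g <#\<^bsub>grp Z\<^esub> E" if "g \<in> carrier (grp Z)" for g
    using that EX by (simp add: S_def)
  have "orb Z S E = X" unfolding orb_def X_def using o by (intro image_cong) auto
  then have tr: "tot S = orb Z S E" by (simp add: S_def)
  then have trS: "otransitive Z S" using EX by (auto simp: otransitive_def S_def)
  have "g <#\<^bsub>grp Z\<^esub> E = E \<longleftrightarrow> g \<in> E" if "g \<in> carrier (grp Z)" for g
  proof
    assume "g <#\<^bsub>grp Z\<^esub> E = E"
    moreover have "g \<in> g <#\<^bsub>grp Z\<^esub> E" using that by (force simp: l_coset_def)
    ultimately show "g \<in> E" by simp
  qed (rule coset_join3[OF that E])
  then have "oact S g E = E \<longleftrightarrow> g \<in> E" if "g \<in> carrier (grp Z)" for g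
    using that o by simp
  then have "{g \<in> carrier (grp Z). oact S g E = E} = E" using E.subset by blast
  then have "otyp Z S E = (z, E)" using str[OF one_closed] z by (simp add: otyp_def one zd(5))
  then have ty: "otyp Z S ` tot S = tclass Z (z, E)"
    using otyp_orb[OF S, of E] tr EX by (simp add: S_def)
  show ?thesis
    using nat_copy[OF S] otransitive_over_iso[OF S conjunct2[OF nat_copy[OF S]] trS] ty
    by (intro exI[of _ "nat_copy Z S"]) simp
qed

section \<open>A matrix-valued functor\<close>

text \<open>The subgroups \<open>E\<close> of \<open>G \<times> L\<close> with this property are the graphs of surjections onto \<open>L\<close>
  from subgroups of \<open>G\<close>.\<close>

definition graph_like :: "('g, 'x) gset \<Rightarrow> 'l monoid \<Rightarrow> ('g \<times> 'l) set \<Rightarrow> bool" where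
  "graph_like A L E \<longleftrightarrow>
     (\<forall>l. (\<one>\<^bsub>grp A\<^esub>, l) \<in> E \<longrightarrow> l = \<one>\<^bsub>L\<^esub>) \<and> (\<forall>l \<in> carrier L. \<exists>g. (g, l) \<in> E)"

text \<open>Spans from \<open>point L\<close> to \<open>A\<close> are the sets over this base, so
  its Burnside group is the Hom from \<open>point L\<close> before extension of scalars.\<close>

abbreviation over_pt :: "('g, 'x) gset \<Rightarrow> 'l monoid \<Rightarrow> ('g \<times> 'l, 'x \<times> unit) gset" where
  "over_pt A L \<equiv> ext_prod A (point L)"

text \<open>That \<open>E\<close> fixes z means that (z, E) occurs as base point and stabilizer in
  some set over the base, by \<open>otransitive_exists\<close>. These classes index the basis of the
  quotient functor at \<open>A\<close>.\<close>

definition gclasses :: "('g, 'x) gset \<Rightarrow> 'l monoid \<Rightarrow> (('x \<times> unit) \<times> ('g \<times> 'l) set) set set" where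
  "gclasses A L = {tclass (over_pt A L) (z, E) | z E. z \<in> pts (over_pt A L) \<and>
     subgroup E (grp (over_pt A L)) \<and> (\<forall>e \<in> E. act (over_pt A L) e z = z) \<and> graph_like A L E}"

lemma tclass_refl:
  assumes Z: "finite_gset Z" and z: "z \<in> pts Z" and E: "E \<subseteq> carrier (grp Z)"
  shows "(z, E) \<in> tclass Z (z, E)"
proof -
  note zd = finite_gsetD[OF Z]
  interpret group "grp Z" by (rule zd)
  have "(\<lambda>e. \<one>\<^bsub>grp Z\<^esub> \<otimes>\<^bsub>grp Z\<^esub> e \<otimes>\<^bsub>grp Z\<^esub> inv\<^bsub>grp Z\<^esub> \<one>\<^bsub>grp Z\<^esub>) ` E = (\<lambda>e. e) ` E"
    using E by (intro image_cong) auto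
  then show ?thesis unfolding tclass_def using z by (intro image_eqI[of _ _ "\<one>\<^bsub>grp Z\<^esub>"]) (auto simp: zd)
qed

lemma finite_gclasses:
  assumes A: "finite_gset A" and L: "group L" "finite (carrier L)"
  shows "finite (gclasses A L)"
proof (rule finite_subset)
  let ?Z = "over_pt A L"
  have Z: "finite_gset ?Z" by (intro finite_gset_ext_prod A finite_gset_point L)
  note zd = finite_gsetD[OF Z]
  interpret group "grp ?Z" by (rule zd)
  show "gclasses A L \<subseteq> Pow (pts ?Z \<times> Pow (carrier (grp ?Z)))"
  proof (intro subsetI PowI)
    fix c p assume c: "c \<in> gclasses A L" "p \<in> c"
    obtain z' E' where p: "p = (z', E')" by (cases p)
    obtain z E g where zE: "z \<in> pts ?Z" "subgroup E (grp ?Z)" "g \<in> carrier (grp ?Z)"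
        "z' = act ?Z g z" "E' = (\<lambda>e. g \<otimes>\<^bsub>grp ?Z\<^esub> e \<otimes>\<^bsub>grp ?Z\<^esub> inv\<^bsub>grp ?Z\<^esub> g) ` E"
      using c unfolding gclasses_def tclass_def p by auto
    have "E' \<subseteq> carrier (grp ?Z)"
      using zE(3) subgroup.subset[OF zE(2)] unfolding zE(5) by (intro image_subsetI m_closed) auto
    then show "p \<in> pts ?Z \<times> Pow (carrier (grp ?Z))" using zE zd(4) by (simp add: p)
  qed
  show "finite (Pow (pts ?Z \<times> Pow (carrier (grp ?Z))))" using zd(2,3) by simp
qed

lemma otyp_in_gclasses:
  assumes S: "over_base (over_pt A L) S" and tr: "otransitive (over_pt A L) S" and s: "s \<in> tot S"
    and g: "graph_like A L (snd (otyp (over_pt A L) S s))"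
  shows "otyp (over_pt A L) S ` tot S \<in> gclasses A L"
proof -
  let ?t = "otyp (over_pt A L) S s"
  have "otyp (over_pt A L) S ` tot S = tclass (over_pt A L) ?t"
    using otyp_orb[OF S s] otransitiveD[OF S tr s] by simp
  moreover have "?t = (str S s, snd ?t)" by (simp add: otyp_def)
  ultimately have "otyp (over_pt A L) S ` tot S = tclass (over_pt A L) (str S s, snd ?t)" by simp
  moreover have "\<forall>e \<in> snd ?t. act (over_pt A L) e (str S s) = str S s"
    using otyp_subgroup(3)[OF S s] by blast
  ultimately show ?thesis
    unfolding gclasses_def using otyp_subgroup(1,2)[OF S s] g by blast
qed

lemma gclasses_graph_like:
  assumes A: "finite_gset A" and L: "group L" "finite (carrier L)"
    and c: "c \<in> gclasses A L"
  shows "\<exists>z E. (z, E) \<in> c \<and> graph_like A L E"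
proof -
  obtain z E where zE: "c = tclass (over_pt A L) (z, E)" "z \<in> pts (over_pt A L)"
      "subgroup E (grp (over_pt A L))" "graph_like A L E"
    using c unfolding gclasses_def by blast
  have Z: "finite_gset (over_pt A L)" by (intro finite_gset_ext_prod A finite_gset_point L)
  show ?thesis using tclass_refl[OF Z zE(2) subgroup.subset[OF zE(3)]] zE(1,4) by blast
qed

text \<open>The basis element for \<open>c\<close>, realized by an actual transitive span so that
  other spans can be composed with it.\<close>

definition orep :: "('g, 'x) gset \<Rightarrow> 'l monoid \<Rightarrow> (('x \<times> unit) \<times> ('g \<times> 'l) set) set \<Rightarrow>
    ('g \<times> 'l, nat, 'x \<times> unit) over" where
  "orep A L c = (SOME T. over_base (over_pt A L) T \<and> otransitive (over_pt A L) T \<and>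
     otyp (over_pt A L) T ` tot T = c)"

lemma orep:
  assumes A: "finite_gset A" and L: "group L" "finite (carrier L)"
    and c: "c \<in> gclasses A L"
  shows "over_base (over_pt A L) (orep A L c)" "otransitive (over_pt A L) (orep A L c)"
    "otyp (over_pt A L) (orep A L c) ` tot (orep A L c) = c"
proof -
  have Z: "finite_gset (over_pt A L)" by (intro finite_gset_ext_prod A finite_gset_point L)
  obtain z E where zE: "c = tclass (over_pt A L) (z, E)" "z \<in> pts (over_pt A L)"
      "subgroup E (grp (over_pt A L))" "\<And>e. e \<in> E \<Longrightarrow> act (over_pt A L) e z = z"
    using c unfolding gclasses_def by blast
  from someI_ex[OF otransitive_exists[OF Z zE(2-4)]]
  show "over_base (over_pt A L) (orep A L c)" "otransitive (over_pt A L) (orep A L c)"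
    "otyp (over_pt A L) (orep A L c) ` tot (orep A L c) = c"
    unfolding orep_def zE(1) by auto
qed

lemma otyp_eq_iso:
  assumes S: "over_base Z S" "otransitive Z S" and T: "over_base Z T" "otransitive Z T"
    and eq: "otyp Z S ` tot S = otyp Z T ` tot T"
  shows "over_iso Z S T"
proof -
  obtain s where s: "s \<in> tot S" using S(2) by (auto simp: otransitive_def)
  then have "otyp Z S s \<in> otyp Z T ` tot T" using eq by blast
  then obtain t where "t \<in> tot T" "otyp Z S s = otyp Z T t" by blast
  then show ?thesis using otransitive_iso[OF S T s] by blast
qed

context
  fixes A :: "('g, 'x) gset" and B :: "('h, 'y) gset" and L :: "'l monoid"
    and W :: "('h, 'y, 'g, 'x, 'w) span"
  assumes A: "finite_gset A" and B: "finite_gset B" and L: "group L" "finite (carrier L)"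
    and W: "over_base (ext_prod B A) W"
begin

text \<open>The element (1, l) acts on [w, s] through s alone, so if it fixes s it fixes [w, s], and
  then l = 1. If (k, l) fixes [w, s], then (k w, l s) is a balanced translate of (w, s), and the
  translating element h of the group of \<open>A\<close> satisfies (h, l) s = s.\<close>

lemma graph_like_span_comp:
  assumes S: "over_base (over_pt A L) S" and m: "matched W S w s"
    and g: "graph_like B L (snd (otyp (over_pt B L) (span_comp B A (point L) W S) (bal_orbit B A (point L) W S w s)))"
  shows "graph_like A L (snd (otyp (over_pt A L) S s))"
proof -
  have P: "finite_gset (point L)" by (rule finite_gset_point[OF L])
  interpret L: group L by (rule L)
  interpret A: group "grp A" by (rule finite_gsetD[OF A])
  interpret B: group "grp B" by (rule finite_gsetD[OF B])
  note c = P A B S W and sd = over_baseD[OF S] and wd = over_baseD[OF W]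
  note m' = matchedD[OF m]
  let ?o = "bal_orbit B A (point L) W S"
  have pt: "grp (point L) = L" by (simp add: point_def)
  note sd = sd[unfolded pt] and ob = oact_bal_orbit[OF c m, unfolded pt]
  have carr: "carrier (grp (over_pt B L)) = carrier (grp B) \<times> carrier L"
      "carrier (grp (over_pt A L)) = carrier (grp A) \<times> carrier L"
    by (simp_all add: ext_prod_def pt)
  have "l = \<one>\<^bsub>L\<^esub>" if "(\<one>\<^bsub>grp A\<^esub>, l) \<in> snd (otyp (over_pt A L) S s)" for l
  proof -
    have l: "l \<in> carrier L" "oact S (\<one>\<^bsub>grp A\<^esub>, l) s = s" using that by (auto simp: otyp_def carr)
    have "oact (span_comp B A (point L) W S) (\<one>\<^bsub>grp B\<^esub>, l) (?o w s) = ?o w s"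
      using m' l by (simp add: ob wd)
    then show ?thesis using g l(1) unfolding graph_like_def by (auto simp: otyp_def carr)
  qed
  moreover have "\<exists>a. (a, l) \<in> snd (otyp (over_pt A L) S s)" if l: "l \<in> carrier L" for l
  proof -
    obtain k where k: "k \<in> carrier (grp B)" "oact (span_comp B A (point L) W S) (k, l) (?o w s) = ?o w s"
      using g l unfolding graph_like_def by (auto simp: otyp_def carr)
    have m2: "oact W (k, \<one>\<^bsub>grp A\<^esub>) w \<in> tot W" "oact S (\<one>\<^bsub>grp A\<^esub>, l) s \<in> tot S"
      using m' k l by (auto simp: wd sd)
    obtain h where h: "h \<in> carrier (grp A)" "s = oact S (h, \<one>\<^bsub>L\<^esub>) (oact S (\<one>\<^bsub>grp A\<^esub>, l) s)"
      using k(2) unfolding ob[OF k(1) l] bal_orbit_eq_iff[OF c m2 m'(1,2), unfolded pt] by blast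
    then have "oact S (h, l) s = s" using m' l by (simp add: sd)
    then show ?thesis using h(1) l by (auto simp: otyp_def carr)
  qed
  ultimately show ?thesis unfolding graph_like_def by blast
qed

text \<open>An orbit of the composite with type in \<open>gclasses B L\<close> would contain a point
  [w, s] with graph-like stabilizer, and s would then have one too. So composition with
  \<open>W\<close> preserves the part that is divided out.\<close>

lemma ocount_span_comp_nonclass:
  assumes S: "over_base (over_pt A L) S" and tr: "otransitive (over_pt A L) S"
    and n: "otyp (over_pt A L) S ` tot S \<notin> gclasses A L" and c: "c \<in> gclasses B L"
  shows "ocount (over_pt B L) c (span_comp B A (point L) W S) = 0"
proof -
  have P: "finite_gset (point L)" by (rule finite_gset_point[OF L])
  note cc = P A B S W
  let ?T = "span_comp B A (point L) W S"
  have T: "over_base (over_pt B L) ?T" by (rule over_base_span_comp[OF P A B W S])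
  have "otyp (over_pt B L) ?T ` X \<noteq> c" if X: "X \<in> orb (over_pt B L) ?T ` tot ?T" for X
  proof
    assume e: "otyp (over_pt B L) ?T ` X = c"
    obtain z E where zE: "(z, E) \<in> c" "graph_like B L E" using gclasses_graph_like[OF B L c] by blast
    then obtain t where t: "t \<in> X" "otyp (over_pt B L) ?T t = (z, E)" using e by (metis imageE)
    then have "t \<in> tot ?T" using orbits_subset[OF T X] by blast
    then obtain w s where ws: "matched W S w s" "t = bal_orbit B A (point L) W S w s"
      by (rule tot_span_compE[OF cc])
    have "graph_like A L (snd (otyp (over_pt A L) S s))"
      using graph_like_span_comp[OF S ws(1)] t(2) zE(2) ws(2) by simp
    then show False using otyp_in_gclasses[OF S tr matchedD(2)[OF ws(1)]] n by blast
  qed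
  then have "{X \<in> orb (over_pt B L) ?T ` tot ?T. otyp (over_pt B L) ?T ` X = c} = {}" by blast
  then show ?thesis by (simp only: ocount_def card.empty)
qed

text \<open>One orbit of \<open>S\<close> is split off at each induction step. If its type is in
  \<open>gclasses A L\<close> it is isomorphic to the corresponding \<open>orep\<close>, otherwise
  it contributes zero to both sides. In effect \<open>W\<close> acts linearly on the quotient, in
  the coordinates given by orbit counts.\<close>

lemma ocount_span_comp:
  assumes S: "over_base (over_pt A L) S" and c: "c \<in> gclasses B L"
  shows "ocount (over_pt B L) c (span_comp B A (point L) W S) =
    (\<Sum>d \<in> gclasses A L. ocount (over_pt A L) d S * ocount (over_pt B L) c (span_comp B A (point L) W (orep A L d)))"
    (is "?l S = ?r S")
  using S
proof (induction "card (tot S)" arbitrary: S rule: less_induct)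
  case less
  have P: "finite_gset (point L)" by (rule finite_gset_point[OF L])
  let ?Z = "over_pt A L"
  note S = less.prems
  show ?case
  proof (cases "tot S = {}")
    case True
    then have "tot (span_comp B A (point L) W S) = {}" by (simp add: span_comp_def span_comp_tot_def)
    then show ?thesis using True by (simp add: ocount_def)
  next
    case False
    then obtain s where s: "s \<in> tot S" by blast
    define X where "X = orb ?Z S s"
    have X: "X \<subseteq> tot S" "\<And>g x. g \<in> carrier (grp ?Z) \<Longrightarrow> x \<in> X \<Longrightarrow> oact S g x \<in> X" "s \<in> X"
      unfolding X_def using orb_subset[OF S s] orb_closed[OF S s] orb_refl[OF S s] by blast+
    let ?S1 = "over_restrict S X" and ?S2 = "over_restrict S (tot S - X)"
    have S1: "over_base ?Z ?S1" by (rule over_base_over_restrict[OF S X(1,2)])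
    have S2: "over_base ?Z ?S2" and iso: "over_iso ?Z S (over_sum ?S1 ?S2)"
      using over_iso_over_restrict[OF S X(1,2)] by blast+
    have "orb ?Z ?S1 s = orb ?Z S s" using X(3) by (simp add: orb_def over_restrict_def)
    then have tr: "otransitive ?Z ?S1"
      unfolding otransitive_def using X(3) by (intro bexI[of _ s]) (simp_all add: over_restrict_def X_def)
    have "card (tot ?S2) < card (tot S)"
      using S X s by (intro psubset_card_mono) (auto simp: over_base_def over_restrict_def)
    from less.hyps[OF this S2] have IH: "?l ?S2 = ?r ?S2" .
    have cnt: "ocount ?Z d S = ocount ?Z d ?S1 + ocount ?Z d ?S2" for d
      using ocount_over_iso[OF S iso] ocount_over_sum[OF S1 S2] by simp
    have i: "over_iso (over_pt B L) (span_comp B A (point L) W S)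
        (over_sum (span_comp B A (point L) W ?S1) (span_comp B A (point L) W ?S2))"
      by (rule over_iso_trans[OF span_comp_cong[OF P A B S W over_base_over_sum[OF S1 S2] W over_iso_refl iso]
            span_comp_over_sum_right[OF P A B S1 S2 W]])
    have l: "?l S = ?l ?S1 + ?l ?S2"
      using ocount_over_iso[OF over_base_span_comp(1)[OF P A B W S] i]
        ocount_over_sum[OF over_base_span_comp(1)[OF P A B W S1] over_base_span_comp(1)[OF P A B W S2]] by simp
    have "?l ?S1 = ?r ?S1"
    proof (cases "otyp ?Z ?S1 ` tot ?S1 \<in> gclasses A L")
      case True
      let ?d = "otyp ?Z ?S1 ` tot ?S1"
      note o = orep[OF A L True]
      have "?l ?S1 = ocount (over_pt B L) c (span_comp B A (point L) W (orep A L ?d))"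
        by (rule ocount_over_iso[OF over_base_span_comp(1)[OF P A B W S1]
              span_comp_cong[OF P A B S1 W o(1) W over_iso_refl otyp_eq_iso[OF S1 tr o(1,2) o(3)[symmetric]]]])
      \<comment> \<open>A transitive set counts 1 for its own type and 0 for every other one, so the
        sum collapses to a single term.\<close>
      also have "\<dots> = ?r ?S1"
        using True finite_gclasses[OF A L]
        by (simp add: ocount_otransitive[OF S1 tr] if_distrib[of "\<lambda>x. x * _"] sum.delta' cong: if_cong)
      finally show ?thesis .
    next
      case False
      have "?r ?S1 = 0"
        unfolding ocount_otransitive[OF S1 tr] by (rule sum.neutral) (use False in auto)
      then show ?thesis using ocount_span_comp_nonclass[OF S1 tr False c] by simp
    qed
    then show ?thesis unfolding l IH by (simp add: cnt distrib_right sum.distrib)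
  qed
qed

end

text \<open>The matrix of composition with \<open>U\<close> on the quotient functor, with row
  \<open>d\<close> and column \<open>c\<close>: a column is the expansion of \<open>U\<close>
  composed with a basis element.\<close>

definition span_mat :: "('g, 'x) gset \<Rightarrow> ('h, 'y) gset \<Rightarrow> 'l monoid \<Rightarrow>
    (('y \<times> unit) \<times> ('h \<times> 'l) set) set \<Rightarrow> (('x \<times> unit) \<times> ('g \<times> 'l) set) set \<Rightarrow>
    ('h, 'y, 'g, 'x, 'u) span \<Rightarrow> nat" where
  "span_mat A B L d c U = ocount (over_pt B L) d (span_comp B A (point L) U (orep A L c))"

lemma span_mat_iso:
  assumes A: "finite_gset A" and B: "finite_gset B" and L: "group L" "finite (carrier L)"
    and U: "over_base (ext_prod B A) U" and U': "over_base (ext_prod B A) U'"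
    and iso: "over_iso (ext_prod B A) U U'" and c: "c \<in> gclasses A L"
  shows "span_mat A B L d c U = span_mat A B L d c U'"
proof -
  have P: "finite_gset (point L)" by (rule finite_gset_point[OF L])
  note o = orep[OF A L c]
  show ?thesis unfolding span_mat_def
    by (rule ocount_over_iso[OF over_base_span_comp(1)[OF P A B U o(1)]
          span_comp_cong[OF P A B o(1) U o(1) U' iso over_iso_refl]])
qed

lemma span_mat_sum:
  assumes A: "finite_gset A" and B: "finite_gset B" and L: "group L" "finite (carrier L)"
    and W: "over_base (ext_prod B A) W" and U: "over_base (ext_prod B A) U" and U': "over_base (ext_prod B A) U'"
    and iso: "over_iso (ext_prod B A) W (over_sum U U')" and c: "c \<in> gclasses A L"
  shows "span_mat A B L d c W = span_mat A B L d c U + span_mat A B L d c U'"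
proof -
  have P: "finite_gset (point L)" by (rule finite_gset_point[OF L])
  note o = orep[OF A L c]
  have i: "over_iso (over_pt B L) (span_comp B A (point L) W (orep A L c))
      (over_sum (span_comp B A (point L) U (orep A L c)) (span_comp B A (point L) U' (orep A L c)))"
    by (rule over_iso_trans[OF span_comp_cong[OF P A B o(1) W o(1) over_base_over_sum[OF U U'] iso over_iso_refl]
          span_comp_over_sum_left[OF P A B o(1) U U']])
  show ?thesis unfolding span_mat_def
    using ocount_over_iso[OF over_base_span_comp(1)[OF P A B W o(1)] i]
      ocount_over_sum[OF over_base_span_comp(1)[OF P A B U o(1)] over_base_span_comp(1)[OF P A B U' o(1)]] by simp
qed

text \<open>Associativity regroups the composite as \<open>V\<close> applied to \<open>U\<close>
  applied to \<open>orep A L c\<close>; expanding the inner part by \<open>ocount_span_comp\<close>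
  gives the matrix product.\<close>

lemma span_mat_comp:
  assumes A: "finite_gset A" and B: "finite_gset B" and C: "finite_gset C"
    and L: "group L" "finite (carrier L)"
    and U: "over_base (ext_prod B A) U" and V: "over_base (ext_prod C B) V"
    and c: "c \<in> gclasses A L" and e: "e \<in> gclasses C L"
  shows "span_mat A C L e c (span_comp C B A V U) =
    (\<Sum>d \<in> gclasses B L. span_mat B C L e d V * span_mat A B L d c U)"
proof -
  have P: "finite_gset (point L)" by (rule finite_gset_point[OF L])
  note o = orep[OF A L c]
  have "span_mat A C L e c (span_comp C B A V U) =
      ocount (over_pt C L) e (span_comp C B (point L) V (span_comp B A (point L) U (orep A L c)))"
    unfolding span_mat_def
    by (rule ocount_over_iso[OF over_base_span_comp(1)[OF P A C over_base_span_comp(1)[OF A B C V U] o(1)]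
          span_comp_assoc[OF P A B C o(1) U V]])
  also have "\<dots> = (\<Sum>d \<in> gclasses B L. span_mat A B L d c U * span_mat B C L e d V)"
    unfolding span_mat_def
    by (rule ocount_span_comp[OF B C L V over_base_span_comp(1)[OF P A B U o(1)] e])
  finally show ?thesis by (simp add: mult.commute)
qed

lemma span_mat_id:
  assumes A: "finite_gset A" and L: "group L" "finite (carrier L)"
    and c: "c \<in> gclasses A L"
  shows "span_mat A A L d c (id_span A) = (if d = c then 1 else 0)"
proof -
  have P: "finite_gset (point L)" by (rule finite_gset_point[OF L])
  note o = orep[OF A L c]
  have "span_mat A A L d c (id_span A) = ocount (over_pt A L) d (orep A L c)"
    unfolding span_mat_def
    by (rule ocount_over_iso[OF over_base_span_comp(1)[OF P A A over_base_id_span[OF A] o(1)]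
          span_comp_id_left[OF P A o(1)]])
  then show ?thesis using ocount_otransitive[OF o(1,2)] o(3) by auto
qed

text \<open>The entry is read off at one representative of the coset; isomorphism invariance and
  additivity of \<open>span_mat\<close> make the choice harmless for \<open>c\<close> in
  \<open>gclasses A L\<close>, see \<open>burnside_mat_eq\<close>.\<close>

definition burnside_mat where
  "burnside_mat A B L d c a = frag_eval (\<lambda>U. int (span_mat A B L d c U)) (SOME p. p \<in> a)"

lemma burnside_mat_eq:
  assumes A: "finite_gset A" and B: "finite_gset B" and L: "group L" "finite (carrier L)"
    and c: "c \<in> gclasses A L" and a: "a \<in> carrier (burnside (ext_prod B A))" "p \<in> a"
  shows "burnside_mat A B L d c a = frag_eval (\<lambda>U. int (span_mat A B L d c U)) p"
proof -
  have "(SOME p. p \<in> a) \<in> a" using a(2) by (rule someI)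
  then have "(SOME p. p \<in> a) - p \<in> burnside_rel (ext_prod B A)"
    using carrier_burnsideD(2)[OF a] mem_frag_coset by metis
  then have "frag_eval (\<lambda>U. int (span_mat A B L d c U)) ((SOME p. p \<in> a) - p) = 0"
    by (rule frag_eval_burnside_rel[rotated 2])
      (auto intro: span_mat_iso[OF A B L _ _ _ c] span_mat_sum[OF A B L _ _ _ _ c] simp flip: of_nat_add)
  then show ?thesis by (simp add: burnside_mat_def frag_eval_diff)
qed

lemma burnside_mat_mult:
  assumes A: "finite_gset A" and B: "finite_gset B" and L: "group L" "finite (carrier L)"
    and c: "c \<in> gclasses A L"
    and a: "a \<in> carrier (burnside (ext_prod B A))" "a' \<in> carrier (burnside (ext_prod B A))"
  shows "burnside_mat A B L d c (a \<otimes>\<^bsub>burnside (ext_prod B A)\<^esub> a') =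
    burnside_mat A B L d c a + burnside_mat A B L d c a'"
proof -
  obtain p p' where p: "p \<in> a" "p' \<in> a'"
    using carrier_burnside_nonempty[OF a(1)] carrier_burnside_nonempty[OF a(2)] by blast
  show ?thesis
    using frag_eval_diff[of "\<lambda>U. int (span_mat A B L d c U)" "p + p'" p']
    by (simp add: burnside_mat_eq[OF A B L c a(1) p(1)] burnside_mat_eq[OF A B L c a(2) p(2)]
        burnside_mat_eq[OF A B L c burnside_mult_reps[OF a(1) p(1) a(2) p(2)]])
qed

lemma burnside_mat_class:
  assumes A: "finite_gset A" and B: "finite_gset B" and L: "group L" "finite (carrier L)"
    and c: "c \<in> gclasses A L" and U: "over_base (ext_prod B A) U"
  shows "burnside_mat A B L d c (burnside_class (ext_prod B A) U) = int (span_mat A B L d c U)"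
proof -
  let ?N = "nat_copy (ext_prod B A) U"
  have "burnside_mat A B L d c (burnside_class (ext_prod B A) U) = int (span_mat A B L d c ?N)"
    using burnside_mat_eq[OF A B L c burnside_class_closed[OF U] nat_copy_in_burnside_class] by simp
  then show ?thesis
    using span_mat_iso[OF A B L U conjunct1[OF nat_copy[OF U]] conjunct2[OF nat_copy[OF U]] c] by simp
qed

text \<open>At representatives both sides become formal double sums, and the claim is
  \<open>span_mat_comp\<close> extended bilinearly.\<close>

lemma burnside_mat_comp:
  assumes A: "finite_gset A" and B: "finite_gset B" and C: "finite_gset C"
    and L: "group L" "finite (carrier L)"
    and c: "c \<in> gclasses A L" and e: "e \<in> gclasses C L"
    and b: "b \<in> carrier (burnside (ext_prod C B))" and a: "a \<in> carrier (burnside (ext_prod B A))"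
  shows "burnside_mat A C L e c (burnside_comp C B A b a) =
    (\<Sum>d \<in> gclasses B L. burnside_mat B C L e d b * burnside_mat A B L d c a)"
proof -
  obtain q p where qp: "q \<in> b" "p \<in> a"
    using carrier_burnside_nonempty[OF a] carrier_burnside_nonempty[OF b] by blast
  note k = carrier_burnsideD(1)[OF b qp(1)] carrier_burnsideD(1)[OF a qp(2)]
  have "frag_comp C B A q p \<in> burnside_comp C B A b a"
    unfolding burnside_comp_eq[OF A B C b qp(1) a qp(2)]
    by (rule frag_coset_self[OF frag_subgroup_burnside_rel])
  then have "burnside_mat A C L e c (burnside_comp C B A b a) =
      frag_eval (\<lambda>U. int (span_mat A C L e c U)) (frag_comp C B A q p)"
    by (rule burnside_mat_eq[OF A C L c burnside_comp_closed[OF A B C b a]])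
  also have "\<dots> = frag_eval (\<lambda>V. frag_eval (\<lambda>U.
      \<Sum>d \<in> gclasses B L. int (span_mat B C L e d V) * int (span_mat A B L d c U)) p) q"
    unfolding frag_comp_def frag_bilinear_def frag_eval_frag_extend frag_eval_of
  proof (intro frag_eval_cong)
    fix V U assume "V \<in> Poly_Mapping.keys q" "U \<in> Poly_Mapping.keys p"
    then have V: "over_base (ext_prod C B) V" and U: "over_base (ext_prod B A) U" using k by auto
    have "span_mat A C L e c (nat_copy (ext_prod C A) (span_comp C B A V U)) =
        span_mat A C L e c (span_comp C B A V U)"
      using nat_copy[OF over_base_span_comp(1)[OF A B C V U]]
      by (intro span_mat_iso[OF A C L over_base_span_comp(1)[OF A B C V U] _ _ c, symmetric]) auto
    then show "int (span_mat A C L e c (nat_copy (ext_prod C A) (span_comp C B A V U))) =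
        (\<Sum>d \<in> gclasses B L. int (span_mat B C L e d V) * int (span_mat A B L d c U))"
      by (simp add: span_mat_comp[OF A B C L U V c e])
  qed
  also have "\<dots> = (\<Sum>d \<in> gclasses B L. burnside_mat B C L e d b * burnside_mat A B L d c a)"
    unfolding frag_eval_sum frag_eval_mult_left frag_eval_mult_right
    by (intro sum.cong refl arg_cong2[where f = "(*)"])
      (simp_all add: burnside_mat_eq[OF B C L _ b qp(1)] burnside_mat_eq[OF A B L c a qp(2)])
  finally show ?thesis .
qed

text \<open>Scalar extension of the integral entry: a pure tensor of r and a goes to r times the
  entry of a.\<close>

definition morph_mat where
  "morph_mat A B L d c \<phi> = frag_eval (\<lambda>(r, a). r * of_int (burnside_mat A B L d c a)) (SOME p. p \<in> \<phi>)"

lemma morph_mat_eq: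
  fixes \<phi> :: "('r::comm_ring_1, 'h, 'y, 'g, 'x) morph"
  assumes A: "finite_gset A" and B: "finite_gset B" and L: "group L" "finite (carrier L)"
    and c: "c \<in> gclasses A L" and \<phi>: "\<phi> \<in> Hom_C A B" "p \<in> \<phi>"
  shows "morph_mat A B L d c \<phi> = frag_eval (\<lambda>(r, a). r * of_int (burnside_mat A B L d c a)) p"
proof -
  have "(SOME p. p \<in> \<phi>) \<in> \<phi>" using \<phi>(2) by (rule someI)
  then have "(SOME p. p \<in> \<phi>) - p \<in> tensor_rel (burnside (ext_prod B A))"
    using carrier_tensorD(2)[OF mult_closed_burnside \<phi>[unfolded Hom_C_def]] mem_frag_coset by metis
  then have "frag_eval (\<lambda>(r, a). r * of_int (burnside_mat A B L d c a)) ((SOME p. p \<in> \<phi>) - p) = 0"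
    by (rule frag_eval_tensor_rel[OF mult_closed_burnside, rotated])
      (simp add: burnside_mat_mult[OF A B L c])
  then show ?thesis by (simp add: morph_mat_def frag_eval_diff)
qed

lemma morph_mat_comp:
  fixes \<psi> :: "('r::comm_ring_1, 'k, 'z, 'h, 'y) morph" and \<phi> :: "('r, 'h, 'y, 'g, 'x) morph"
  assumes A: "finite_gset A" and B: "finite_gset B" and C: "finite_gset C"
    and L: "group L" "finite (carrier L)"
    and c: "c \<in> gclasses A L" and e: "e \<in> gclasses C L"
    and \<psi>: "\<psi> \<in> Hom_C B C" and \<phi>: "\<phi> \<in> Hom_C A B"
  shows "morph_mat A C L e c (comp_C C B A \<psi> \<phi>) =
    (\<Sum>d \<in> gclasses B L. morph_mat B C L e d \<psi> * morph_mat A B L d c \<phi>)"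
proof -
  note t = \<psi>[unfolded Hom_C_def] \<phi>[unfolded Hom_C_def]
  obtain q p where qp: "q \<in> \<psi>" "p \<in> \<phi>"
    using carrier_tensor_nonempty[OF mult_closed_burnside t(1)]
      carrier_tensor_nonempty[OF mult_closed_burnside t(2)] by blast
  note k = carrier_tensorD(1)[OF mult_closed_burnside t(1) qp(1)]
    carrier_tensorD(1)[OF mult_closed_burnside t(2) qp(2)]
  note e0 = comp_C_eq[OF A B C \<psi> qp(1) \<phi> qp(2)]
  have kk: "Poly_Mapping.keys (tens_comp C B A q p) \<subseteq> UNIV \<times> carrier (burnside (ext_prod C A))"
    unfolding tens_comp_def
  proof (rule keys_frag_bilinear)
    fix tb ta assume "tb \<in> Poly_Mapping.keys q" "ta \<in> Poly_Mapping.keys p"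
    then have "snd tb \<in> carrier (burnside (ext_prod C B))" "snd ta \<in> carrier (burnside (ext_prod B A))"
      using k by auto
    then show "Poly_Mapping.keys ((case tb of (r, b) \<Rightarrow> \<lambda>(s, a). frag_of (r * s, burnside_comp C B A b a)) ta) \<subseteq>
        UNIV \<times> carrier (burnside (ext_prod C A))"
      using burnside_comp_closed[OF A B C] by (simp add: case_prod_unfold)
  qed
  have h: "comp_C C B A \<psi> \<phi> \<in> Hom_C A C" "tens_comp C B A q p \<in> comp_C C B A \<psi> \<phi>"
    unfolding e0 Hom_C_def carrier_tensor[OF mult_closed_burnside]
    using kk frag_subgroupD(1)[OF frag_subgroup_tensor_rel[OF mult_closed_burnside]]
    by (auto simp: mem_frag_coset)
  have "morph_mat A C L e c (comp_C C B A \<psi> \<phi>) =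
      frag_eval (\<lambda>(r, a). r * of_int (burnside_mat A C L e c a)) (tens_comp C B A q p)"
    by (rule morph_mat_eq[OF A C L c h])
  also have "\<dots> = frag_eval (\<lambda>tb. frag_eval (\<lambda>ta. \<Sum>d \<in> gclasses B L.
      (fst tb * of_int (burnside_mat B C L e d (snd tb))) * (fst ta * of_int (burnside_mat A B L d c (snd ta)))) p) q"
    unfolding tens_comp_def frag_bilinear_def case_prod_unfold frag_eval_frag_extend frag_eval_of fst_conv snd_conv
  proof (intro frag_eval_cong)
    fix tb ta assume "tb \<in> Poly_Mapping.keys q" "ta \<in> Poly_Mapping.keys p"
    then have "snd tb \<in> carrier (burnside (ext_prod C B))" "snd ta \<in> carrier (burnside (ext_prod B A))"
      using k by auto
    then show "fst tb * fst ta * of_int (burnside_mat A C L e c (burnside_comp C B A (snd tb) (snd ta))) =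
        (\<Sum>d \<in> gclasses B L. (fst tb * of_int (burnside_mat B C L e d (snd tb))) *
          (fst ta * of_int (burnside_mat A B L d c (snd ta))))"
      by (simp add: burnside_mat_comp[OF A B C L c e] sum_distrib_left mult_ac)
  qed
  also have "\<dots> = (\<Sum>d \<in> gclasses B L. morph_mat B C L e d \<psi> * morph_mat A B L d c \<phi>)"
    unfolding frag_eval_sum frag_eval_mult_left frag_eval_mult_right
    by (intro sum.cong refl arg_cong2[where f = "(*)"])
      (simp_all add: morph_mat_eq[OF B C L _ \<psi> qp(1)] morph_mat_eq[OF A B L c \<phi> qp(2)] case_prod_unfold)
  finally show ?thesis .
qed

lemma morph_mat_id:
  assumes A: "finite_gset A" and L: "group L" "finite (carrier L)"
    and c: "c \<in> gclasses A L"
  shows "morph_mat A A L d c (id_C A :: ('r::comm_ring_1, 'g, 'x, 'g, 'x) morph) = (if d = c then 1 else 0)"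
proof -
  have i: "(id_C A :: ('r, 'g, 'x, 'g, 'x) morph) = span_hom A A (id_span A)"
    by (simp add: id_C_def span_hom_def)
  show ?thesis
    unfolding i morph_mat_eq[OF A A L c span_hom_in_Hom_C[OF over_base_id_span[OF A]]]
    by (simp add: burnside_mat_class[OF A A L c over_base_id_span[OF A]] span_mat_id[OF A L c])
qed

section \<open>Counting classes\<close>

definition conj_set :: "('g, 'm) monoid_scheme \<Rightarrow> 'g \<Rightarrow> 'g set \<Rightarrow> 'g set" where
  "conj_set M g E = (\<lambda>e. g \<otimes>\<^bsub>M\<^esub> e \<otimes>\<^bsub>M\<^esub> inv\<^bsub>M\<^esub> g) ` E"

lemma conj_set_mult:
  assumes "group M" "E \<subseteq> carrier M" "a \<in> carrier M" "b \<in> carrier M"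
  shows "conj_set M (a \<otimes>\<^bsub>M\<^esub> b) E = conj_set M a (conj_set M b E)"
proof -
  interpret group M by fact
  show ?thesis unfolding conj_set_def image_image
    using assms by (intro image_cong) (auto simp: m_assoc inv_mult_group subsetD)
qed

lemma conj_set_one:
  assumes "group M" "E \<subseteq> carrier M"
  shows "conj_set M \<one>\<^bsub>M\<^esub> E = E"
proof -
  interpret group M by fact
  have "conj_set M \<one>\<^bsub>M\<^esub> E = (\<lambda>e. e) ` E" unfolding conj_set_def
    using assms by (intro image_cong) (auto simp: subsetD)
  then show ?thesis by simp
qed

lemma conj_set_subset:
  assumes "group M" "E \<subseteq> carrier M" "a \<in> carrier M"
  shows "conj_set M a E \<subseteq> carrier M"
proof -
  interpret group M by fact
  show ?thesis unfolding conj_set_def using assms by auto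
qed

lemma conj_set_subgroup:
  assumes M: "group M" and E: "subgroup E M" and a: "a \<in> carrier M"
  shows "subgroup (conj_set M a E) M"
proof -
  interpret group M by fact
  have "(\<lambda>e. a \<otimes>\<^bsub>M\<^esub> e \<otimes>\<^bsub>M\<^esub> inv\<^bsub>M\<^esub> a) \<in> hom M M"
  proof (rule homI)
    fix x y assume xy: "x \<in> carrier M" "y \<in> carrier M"
    have "inv\<^bsub>M\<^esub> a \<otimes>\<^bsub>M\<^esub> (a \<otimes>\<^bsub>M\<^esub> (y \<otimes>\<^bsub>M\<^esub> inv\<^bsub>M\<^esub> a)) = y \<otimes>\<^bsub>M\<^esub> inv\<^bsub>M\<^esub> a"
      using a xy by (simp flip: m_assoc)
    then show "a \<otimes>\<^bsub>M\<^esub> (x \<otimes>\<^bsub>M\<^esub> y) \<otimes>\<^bsub>M\<^esub> inv\<^bsub>M\<^esub> a =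
        (a \<otimes>\<^bsub>M\<^esub> x \<otimes>\<^bsub>M\<^esub> inv\<^bsub>M\<^esub> a) \<otimes>\<^bsub>M\<^esub> (a \<otimes>\<^bsub>M\<^esub> y \<otimes>\<^bsub>M\<^esub> inv\<^bsub>M\<^esub> a)"
      using a xy by (simp add: m_assoc)
  qed (use a in simp)
  then have "group_hom M M (\<lambda>e. a \<otimes>\<^bsub>M\<^esub> e \<otimes>\<^bsub>M\<^esub> inv\<^bsub>M\<^esub> a)"
    by (intro group_hom.intro group_hom_axioms.intro M)
  from group_hom.subgroup_img_is_subgroup[OF this E] show ?thesis by (simp add: conj_set_def)
qed

lemma tclass_eq_iff:
  assumes Z: "finite_gset Z" and z: "z \<in> pts Z" "z' \<in> pts Z"
    and E: "E \<subseteq> carrier (grp Z)" "E' \<subseteq> carrier (grp Z)"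
  shows "tclass Z (z, E) = tclass Z (z', E') \<longleftrightarrow>
    (\<exists>g \<in> carrier (grp Z). z' = act Z g z \<and> E' = conj_set (grp Z) g E)"
proof
  assume "tclass Z (z, E) = tclass Z (z', E')"
  then have "(z', E') \<in> tclass Z (z, E)" using tclass_refl[OF Z z(2) E(2)] by simp
  then show "\<exists>g \<in> carrier (grp Z). z' = act Z g z \<and> E' = conj_set (grp Z) g E"
    by (auto simp: tclass_def conj_set_def)
next
  note zd = finite_gsetD[OF Z]
  interpret group "grp Z" by (rule zd)
  have sub: "tclass Z (act Z g z, conj_set (grp Z) g E) \<subseteq> tclass Z (z, E)"
    if "g \<in> carrier (grp Z)" "z \<in> pts Z" "E \<subseteq> carrier (grp Z)" for g z E
  proof
    fix p assume "p \<in> tclass Z (act Z g z, conj_set (grp Z) g E)"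
    then obtain h where h: "h \<in> carrier (grp Z)" "p = (act Z h (act Z g z), conj_set (grp Z) h (conj_set (grp Z) g E))"
      by (auto simp: tclass_def conj_set_def)
    have "p = (act Z (h \<otimes>\<^bsub>grp Z\<^esub> g) z, conj_set (grp Z) (h \<otimes>\<^bsub>grp Z\<^esub> g) E)"
      using that h by (simp add: zd(6) conj_set_mult[OF zd(1)])
    then show "p \<in> tclass Z (z, E)" using h(1) that(1) by (auto simp: tclass_def conj_set_def)
  qed
  assume "\<exists>g \<in> carrier (grp Z). z' = act Z g z \<and> E' = conj_set (grp Z) g E"
  then obtain g where g: "g \<in> carrier (grp Z)" "z' = act Z g z" "E' = conj_set (grp Z) g E" by blast
  have "act Z (inv\<^bsub>grp Z\<^esub> g) z' = z" "conj_set (grp Z) (inv\<^bsub>grp Z\<^esub> g) E' = E"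
    using g z E by (simp_all add: zd(5) conj_set_one[OF zd(1)] flip: zd(6) conj_set_mult[OF zd(1)])
  then show "tclass Z (z, E) = tclass Z (z', E')"
    using sub[OF g(1) z(1) E(1)] sub[of "inv\<^bsub>grp Z\<^esub> g" z' E'] g z E by auto
qed

lemma card_image_eq_of_kernel:
  assumes "\<And>x y. x \<in> S \<Longrightarrow> y \<in> S \<Longrightarrow> f x = f y \<longleftrightarrow> g x = g y"
  shows "card (f ` S) = card (g ` S)"
proof -
  let ?r = "inv_into S f"
  have r: "?r y \<in> S" "f (?r y) = y" if "y \<in> f ` S" for y
    using that by (auto simp: inv_into_into f_inv_into_f)
  have gr: "g (?r (f x)) = g x" if "x \<in> S" for x
    using that r[of "f x"] assms[of "?r (f x)" x] by simp
  have "bij_betw (g \<circ> ?r) (f ` S) (g ` S)"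
  proof (rule bij_betw_imageI)
    show "inj_on (g \<circ> ?r) (f ` S)"
      by (rule inj_onI) (auto simp: gr assms)
    show "(g \<circ> ?r) ` f ` S = g ` S"
      unfolding image_image by (intro image_cong) (auto simp: gr)
  qed
  then show ?thesis by (rule bij_betw_same_card)
qed

text \<open>Over a one-point set the base point carries no information, so the classes of
  \<open>point G\<close> are the conjugacy classes of these subgroups.\<close>

definition graph_subgroups :: "'g monoid \<Rightarrow> 'l monoid \<Rightarrow> ('g \<times> 'l) set set" where
  "graph_subgroups G L = {E. subgroup E (G \<times>\<times> L) \<and> graph_like (point G) L E}"

lemma gclasses_point:
  "gclasses (point G) L = (\<lambda>E. tclass (over_pt (point G) L) (((), ()), E)) ` graph_subgroups G L"
  by (auto simp: gclasses_def graph_subgroups_def ext_prod_def point_def)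

lemma graph_subgroups_subset: "E \<in> graph_subgroups G L \<Longrightarrow> E \<subseteq> carrier (G \<times>\<times> L)"
  unfolding graph_subgroups_def by (blast intro: subgroup.subset[THEN subsetD])

lemma tclass_point_eq_iff:
  assumes G: "group G" "finite (carrier G)" and L: "group L" "finite (carrier L)"
    and E: "E \<in> graph_subgroups G L" "E' \<in> graph_subgroups G L"
  shows "tclass (over_pt (point G) L) (((), ()), E) = tclass (over_pt (point G) L) (((), ()), E') \<longleftrightarrow>
    (\<exists>p \<in> carrier (G \<times>\<times> L). E' = conj_set (G \<times>\<times> L) p E)"
proof -
  have g: "grp (over_pt (point G) L) = G \<times>\<times> L" by (simp add: ext_prod_def point_def)
  have Z: "finite_gset (over_pt (point G) L)" by (intro finite_gset_ext_prod finite_gset_point G L)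
  have sub: "E \<subseteq> carrier (G \<times>\<times> L)" "E' \<subseteq> carrier (G \<times>\<times> L)"
    by (rule graph_subgroups_subset[OF E(1)], rule graph_subgroups_subset[OF E(2)])
  have pt: "((), ()) \<in> pts (over_pt (point G) L)" by (simp add: ext_prod_def point_def)
  show ?thesis
    using tclass_eq_iff[OF Z pt pt, of E E', unfolded g, OF sub] by (simp add: prod_eq_iff)
qed

text \<open>Each pair (y, E) can be translated so that y becomes one of the x i; then E lies in
  Stab(x i) \<times> L, because it fixes x i. An element relating two pairs over the same x i lies
  there as well, so no further conjugacies appear. The stabilizers enter through embeddings
  \<open>\<theta> i\<close> of abstract groups, so that the result applies both to an isomorphism of
  groups and to a direct sum.\<close>

lemma card_gclasses_sum:
  fixes A :: "('a, 'x) gset" and G :: "'i \<Rightarrow> 'g monoid" and L :: "'l monoid"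
  assumes A: "finite_gset A" and L: "group L" "finite (carrier L)" and I: "finite I"
    and G: "\<And>i. i \<in> I \<Longrightarrow> group (G i)" "\<And>i. i \<in> I \<Longrightarrow> finite (carrier (G i))"
    and x: "\<And>i. i \<in> I \<Longrightarrow> x i \<in> pts A"
    and cover: "\<And>y. y \<in> pts A \<Longrightarrow> \<exists>i \<in> I. \<exists>g \<in> carrier (grp A). y = act A g (x i)"
    and disj: "\<And>i j g. i \<in> I \<Longrightarrow> j \<in> I \<Longrightarrow> g \<in> carrier (grp A) \<Longrightarrow> x j = act A g (x i) \<Longrightarrow> i = j"
    and \<theta>: "\<And>i. i \<in> I \<Longrightarrow> \<theta> i \<in> hom (G i) (grp A)" "\<And>i. i \<in> I \<Longrightarrow> inj_on (\<theta> i) (carrier (G i))"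
      "\<And>i. i \<in> I \<Longrightarrow> \<theta> i ` carrier (G i) = {g \<in> carrier (grp A). act A g (x i) = x i}"
  shows "card (gclasses A L) = (\<Sum>i\<in>I. card (gclasses (point (G i)) L))"
proof -
  let ?Z = "over_pt A L"
  have Z: "finite_gset ?Z" by (intro finite_gset_ext_prod A finite_gset_point L)
  note zd = finite_gsetD[OF Z] and ad = finite_gsetD[OF A]
  interpret A: group "grp A" by (rule ad)
  interpret L: group L by (rule L)
  interpret Z: group "grp ?Z" by (rule zd)
  have gZ: "grp ?Z = grp A \<times>\<times> L" by (simp add: ext_prod_def point_def)
  have pZ: "pts ?Z = pts A \<times> {()}" by (simp add: ext_prod_def point_def)
  have aZ: "act ?Z (g, l) (y, ()) = (act A g y, ())" if "y \<in> pts A" for g l y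
    using that by (simp add: ext_prod_def point_def)
  define \<kappa> where "\<kappa> i = map_prod (\<theta> i) (id :: 'l \<Rightarrow> 'l)" for i
  have \<kappa>_hom: "group_hom (G i \<times>\<times> L) (grp ?Z) (\<kappa> i)" if i: "i \<in> I" for i
  proof -
    have "\<kappa> i \<in> hom (G i \<times>\<times> L) (grp ?Z)"
      unfolding gZ \<kappa>_def by (rule homI) (use \<theta>(1)[OF i] in \<open>auto simp: hom_def\<close>)
    then show ?thesis
      by (intro group_hom.intro group_hom_axioms.intro DirProd_group G(1)[OF i] L(1) zd(1))
  qed
  have \<kappa>_inj: "inj_on (\<kappa> i) (carrier (G i \<times>\<times> L))" if i: "i \<in> I" for i
    using \<theta>(2)[OF i] by (auto simp: \<kappa>_def inj_on_def)
  have \<theta>_carr: "\<theta> i g \<in> carrier (grp A)" "act A (\<theta> i g) (x i) = x i" if "i \<in> I" "g \<in> carrier (G i)" for i g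
    using \<theta>(3)[OF that(1)] that(2) by auto
  have \<theta>_one: "\<theta> i \<one>\<^bsub>G i\<^esub> = \<one>\<^bsub>grp A\<^esub>" if "i \<in> I" for i
    by (rule hom_one[OF \<theta>(1)[OF that] G(1)[OF that] ad(1)])
  define F where "F i E = tclass ?Z ((x i, ()), \<kappa> i ` E)" for i E
  let ?S = "\<lambda>i. graph_subgroups (G i) L"
  have sub: "E \<subseteq> carrier (G i \<times>\<times> L)" if "E \<in> ?S i" for i E
    by (rule graph_subgroups_subset[OF that])
  have \<kappa>sub: "\<kappa> i ` E \<subseteq> carrier (grp ?Z)" if "E \<in> ?S i" "i \<in> I" for i E
    using sub[OF that(1)] group_hom.hom_closed[OF \<kappa>_hom[OF that(2)]] by blast
  have xZ: "(x i, ()) \<in> pts ?Z" if "i \<in> I" for i using x[OF that] by (simp add: pZ)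
  have conj: "\<kappa> i ` conj_set (G i \<times>\<times> L) p E = conj_set (grp ?Z) (\<kappa> i p) (\<kappa> i ` E)"
    if "i \<in> I" "E \<subseteq> carrier (G i \<times>\<times> L)" "p \<in> carrier (G i \<times>\<times> L)" for i p E
  proof -
    interpret k: group_hom "G i \<times>\<times> L" "grp ?Z" "\<kappa> i" by (rule \<kappa>_hom[OF that(1)])
    show ?thesis unfolding conj_set_def image_image
      using that(2,3) by (intro image_cong) (auto simp: subsetD simp del: carrier_DirProd)
  qed
  have F_eq: "i = j \<and> (\<exists>p \<in> carrier (G i \<times>\<times> L). E' = conj_set (G i \<times>\<times> L) p E)"
    if ij: "i \<in> I" "j \<in> I" and E: "E \<in> ?S i" "E' \<in> ?S j" and eq: "F i E = F j E'" for i j E E'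
  proof -
    obtain q where q: "q \<in> carrier (grp ?Z)" "(x j, ()) = act ?Z q (x i, ())"
        "\<kappa> j ` E' = conj_set (grp ?Z) q (\<kappa> i ` E)"
      using eq tclass_eq_iff[OF Z xZ[OF ij(1)] xZ[OF ij(2)] \<kappa>sub[OF E(1) ij(1)] \<kappa>sub[OF E(2) ij(2)]]
      unfolding F_def by blast
    obtain g l where gl: "q = (g, l)" "g \<in> carrier (grp A)" "l \<in> carrier L" using q(1) by (auto simp: gZ)
    have xj: "x j = act A g (x i)" using q(2) aZ[OF x[OF ij(1)]] by (simp add: gl(1))
    have ij': "i = j" by (rule disj[OF ij gl(2) xj])
    \<comment> \<open>As i = j, the element g fixes x i and so comes from \<open>G i\<close>; pulled
      back along \<open>\<theta> i\<close> it conjugates \<open>E\<close> to \<open>E'\<close>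
      there.\<close>
    have "g \<in> \<theta> i ` carrier (G i)" using xj ij' gl(2) \<theta>(3)[OF ij(1)] by simp
    then obtain h where h: "h \<in> carrier (G i)" "g = \<theta> i h" by blast
    have hl: "(h, l) \<in> carrier (G i \<times>\<times> L)" using h gl by simp
    have "\<kappa> i ` E' = \<kappa> i ` conj_set (G i \<times>\<times> L) (h, l) E"
      unfolding conj[OF ij(1) sub[OF E(1)] hl] using q(3) ij' by (simp add: gl h \<kappa>_def)
    moreover have "conj_set (G i \<times>\<times> L) (h, l) E \<subseteq> carrier (G i \<times>\<times> L)"
      by (rule conj_set_subset[OF _ sub[OF E(1)] hl]) (intro DirProd_group G(1)[OF ij(1)] L(1))
    moreover have "E' \<subseteq> carrier (G i \<times>\<times> L)" using sub[OF E(2)] ij' by simp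
    ultimately have "E' = conj_set (G i \<times>\<times> L) (h, l) E"
      using inj_on_image_eq_iff[OF \<kappa>_inj[OF ij(1)]] by blast
    then show ?thesis using ij' hl by blast
  qed
  have F_eq': "F i (conj_set (G i \<times>\<times> L) p E) = F i E"
    if i: "i \<in> I" and E: "E \<in> ?S i" and p: "p \<in> carrier (G i \<times>\<times> L)" for i p E
  proof -
    have c: "conj_set (G i \<times>\<times> L) p E \<subseteq> carrier (G i \<times>\<times> L)"
      by (rule conj_set_subset[OF _ sub[OF E] p]) (intro DirProd_group G(1)[OF i] L(1))
    have "\<kappa> i p \<in> carrier (grp ?Z)" by (rule group_hom.hom_closed[OF \<kappa>_hom[OF i] p])
    moreover have "act ?Z (\<kappa> i p) (x i, ()) = (x i, ())"
      using p aZ[OF x[OF i]] \<theta>_carr[OF i] by (cases p) (auto simp: \<kappa>_def)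
    moreover have "\<kappa> i ` conj_set (G i \<times>\<times> L) p E \<subseteq> carrier (grp ?Z)"
      using c group_hom.hom_closed[OF \<kappa>_hom[OF i]] by blast
    ultimately have "tclass ?Z ((x i, ()), \<kappa> i ` E) = tclass ?Z ((x i, ()), \<kappa> i ` conj_set (G i \<times>\<times> L) p E)"
      using conj[OF i sub[OF E] p]
      by (intro iffD2[OF tclass_eq_iff[OF Z xZ[OF i] xZ[OF i] \<kappa>sub[OF E i]]] bexI[of _ "\<kappa> i p"]) auto
    then show ?thesis by (simp add: F_def)
  qed
  have F_in: "F i E \<in> gclasses A L" if i: "i \<in> I" and E: "E \<in> ?S i" for i E
  proof -
    have s: "subgroup E (G i \<times>\<times> L)" and g: "graph_like (point (G i)) L E"
      using E by (auto simp: graph_subgroups_def)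
    have "subgroup (\<kappa> i ` E) (grp ?Z)" by (rule group_hom.subgroup_img_is_subgroup[OF \<kappa>_hom[OF i] s])
    moreover have "\<forall>e \<in> \<kappa> i ` E. act ?Z e (x i, ()) = (x i, ())"
      using sub[OF E] aZ[OF x[OF i]] \<theta>_carr[OF i] by (auto simp: \<kappa>_def)
    moreover have "graph_like A L (\<kappa> i ` E)"
      unfolding graph_like_def
    proof (intro conjI allI ballI impI)
      fix l assume "(\<one>\<^bsub>grp A\<^esub>, l) \<in> \<kappa> i ` E"
      then obtain h where h: "(h, l) \<in> E" "\<theta> i h = \<one>\<^bsub>grp A\<^esub>" by (auto simp: \<kappa>_def)
      then have "h = \<one>\<^bsub>G i\<^esub>"
        using sub[OF E] \<theta>_one[OF i] inj_onD[OF \<theta>(2)[OF i], of h "\<one>\<^bsub>G i\<^esub>"]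
          monoid.one_closed[OF group.is_monoid[OF G(1)[OF i]]] by auto
      then show "l = \<one>\<^bsub>L\<^esub>" using g h(1) by (auto simp: graph_like_def point_def)
    next
      fix l assume "l \<in> carrier L"
      then obtain h where "(h, l) \<in> E" using g by (auto simp: graph_like_def)
      then show "\<exists>g. (g, l) \<in> \<kappa> i ` E" by (force simp: \<kappa>_def)
    qed
    ultimately show ?thesis unfolding gclasses_def F_def using xZ[OF i] by blast
  qed
  have surj: "\<exists>i \<in> I. \<exists>E \<in> ?S i. c = F i E" if c: "c \<in> gclasses A L" for c
  proof -
    obtain y E where E: "c = tclass ?Z ((y, ()), E)" "y \<in> pts A" "subgroup E (grp ?Z)"
        "\<forall>e \<in> E. act ?Z e (y, ()) = (y, ())" "graph_like A L E"
      using c unfolding gclasses_def by (auto simp: pZ)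
    obtain i g where i: "i \<in> I" and g: "g \<in> carrier (grp A)" "y = act A g (x i)" using cover[OF E(2)] by blast
    \<comment> \<open>Translation by g^-1 takes y back to the representative x i of its orbit; the
      L-component can be left alone.\<close>
    let ?h = "(inv\<^bsub>grp A\<^esub> g, \<one>\<^bsub>L\<^esub>)"
    define E' where "E' = conj_set (grp ?Z) ?h E"
    have gy: "act A (inv\<^bsub>grp A\<^esub> g) y = x i"
      unfolding g(2) using g(1) x[OF i] by (simp add: ad(5) flip: ad(6))
    have h: "?h \<in> carrier (grp ?Z)" "(x i, ()) = act ?Z ?h (y, ())"
      using g(1) by (simp_all add: gZ aZ[OF E(2)] gy)
    have E': "subgroup E' (grp ?Z)" unfolding E'_def by (rule conj_set_subgroup[OF zd(1) E(3) h(1)])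
    have yZ: "(y, ()) \<in> pts ?Z" by (simp add: pZ E(2))
    have c': "c = tclass ?Z ((x i, ()), E')"
      unfolding E(1) tclass_eq_iff[OF Z yZ xZ[OF i] subgroup.subset[OF E(3)] subgroup.subset[OF E']]
      using h E'_def by blast
    have stab: "act A a (x i) = x i" if al: "(a, l) \<in> E'" for a l
    proof -
      obtain e where e: "e \<in> E" "(a, l) = ?h \<otimes>\<^bsub>grp ?Z\<^esub> e \<otimes>\<^bsub>grp ?Z\<^esub> inv\<^bsub>grp ?Z\<^esub> ?h"
        using al unfolding E'_def conj_set_def by blast
      have "e \<in> carrier (grp ?Z)" using subgroup.subset[OF E(3)] e(1) by blast
      then have "act ?Z (a, l) (x i, ()) = (x i, ())"
        unfolding h(2) e(2) using h(1) E(4) e(1) yZ by (simp add: zd(4) flip: zd(6)) (simp add: Z.m_assoc zd(6))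
      then show ?thesis using aZ[OF x[OF i]] by simp
    qed
    have E'_iff: "(a, l) \<in> E' \<longleftrightarrow> (\<exists>b. (b, l) \<in> E \<and> a = inv\<^bsub>grp A\<^esub> g \<otimes>\<^bsub>grp A\<^esub> b \<otimes>\<^bsub>grp A\<^esub> g)" for a l
      using subgroup.subset[OF E(3)] g(1)
      by (force simp: E'_def conj_set_def gZ inv_DirProd[OF ad(1) L(1)])
    \<comment> \<open>Nothing is lost in passing to the preimage: by \<open>stab\<close> the group
      \<open>E'\<close> lies in the image of \<open>\<kappa> i\<close>.\<close>
    define D where "D = {p \<in> carrier (G i \<times>\<times> L). \<kappa> i p \<in> E'}"
    interpret k: group_hom "G i \<times>\<times> L" "grp ?Z" "\<kappa> i" by (rule \<kappa>_hom[OF i])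
    have D: "subgroup D (G i \<times>\<times> L)"
    proof (rule k.G.subgroupI)
      have "\<one>\<^bsub>G i \<times>\<times> L\<^esub> \<in> D"
        using k.G.one_closed k.hom_one subgroup.one_closed[OF E']
        by (simp add: D_def del: carrier_DirProd one_DirProd)
      then show "D \<noteq> {}" by blast
    qed (use E' in \<open>auto simp: D_def subgroup.m_closed subgroup.m_inv_closed simp del: carrier_DirProd\<close>)
    have kD: "\<kappa> i ` D = E'"
    proof (intro equalityI subsetI)
      fix e assume e: "e \<in> E'"
      obtain a l where al: "e = (a, l)" "a \<in> carrier (grp A)" "l \<in> carrier L"
        using subgroup.subset[OF E'] e by (auto simp: gZ)
      have "a \<in> \<theta> i ` carrier (G i)" using stab[of a l] e al \<theta>(3)[OF i] by simp
      then show "e \<in> \<kappa> i ` D" using e al by (force simp: D_def \<kappa>_def)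
    qed (auto simp: D_def)
    have "graph_like (point (G i)) L D"
      unfolding graph_like_def
    proof (intro conjI allI ballI impI)
      fix l assume "(\<one>\<^bsub>grp (point (G i))\<^esub>, l) \<in> D"
      then have "(\<one>\<^bsub>grp A\<^esub>, l) \<in> E'" by (auto simp: D_def \<kappa>_def point_def \<theta>_one[OF i])
      then obtain b where b: "(b, l) \<in> E" "\<one>\<^bsub>grp A\<^esub> = inv\<^bsub>grp A\<^esub> g \<otimes>\<^bsub>grp A\<^esub> b \<otimes>\<^bsub>grp A\<^esub> g" by (auto simp: E'_iff)
      have bA: "b \<in> carrier (grp A)" using subgroup.subset[OF E(3)] b(1) by (auto simp: gZ)
      have "g = g \<otimes>\<^bsub>grp A\<^esub> (inv\<^bsub>grp A\<^esub> g \<otimes>\<^bsub>grp A\<^esub> b \<otimes>\<^bsub>grp A\<^esub> g)" using g(1) by (simp flip: b(2))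
      also have "\<dots> = b \<otimes>\<^bsub>grp A\<^esub> g" using g(1) bA by (simp flip: A.m_assoc)
      finally have "b = \<one>\<^bsub>grp A\<^esub>" using g(1) bA by simp
      then show "l = \<one>\<^bsub>L\<^esub>" using b(1) E(5) by (simp add: graph_like_def)
    next
      fix l assume "l \<in> carrier L"
      then obtain b where "(b, l) \<in> E" using E(5) by (auto simp: graph_like_def)
      then have "(inv\<^bsub>grp A\<^esub> g \<otimes>\<^bsub>grp A\<^esub> b \<otimes>\<^bsub>grp A\<^esub> g, l) \<in> \<kappa> i ` D" unfolding kD E'_iff by blast
      then show "\<exists>h. (h, l) \<in> D" by (auto simp: \<kappa>_def)
    qed
    with D have "D \<in> ?S i" by (simp add: graph_subgroups_def)
    moreover have "c = F i D" unfolding F_def kD by (rule c')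
    ultimately show ?thesis using i by blast
  qed
  have U: "gclasses A L = (\<Union>i\<in>I. F i ` ?S i)"
  proof (intro equalityI subsetI)
    fix c assume "c \<in> gclasses A L"
    from surj[OF this] show "c \<in> (\<Union>i\<in>I. F i ` ?S i)" by (elim bexE) (intro UN_I image_eqI)
  next
    fix c assume "c \<in> (\<Union>i\<in>I. F i ` ?S i)"
    then show "c \<in> gclasses A L" using F_in by (elim UN_E imageE) simp
  qed
  have "card (gclasses A L) = (\<Sum>i\<in>I. card (F i ` ?S i))"
    unfolding U
  proof (rule card_UN_disjoint[OF I])
    show "\<forall>i\<in>I. finite (F i ` ?S i)"
      using finite_subset[OF _ finite_gclasses[OF A L]] F_in by (meson image_subsetI)
    show "\<forall>i\<in>I. \<forall>j\<in>I. i \<noteq> j \<longrightarrow> F i ` ?S i \<inter> F j ` ?S j = {}" using F_eq by blast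
  qed
  also have "\<dots> = (\<Sum>i\<in>I. card (gclasses (point (G i)) L))"
  proof (rule sum.cong[OF refl])
    fix i assume i: "i \<in> I"
    show "card (F i ` ?S i) = card (gclasses (point (G i)) L)"
      unfolding gclasses_point
    proof (rule card_image_eq_of_kernel)
      fix E E' assume E: "E \<in> ?S i" "E' \<in> ?S i"
      show "F i E = F i E' \<longleftrightarrow>
          tclass (over_pt (point (G i)) L) (((), ()), E) = tclass (over_pt (point (G i)) L) (((), ()), E')"
        unfolding tclass_point_eq_iff[OF G(1)[OF i] G(2)[OF i] L E]
        using F_eq[OF i i E] F_eq'[OF i E(1)] by metis
    qed
  qed
  finally show ?thesis .
qed

text \<open>Otherwise padding both matrices with zeros to size \<open>card I\<close> would give an invertible
  square matrix with a zero row.\<close>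

lemma card_le_of_left_inverse:
  fixes P :: "'i \<Rightarrow> 'j \<Rightarrow> 'r::comm_ring_1"
  assumes I: "finite I" and J: "finite J"
    and PQ: "\<And>i k. i \<in> I \<Longrightarrow> k \<in> I \<Longrightarrow> (\<Sum>j\<in>J. P i j * Q j k) = (if i = k then 1 else 0)"
  shows "card I \<le> card J"
proof (rule ccontr)
  assume "\<not> card I \<le> card J"
  define n m where "n = card I" and "m = card J"
  have mn: "m < n" using \<open>\<not> card I \<le> card J\<close> by (simp add: n_def m_def)
  obtain e where e: "bij_betw e {0..<n} I" using ex_bij_betw_nat_finite[OF I] unfolding n_def by blast
  obtain f where f: "bij_betw f {0..<m} J" using ex_bij_betw_nat_finite[OF J] unfolding m_def by blast
  define M where "M = mat n n (\<lambda>(a, b). if b < m then P (e a) (f b) else 0)"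
  define N where "N = mat n n (\<lambda>(a, b). if a < m then Q (f a) (e b) else 0)"
  have MN: "M \<in> carrier_mat n n" "N \<in> carrier_mat n n" by (auto simp: M_def N_def)
  have "M * N = 1\<^sub>m n"
  proof (rule eq_matI)
    fix a c assume "a < dim_row (1\<^sub>m n :: 'r mat)" "c < dim_col (1\<^sub>m n :: 'r mat)"
    then have ac: "a < n" "c < n" by auto
    have "(M * N) $$ (a, c) = (\<Sum>b = 0..<n. M $$ (a, b) * N $$ (b, c))"
      using ac MN by (simp add: scalar_prod_def)
    also have "\<dots> = (\<Sum>b = 0..<n. if b < m then P (e a) (f b) * Q (f b) (e c) else 0)"
      using ac by (intro sum.cong) (auto simp: M_def N_def)
    also have "\<dots> = (\<Sum>b = 0..<m. P (e a) (f b) * Q (f b) (e c))"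
      using mn by (intro sum.mono_neutral_cong_right) auto
    also have "\<dots> = (\<Sum>j\<in>J. P (e a) j * Q j (e c))" by (rule sum.reindex_bij_betw[OF f])
    also have "\<dots> = (if e a = e c then 1 else 0)"
      using ac by (intro PQ bij_betwE[OF e, rule_format]) auto
    also have "e a = e c \<longleftrightarrow> a = c"
      using ac by (intro inj_on_eq_iff[OF bij_betw_imp_inj_on[OF e]]) auto
    finally show "(M * N) $$ (a, c) = 1\<^sub>m n $$ (a, c)" using ac by simp
  qed (use MN in auto)
  then have "det M * det N = 1" using det_mult[OF MN] by simp
  moreover have "det N = (\<Sum>j<n. N $$ (m, j) * cofactor N m j)"
    by (rule laplace_expansion_row[OF MN(2) mn])
  then have "det N = 0" using mn by (simp add: N_def)
  \<comment> \<open>The contradiction is 0 = 1 in R, excluded by the class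
    \<open>comm_ring_1\<close>; over the zero ring any two objects would be isomorphic.\<close>
  ultimately show False by simp
qed

text \<open>By functoriality the matrix of \<psi> times that of \<phi> is the identity matrix
  indexed by \<open>gclasses A L\<close>, factored through \<open>gclasses B L\<close>. One of the
  two composites gives one inequality.\<close>

lemma card_gclasses_le:
  assumes A: "finite_gset A" and B: "finite_gset B" and L: "group L" "finite (carrier L)"
    and \<phi>: "(\<phi> :: ('r::comm_ring_1, 'h, 'y, 'g, 'x) morph) \<in> Hom_C A B" and \<psi>: "\<psi> \<in> Hom_C B A"
    and id: "comp_C A B A \<psi> \<phi> = id_C A"
  shows "card (gclasses A L) \<le> card (gclasses B L)"
proof (rule card_le_of_left_inverse)
  fix d c assume d: "d \<in> gclasses A L" and c: "c \<in> gclasses A L"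
  show "(\<Sum>e\<in>gclasses B L. morph_mat B A L d e \<psi> * morph_mat A B L e c \<phi>) = (if d = c then 1 else 0)"
    by (rule trans[OF morph_mat_comp[OF A B A L c d \<psi> \<phi>, symmetric, unfolded id] morph_mat_id[OF A L c]])
qed (rule finite_gclasses[OF A L] finite_gclasses[OF B L])+

lemma iso_C_card_gclasses:
  assumes A: "finite_gset A" and B: "finite_gset B" and L: "group L" "finite (carrier L)"
    and iso: "iso_C TYPE('r::comm_ring_1) A B"
  shows "card (gclasses A L) = card (gclasses B L)"
  using iso card_gclasses_le[OF A B L] card_gclasses_le[OF B A L] unfolding iso_C_def
  by (metis order_antisym)

text \<open>The one-orbit case of \<open>card_gclasses_sum\<close>: the isomorphism maps
  \<open>G\<close> onto the stabilizer of the single point of \<open>point H\<close>, which is all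
  of \<open>H\<close>.\<close>

lemma card_gclasses_point_iso:
  assumes G: "group G" "finite (carrier G)" and H: "group H" "finite (carrier H)"
    and L: "group L" "finite (carrier L)" and iso: "G \<cong> H"
  shows "card (gclasses (point G) L) = card (gclasses (point H) L)"
proof -
  obtain \<theta> where \<theta>: "\<theta> \<in> iso G H" using iso by (auto simp: is_iso_def)
  have "card (gclasses (point H) L) = (\<Sum>i\<in>{()}. card (gclasses (point G) L))"
  proof (rule card_gclasses_sum[OF finite_gset_point[OF H] L, where x = "\<lambda>_. ()" and \<theta> = "\<lambda>_. \<theta>"], goal_cases)
    case (5 y)
    have "\<one>\<^bsub>H\<^esub> \<in> carrier (grp (point H))" using group.is_monoid[OF H(1)] by (simp add: point_def monoid.one_closed)
    then show ?case by auto
  qed (use G \<theta> in \<open>simp_all add: point_def iso_def bij_betw_def\<close>)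
  then show ?thesis by simp
qed

text \<open>The orbits of the direct sum are its summands. In the i-th one, the point with all group
  coordinates 1 is stabilized exactly by the elements that are 1 away from i, a copy of
  \<open>G i\<close>.\<close>

lemma card_gclasses_dir_sum:
  assumes I: "finite I" and G: "\<And>i. i \<in> I \<Longrightarrow> group (G i)" "\<And>i. i \<in> I \<Longrightarrow> finite (carrier (G i))"
    and L: "group L" "finite (carrier L)"
  shows "card (gclasses (dir_sum I (\<lambda>i. point (G i))) L) = (\<Sum>i\<in>I. card (gclasses (point (G i)) L))"
proof -
  let ?A = "dir_sum I (\<lambda>i. point (G i))"
  have A: "finite_gset ?A" by (intro finite_gset_dir_sum I finite_gset_point G)
  have gA: "grp ?A = product_group I G" by (simp add: dir_sum_def point_def)
  have pA: "pts ?A = {(i, u, f). i \<in> I \<and> f \<in> (\<Pi>\<^sub>E j \<in> I - {i}. carrier (G j))}"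
    by (auto simp: dir_sum_def dir_sum_pts_def point_def)
  have aA: "act ?A g (i, u, f) = (i, (), \<lambda>j \<in> I - {i}. g j \<otimes>\<^bsub>G j\<^esub> f j)"
    if "(i, u, f) \<in> pts ?A" for g i u f
    using that by (simp add: dir_sum_def point_def)
  have mon: "monoid (G i)" if "i \<in> I" for i by (rule group.is_monoid[OF G(1)[OF that]])
  define x where "x i = (i, (), \<lambda>j \<in> I - {i}. \<one>\<^bsub>G j\<^esub>)" for i
  define \<theta> where "\<theta> i g = (\<lambda>j \<in> I. if j = i then g else \<one>\<^bsub>G j\<^esub>)" for i g
  have x: "x i \<in> pts ?A" if "i \<in> I" for i
    using that mon by (auto simp: x_def pA monoid.one_closed)
  have act_x: "act ?A g (x i) = (i, (), \<lambda>j \<in> I - {i}. g j)"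
    if "i \<in> I" "g \<in> carrier (grp ?A)" for i g
  proof -
    have "act ?A g (x i) = (i, (), \<lambda>j \<in> I - {i}. g j \<otimes>\<^bsub>G j\<^esub> (\<lambda>j \<in> I - {i}. \<one>\<^bsub>G j\<^esub>) j)"
      unfolding x_def by (rule aA) (use x[OF that(1)] in \<open>simp add: x_def\<close>)
    also have "(\<lambda>j \<in> I - {i}. g j \<otimes>\<^bsub>G j\<^esub> (\<lambda>j \<in> I - {i}. \<one>\<^bsub>G j\<^esub>) j) = (\<lambda>j \<in> I - {i}. g j)"
      using that mon by (intro restrict_ext) (auto simp: gA PiE_iff monoid.r_one)
    finally show ?thesis .
  qed
  show ?thesis
  proof (rule card_gclasses_sum[OF A L I, where x = x and \<theta> = \<theta>], goal_cases)
    case (4 y)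
    then obtain i u f where y: "y = (i, u, f)" "i \<in> I" "f \<in> (\<Pi>\<^sub>E j \<in> I - {i}. carrier (G j))"
      by (auto simp: pA)
    \<comment> \<open>Coordinate i of a group element does not move the points of the i-th summand,
      so it is set to 1; the other coordinates have to carry 1 to f j.\<close>
    let ?g = "\<lambda>j \<in> I. if j = i then \<one>\<^bsub>G j\<^esub> else f j"
    have g: "?g \<in> carrier (grp ?A)" using y mon by (auto simp: gA PiE_iff monoid.one_closed)
    have "(\<lambda>j \<in> I - {i}. ?g j) = f"
      by (rule extensionalityI[of _ "I - {i}"]) (use y in \<open>auto simp: PiE_iff\<close>)
    then show ?case using g y by (intro bexI[of _ i] bexI[of _ ?g]) (simp_all add: act_x)
  next
    case (5 i j g)
    then show ?case using act_x[of i g] by (simp add: x_def)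
  next
    case (6 i)
    then show ?case using mon
      by (auto simp: hom_def gA \<theta>_def PiE_iff monoid.one_closed monoid.l_one intro!: restrict_ext)
  next
    case (7 i)
    then show ?case by (auto simp: inj_on_def \<theta>_def fun_eq_iff restrict_def split: if_splits)
  next
    case (8 i)
    show ?case
    proof (intro equalityI subsetI)
      fix g assume "g \<in> \<theta> i ` carrier (G i)"
      then obtain h where h: "h \<in> carrier (G i)" "g = \<theta> i h" by blast
      then have g: "g \<in> carrier (grp ?A)" using mon by (auto simp: gA \<theta>_def PiE_iff monoid.one_closed)
      have "(\<lambda>j \<in> I - {i}. g j) = (\<lambda>j \<in> I - {i}. \<one>\<^bsub>G j\<^esub>)"
        by (rule restrict_ext) (simp add: h(2) \<theta>_def)
      then show "g \<in> {g \<in> carrier (grp ?A). act ?A g (x i) = x i}"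
        using g act_x[OF 8 g] by (simp add: x_def)
    next
      fix g assume "g \<in> {g \<in> carrier (grp ?A). act ?A g (x i) = x i}"
      then have g: "g \<in> carrier (grp ?A)" "(\<lambda>j \<in> I - {i}. g j) = (\<lambda>j \<in> I - {i}. \<one>\<^bsub>G j\<^esub>)"
        using act_x[OF 8] by (auto simp: x_def)
      have "g j = \<one>\<^bsub>G j\<^esub>" if "j \<in> I" "j \<noteq> i" for j
        using fun_cong[OF g(2), of j] that by simp
      then have "g = \<theta> i (g i)"
        using g(1) by (intro extensionalityI[of _ I]) (auto simp: gA \<theta>_def PiE_iff)
      moreover have "g i \<in> carrier (G i)" using g(1) 8 by (auto simp: gA)
      ultimately show "g \<in> \<theta> i ` carrier (G i)" by blast
    qed
  qed (use G x in auto)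
qed

text \<open>The diagonal is the graph of the identity map of \<open>G\<close>.\<close>

lemma gclasses_point_self: "group G \<Longrightarrow> gclasses (point G) G \<noteq> {}"
proof -
  assume "group G"
  then interpret group G .
  have "subgroup {(g, g) | g. g \<in> carrier G} (G \<times>\<times> G)"
  proof (rule group.subgroupI[OF DirProd_group[OF \<open>group G\<close> \<open>group G\<close>]])
    show "{(g, g) | g. g \<in> carrier G} \<noteq> {}" using one_closed by blast
  qed (auto simp: inv_DirProd[OF \<open>group G\<close> \<open>group G\<close>])
  then have "{(g, g) | g. g \<in> carrier G} \<in> graph_subgroups G G"
    by (auto simp: graph_subgroups_def graph_like_def point_def)
  then show ?thesis by (auto simp: gclasses_point)
qed

lemma card_gclasses_point_self:
  assumes "group G" "finite (carrier G)"
  shows "0 < card (gclasses (point G) G)"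
  using gclasses_point_self[OF assms(1)] finite_gclasses[OF finite_gset_point[OF assms] assms]
  by (simp add: card_gt_0_iff)

text \<open>A graph-like subgroup is the graph of a surjection from a subgroup of \<open>G\<close>
  onto \<open>L\<close>, whence the inequality of orders. If the orders agree, that subgroup is all
  of \<open>G\<close> and the surjection is bijective.\<close>

lemma gclasses_point_nonempty:
  assumes G: "group G" "finite (carrier G)" and L: "group L" "finite (carrier L)"
    and ne: "gclasses (point G) L \<noteq> {}"
  shows "card (carrier L) \<le> card (carrier G)"
    and "card (carrier L) = card (carrier G) \<Longrightarrow> L \<cong> G"
proof -
  interpret G: group G by (rule G)
  interpret L: group L by (rule L)
  obtain E where E: "subgroup E (G \<times>\<times> L)" "graph_like (point G) L E"
    using ne by (auto simp: gclasses_point graph_subgroups_def)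
  interpret E: subgroup E "G \<times>\<times> L" by (rule E)
  have uniq: "l = l'" if "(g, l) \<in> E" "(g, l') \<in> E" for g l l'
  proof -
    have c: "g \<in> carrier G" "l \<in> carrier L" "l' \<in> carrier L" using that E.subset by auto
    have "(g, l) \<otimes>\<^bsub>G \<times>\<times> L\<^esub> inv\<^bsub>G \<times>\<times> L\<^esub> (g, l') \<in> E" using that E.m_inv_closed E.m_closed by blast
    then have "(\<one>\<^bsub>G\<^esub>, l \<otimes>\<^bsub>L\<^esub> inv\<^bsub>L\<^esub> l') \<in> E" using c by (simp add: inv_DirProd[OF G(1) L(1)])
    then have "l \<otimes>\<^bsub>L\<^esub> inv\<^bsub>L\<^esub> l' = \<one>\<^bsub>L\<^esub>" using E(2) by (simp add: graph_like_def point_def)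
    then show ?thesis using c by (metis L.inv_equality L.inv_inv L.inv_closed)
  qed
  \<comment> \<open>A set-theoretic section of the surjection: injective by \<open>uniq\<close>, and
    seen to be multiplicative once it exhausts \<open>G\<close>.\<close>
  define f where "f l = (SOME g. (g, l) \<in> E)" for l
  have f: "(f l, l) \<in> E" if "l \<in> carrier L" for l
    unfolding f_def by (rule someI_ex) (use E(2) that in \<open>simp add: graph_like_def\<close>)
  have f_carr: "f ` carrier L \<subseteq> carrier G" using f E.subset by auto
  have f_inj: "inj_on f (carrier L)" by (rule inj_onI) (metis f uniq)
  show "card (carrier L) \<le> card (carrier G)" by (rule card_inj_on_le[OF f_inj f_carr G(2)])
  assume eq: "card (carrier L) = card (carrier G)"
  have f_surj: "f ` carrier L = carrier G"
    by (rule card_subset_eq[OF G(2) f_carr]) (simp add: card_image[OF f_inj] eq)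
  have fE: "f l = g" if "(g, l) \<in> E" for g l
  proof -
    have "g \<in> f ` carrier L" using that E.subset f_surj by auto
    then show ?thesis using uniq[OF that] f by force
  qed
  have "f \<in> iso L G"
  proof (intro isoI homI)
    fix a b assume "a \<in> carrier L" "b \<in> carrier L"
    then have "(f a, a) \<otimes>\<^bsub>G \<times>\<times> L\<^esub> (f b, b) \<in> E" using f E.m_closed by blast
    then show "f (a \<otimes>\<^bsub>L\<^esub> b) = f a \<otimes>\<^bsub>G\<^esub> f b" using fE by simp
  qed (use f_carr f_inj f_surj in \<open>auto simp: bij_betw_def\<close>)
  then show "L \<cong> G" by (auto simp: is_iso_def)
qed

text \<open>The test group is \<open>G i\<close> itself. The term of index i makes the left sum
  positive, so some \<open>H j\<close> has a class for \<open>G i\<close> and hence at least its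
  order. Maximality forces equal orders, and equal orders force an isomorphism.\<close>

lemma iso_of_maximal_order:
  fixes G :: "'i \<Rightarrow> 'g monoid" and H :: "'j \<Rightarrow> 'h monoid"
  assumes I: "finite I" and i: "i \<in> I" and g: "group (G i)" "finite (carrier (G i))"
    and H: "\<And>j. j \<in> J \<Longrightarrow> group (H j) \<and> finite (carrier (H j))"
    and max: "\<And>j. j \<in> J \<Longrightarrow> card (carrier (H j)) \<le> card (carrier (G i))"
    and sum: "(\<Sum>k\<in>I. card (gclasses (point (G k)) (G i))) = (\<Sum>j\<in>J. card (gclasses (point (H j)) (G i)))"
  shows "\<exists>j\<in>J. G i \<cong> H j"
proof -
  have "0 < (\<Sum>k\<in>I. card (gclasses (point (G k)) (G i)))"
    using card_gclasses_point_self[OF g] by (intro sum_pos2[OF I i]) auto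
  then have "(\<Sum>j\<in>J. card (gclasses (point (H j)) (G i))) \<noteq> 0" by (simp add: sum)
  then obtain j where j: "j \<in> J" "card (gclasses (point (H j)) (G i)) \<noteq> 0"
    by (rule sum.not_neutral_contains_not_neutral)
  then have ne: "gclasses (point (H j)) (G i) \<noteq> {}" by auto
  note h = conjunct1[OF H[OF j(1)]] conjunct2[OF H[OF j(1)]]
  have "card (carrier (G i)) = card (carrier (H j))"
    using gclasses_point_nonempty(1)[OF h g ne] max[OF j(1)] by simp
  then show ?thesis using gclasses_point_nonempty(2)[OF h g ne] j(1) by blast
qed

lemma matching_of_card_gclasses:
  fixes G :: "'i \<Rightarrow> 'g monoid" and H :: "'j \<Rightarrow> 'h monoid"
  assumes "finite I" "finite J"
    and "\<And>i. i \<in> I \<Longrightarrow> group (G i) \<and> finite (carrier (G i))"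
    and "\<And>j. j \<in> J \<Longrightarrow> group (H j) \<and> finite (carrier (H j))"
    and "\<And>L :: 'g monoid. group L \<Longrightarrow> finite (carrier L) \<Longrightarrow>
      (\<Sum>i\<in>I. card (gclasses (point (G i)) L)) = (\<Sum>j\<in>J. card (gclasses (point (H j)) L))"
    and "\<And>L :: 'h monoid. group L \<Longrightarrow> finite (carrier L) \<Longrightarrow>
      (\<Sum>i\<in>I. card (gclasses (point (G i)) L)) = (\<Sum>j\<in>J. card (gclasses (point (H j)) L))"
  shows "\<exists>\<sigma>. bij_betw \<sigma> I J \<and> (\<forall>i\<in>I. G i \<cong> H (\<sigma> i))"
  using assms
proof (induction "card I" arbitrary: I J rule: less_induct)
  case less
  note I = less.prems(1) and J = less.prems(2) and G = less.prems(3) and H = less.prems(4)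
    and sG = less.prems(5) and sH = less.prems(6)
  have large: "\<exists>i\<in>I. \<exists>j\<in>J. G i \<cong> H j" if IJ: "I \<noteq> {} \<or> J \<noteq> {}"
  proof -
    \<comment> \<open>The maximum is taken over both families at once, so that whichever family
      attains it also bounds the other.\<close>
    let ?S = "(\<lambda>i. card (carrier (G i))) ` I \<union> (\<lambda>j. card (carrier (H j))) ` J"
    have S: "finite ?S" "?S \<noteq> {}" using I J IJ by auto
    have max: "\<And>i. i \<in> I \<Longrightarrow> card (carrier (G i)) \<le> Max ?S" "\<And>j. j \<in> J \<Longrightarrow> card (carrier (H j)) \<le> Max ?S"
      using Max_ge[OF S(1)] by auto
    have "(\<exists>i \<in> I. card (carrier (G i)) = Max ?S) \<or> (\<exists>j \<in> J. card (carrier (H j)) = Max ?S)"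
      using Max_in[OF S] by (elim UnE imageE) auto
    then consider i where "i \<in> I" "card (carrier (G i)) = Max ?S" | j where "j \<in> J" "card (carrier (H j)) = Max ?S"
      by blast
    then show ?thesis
    proof cases
      case 1
      note g = conjunct1[OF G[OF 1(1)]] conjunct2[OF G[OF 1(1)]]
      have "\<exists>j\<in>J. G i \<cong> H j"
        by (rule iso_of_maximal_order[of I i G J H, OF I 1(1) g H]) (use max(2) 1(2) sG[OF g] in auto)
      then show ?thesis using 1(1) by blast
    next
      case 2
      note h = conjunct1[OF H[OF 2(1)]] conjunct2[OF H[OF 2(1)]]
      have "\<exists>i\<in>I. H j \<cong> G i"
        by (rule iso_of_maximal_order[of J j H I G, OF J 2(1) h G]) (use max(1) 2(2) sH[OF h] in auto)
      then show ?thesis using group.iso_sym[OF h(1)] 2(1) by blast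
    qed
  qed
  show ?case
  proof (cases "I = {} \<and> J = {}")
    case True
    then show ?thesis by (auto simp: bij_betw_def)
  next
    case False
    then obtain i j where ij: "i \<in> I" "j \<in> J" "G i \<cong> H j" using large by blast
    note g = conjunct1[OF G[OF ij(1)]] conjunct2[OF G[OF ij(1)]]
    note h = conjunct1[OF H[OF ij(2)]] conjunct2[OF H[OF ij(2)]]
    have "\<exists>\<sigma>. bij_betw \<sigma> (I - {i}) (J - {j}) \<and> (\<forall>k\<in>I - {i}. G k \<cong> H (\<sigma> k))"
    proof (rule less.hyps)
      show "card (I - {i}) < card I" using I ij(1) by (rule card_Diff1_less)
      fix L :: "'g monoid" assume L: "group L" "finite (carrier L)"
      show "(\<Sum>i\<in>I - {i}. card (gclasses (point (G i)) L)) = (\<Sum>j\<in>J - {j}. card (gclasses (point (H j)) L))"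
        using sG[OF L] sum.remove[OF I ij(1), of "\<lambda>i. card (gclasses (point (G i)) L)"]
          sum.remove[OF J ij(2), of "\<lambda>j. card (gclasses (point (H j)) L)"]
          card_gclasses_point_iso[OF g h L ij(3)] by simp
    next
      fix L :: "'h monoid" assume L: "group L" "finite (carrier L)"
      show "(\<Sum>i\<in>I - {i}. card (gclasses (point (G i)) L)) = (\<Sum>j\<in>J - {j}. card (gclasses (point (H j)) L))"
        using sH[OF L] sum.remove[OF I ij(1), of "\<lambda>i. card (gclasses (point (G i)) L)"]
          sum.remove[OF J ij(2), of "\<lambda>j. card (gclasses (point (H j)) L)"]
          card_gclasses_point_iso[OF g h L ij(3)] by simp
    qed (use I J G H in auto)
    then obtain \<sigma> where \<sigma>: "bij_betw \<sigma> (I - {i}) (J - {j})" "\<And>k. k \<in> I - {i} \<Longrightarrow> G k \<cong> H (\<sigma> k)" by blast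
    have "bij_betw (\<sigma>(i := j)) (I - {i}) (J - {j})"
      using \<sigma>(1) by (rule bij_betw_cong[THEN iffD2, rotated]) auto
    then have "bij_betw (\<sigma>(i := j)) ((I - {i}) \<union> {i}) ((J - {j}) \<union> {j})"
      using notIn_Un_bij_betw[of i "I - {i}" "\<sigma>(i := j)" "J - {j}"] by simp
    then have "bij_betw (\<sigma>(i := j)) I J" using ij by (simp add: insert_absorb)
    moreover have "\<forall>k\<in>I. G k \<cong> H ((\<sigma>(i := j)) k)" using \<sigma>(2) ij(3) by auto
    ultimately show ?thesis by blast
  qed
qed

context
  fixes A :: "('a, 'x) gset" and G :: "nat \<Rightarrow> 'g monoid" and H :: "nat \<Rightarrow> 'h monoid" and n m :: nat
  assumes G: "\<And>i. i \<in> {1..n} \<Longrightarrow> group (G i) \<and> finite (carrier (G i))"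
    and H: "\<And>j. j \<in> {1..m} \<Longrightarrow> group (H j) \<and> finite (carrier (H j))"
    and A: "finite_gset A"
    and iG: "iso_C TYPE('r::comm_ring_1) A (dir_sum {1..n} (\<lambda>i. point (G i)))"
    and iH: "iso_C TYPE('r) A (dir_sum {1..m} (\<lambda>j. point (H j)))"
begin

lemma sum_card_gclasses_eq:
  assumes L: "group L" "finite (carrier L)"
  shows "(\<Sum>i\<in>{1..n}. card (gclasses (point (G i)) L)) = (\<Sum>j\<in>{1..m}. card (gclasses (point (H j)) L))"
proof -
  have DG: "finite_gset (dir_sum {1..n} (\<lambda>i. point (G i)))" and DH: "finite_gset (dir_sum {1..m} (\<lambda>j. point (H j)))"
    using G H by (auto intro!: finite_gset_dir_sum finite_gset_point)
  show ?thesis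
    using iso_C_card_gclasses[OF A DG L iG] iso_C_card_gclasses[OF A DH L iH]
      card_gclasses_dir_sum[of "{1..n}" G L] card_gclasses_dir_sum[of "{1..m}" H L] G H L by simp
qed

text \<open>The comparison runs through a common object \<open>A\<close>, so that it serves both
  halves of the theorem: for the first, \<open>A\<close> is one of the direct sums, for the second
  an object that decomposes into its stabilizers.\<close>

lemma unique_decomposition:
  "m = n \<and> (\<exists>\<sigma>. \<sigma> permutes {1..n} \<and> (\<forall>i \<in> {1..n}. G i \<cong> H (\<sigma> i)))"
proof -
  obtain \<sigma> where \<sigma>: "bij_betw \<sigma> {1..n} {1..m}" "\<forall>i\<in>{1..n}. G i \<cong> H (\<sigma> i)"
    using matching_of_card_gclasses[of "{1..n}" "{1..m}" G H, OF _ _ G H sum_card_gclasses_eq sum_card_gclasses_eq] by blast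
  have mn: "m = n" using bij_betw_same_card[OF \<sigma>(1)] by simp
  \<comment> \<open>\<open>permutes\<close> asks for the identity outside the index set.\<close>
  let ?\<tau> = "\<lambda>i. if i \<in> {1..n} then \<sigma> i else i"
  have "bij_betw ?\<tau> {1..n} {1..n}"
    using \<sigma>(1) unfolding mn by (rule bij_betw_cong[THEN iffD1, rotated]) simp
  then have "?\<tau> permutes {1..n}" by (rule bij_imp_permutes) auto
  then show ?thesis using \<sigma>(2) mn by (intro conjI exI[of _ ?\<tau>]) auto
qed

end

section \<open>Biprincipal spans are invertible\<close>

definition op_span :: "('h, 'y, 'g, 'x, 'u) span \<Rightarrow> ('g, 'x, 'h, 'y, 'u) span" where
  "op_span U = \<lparr>tot = tot U, oact = (\<lambda>(g, h). oact U (h, g)), str = (\<lambda>u. prod.swap (str U u))\<rparr>"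

lemma op_span_simps [simp]:
  "tot (op_span U) = tot U" "oact (op_span U) (g, h) = oact U (h, g)" "str (op_span U) u = prod.swap (str U u)"
  by (simp_all add: op_span_def)

lemma op_op_span: "op_span (op_span U) = (U :: ('h, 'y, 'g, 'x, 'u) span)"
  by (cases U) (auto simp: op_span_def)

lemma over_base_op_span:
  assumes A: "finite_gset A" and B: "finite_gset B" and U: "over_base (ext_prod B A) U"
  shows "over_base (ext_prod A B) (op_span U)"
proof -
  note ud = over_baseD[OF U] and ad = finite_gsetD[OF A] and bd = finite_gsetD[OF B]
  have u: "group_action (grp B \<times>\<times> grp A) (tot U) (oact U)"
    using U by (simp add: over_base_def ext_prod_def)
  have "group_action (grp A \<times>\<times> grp B) (tot U) (oact (op_span U))"
  proof (rule group_actionI)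
    fix g assume "g \<in> carrier (grp A \<times>\<times> grp B)"
    then show "oact (op_span U) g \<in> extensional (tot U)"
      using group_actionD(2)[OF u, of "prod.swap g"] by (cases g) (simp add: op_span_def)
  qed (auto intro: DirProd_group ad bd simp: ud)
  moreover have "prod.swap (str U (oact U (h, g) u)) = act (ext_prod A B) (g, h) (prod.swap (str U u))"
    if "h \<in> carrier (grp B)" "g \<in> carrier (grp A)" "u \<in> tot U" for h g u
    using that by (intro prod_eqI) (auto simp: ud ext_prod_def mem_Times_iff split: prod.splits)
  moreover have "prod.swap (str U u) \<in> pts A \<times> pts B" if "u \<in> tot U" for u
    using that by (simp add: ud mem_Times_iff)
  ultimately show ?thesis unfolding over_base_def
    by (auto simp: ext_prod_def ud(8))
qed

text \<open>A principal bundle on both sides: the leg to \<open>pts B\<close> is the quotient by a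
  free action of \<open>grp A\<close>, the leg to \<open>pts A\<close> the quotient by a free action
  of \<open>grp B\<close>. This is a Morita equivalence of the two action groupoids.\<close>

definition biprincipal :: "('h, 'y) gset \<Rightarrow> ('g, 'x) gset \<Rightarrow> ('h, 'y, 'g, 'x, 'u) span \<Rightarrow> bool" where
  "biprincipal B A U \<longleftrightarrow> over_base (ext_prod B A) U \<and>
     (\<forall>u \<in> tot U. \<forall>g \<in> carrier (grp A). oact U (\<one>\<^bsub>grp B\<^esub>, g) u = u \<longrightarrow> g = \<one>\<^bsub>grp A\<^esub>) \<and>
     (\<forall>u \<in> tot U. \<forall>h \<in> carrier (grp B). oact U (h, \<one>\<^bsub>grp A\<^esub>) u = u \<longrightarrow> h = \<one>\<^bsub>grp B\<^esub>) \<and>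
     (\<forall>u \<in> tot U. \<forall>u' \<in> tot U. fst (str U u) = fst (str U u') \<longrightarrow>
        (\<exists>g \<in> carrier (grp A). u' = oact U (\<one>\<^bsub>grp B\<^esub>, g) u)) \<and>
     (\<forall>u \<in> tot U. \<forall>u' \<in> tot U. snd (str U u) = snd (str U u') \<longrightarrow>
        (\<exists>h \<in> carrier (grp B). u' = oact U (h, \<one>\<^bsub>grp A\<^esub>) u)) \<and>
     pts B \<subseteq> (\<lambda>u. fst (str U u)) ` tot U \<and> pts A \<subseteq> (\<lambda>u. snd (str U u)) ` tot U"

lemma biprincipal_op_span:
  assumes A: "finite_gset A" and B: "finite_gset B" and U: "biprincipal B A U"
  shows "biprincipal A B (op_span U)"
proof -
  have "over_base (ext_prod B A) U" using U by (simp add: biprincipal_def)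
  from over_base_op_span[OF A B this] show ?thesis using U unfolding biprincipal_def by auto
qed

text \<open>A matched pair (v, u) lies over one point of \<open>pts B\<close>, so v = g u for a
  unique g. The orbit [v, u] then corresponds to g together with the image of v in
  \<open>pts A\<close>; the balancing action of \<open>grp B\<close> changes neither.\<close>

lemma biprincipal_comp:
  assumes A: "finite_gset A" and B: "finite_gset B" and bi: "biprincipal B A U"
  shows "over_iso (ext_prod A A) (span_comp A B A (op_span U) U) (id_span A)"
proof -
  have U: "over_base (ext_prod B A) U" using bi by (simp add: biprincipal_def)
  have free: "\<forall>u \<in> tot U. \<forall>g \<in> carrier (grp A). oact U (\<one>\<^bsub>grp B\<^esub>, g) u = u \<longrightarrow> g = \<one>\<^bsub>grp A\<^esub>"
    and transA: "\<forall>u \<in> tot U. \<forall>u' \<in> tot U. fst (str U u) = fst (str U u') \<longrightarrow>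
      (\<exists>g \<in> carrier (grp A). u' = oact U (\<one>\<^bsub>grp B\<^esub>, g) u)"
    and transB: "\<forall>u \<in> tot U. \<forall>u' \<in> tot U. snd (str U u) = snd (str U u') \<longrightarrow>
      (\<exists>h \<in> carrier (grp B). u' = oact U (h, \<one>\<^bsub>grp A\<^esub>) u)"
    and surj: "pts A \<subseteq> (\<lambda>u. snd (str U u)) ` tot U"
    using bi unfolding biprincipal_def by - (elim conjE, assumption)+
  note free = free[rule_format] and transA = transA[rule_format] and transB = transB[rule_format]
  note ad = finite_gsetD[OF A] and bd = finite_gsetD[OF B] and ud = over_baseD[OF U]
  interpret A: group "grp A" by (rule ad)
  interpret B: group "grp B" by (rule bd)
  \<comment> \<open>The division map of the principal bundle under \<open>grp A\<close>.\<close>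
  define q where "q v u = (THE g. g \<in> carrier (grp A) \<and> v = oact U (\<one>\<^bsub>grp B\<^esub>, g) u)" for v u
  have q_eq: "q (oact U (\<one>\<^bsub>grp B\<^esub>, g) u) u = g" if u: "u \<in> tot U" and g: "g \<in> carrier (grp A)" for u g
    unfolding q_def
  proof (rule the_equality)
    fix g' assume "g' \<in> carrier (grp A) \<and> oact U (\<one>\<^bsub>grp B\<^esub>, g) u = oact U (\<one>\<^bsub>grp B\<^esub>, g') u"
    then have g': "g' \<in> carrier (grp A)" and e: "oact U (\<one>\<^bsub>grp B\<^esub>, g) u = oact U (\<one>\<^bsub>grp B\<^esub>, g') u"
      by blast+
    have "oact U (\<one>\<^bsub>grp B\<^esub>, inv\<^bsub>grp A\<^esub> g) (oact U (\<one>\<^bsub>grp B\<^esub>, g) u) =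
        oact U (\<one>\<^bsub>grp B\<^esub>, inv\<^bsub>grp A\<^esub> g) (oact U (\<one>\<^bsub>grp B\<^esub>, g') u)" by (simp only: e)
    then have "oact U (\<one>\<^bsub>grp B\<^esub>, inv\<^bsub>grp A\<^esub> g \<otimes>\<^bsub>grp A\<^esub> g') u = u" using u g g' by (simp add: ud)
    then have "inv\<^bsub>grp A\<^esub> g \<otimes>\<^bsub>grp A\<^esub> g' = \<one>\<^bsub>grp A\<^esub>" using free u g g' by simp
    then have "g \<otimes>\<^bsub>grp A\<^esub> (inv\<^bsub>grp A\<^esub> g \<otimes>\<^bsub>grp A\<^esub> g') = g" using g by simp
    then show "g' = g" using g g' by (simp flip: A.m_assoc)
  qed (use g in simp)
  have E: "\<exists>g \<in> carrier (grp A). v = oact U (\<one>\<^bsub>grp B\<^esub>, g) u \<and> u \<in> tot U \<and> q v u = g"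
    if "matched (op_span U) U v u" for v u
    using that transA[of u v] q_eq unfolding matched_def by auto
  have m: "matched (op_span U) U (oact U (\<one>\<^bsub>grp B\<^esub>, g) u) u" if "u \<in> tot U" "g \<in> carrier (grp A)" for u g
    using that by (simp add: matched_def ud bd)
  have i: "oact (id_span A) (a, b) (g, x) = (a \<otimes>\<^bsub>grp A\<^esub> g \<otimes>\<^bsub>grp A\<^esub> inv\<^bsub>grp A\<^esub> b, act A a x)"
      "str (id_span A) (g, x) = (x, act A (inv\<^bsub>grp A\<^esub> g) x)"
    if "g \<in> carrier (grp A)" "x \<in> pts A" for a b g x
    using that by (auto simp: id_span_def)
  let ?F = "\<lambda>v u. (q v u, snd (str U v))"
  show ?thesis
  proof (rule span_comp_isoI[OF A B A U over_base_op_span[OF A B U], where F = ?F], goal_cases)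
    case (1 v u)
    then obtain g where "g \<in> carrier (grp A)" "v = oact U (\<one>\<^bsub>grp B\<^esub>, g) u" "u \<in> tot U" "q v u = g"
      using E by blast
    then show ?case by (simp add: id_span_def ud ad)
  next
    case (2 v u h)
    then obtain g where g: "g \<in> carrier (grp A)" "v = oact U (\<one>\<^bsub>grp B\<^esub>, g) u" "u \<in> tot U" "q v u = g"
      using E by blast
    have e: "oact U (h, \<one>\<^bsub>grp A\<^esub>) v = oact U (\<one>\<^bsub>grp B\<^esub>, g) (oact U (h, \<one>\<^bsub>grp A\<^esub>) u)"
      using g 2(2) by (simp add: ud)
    have "q (oact U (h, \<one>\<^bsub>grp A\<^esub>) v) (oact U (h, \<one>\<^bsub>grp A\<^esub>) u) = g"
      unfolding e using g 2(2) by (intro q_eq) (auto simp: ud)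
    moreover have "snd (str U (oact U (h, \<one>\<^bsub>grp A\<^esub>) v)) = snd (str U v)"
      using matchedD(1)[OF 2(1)] 2(2) by (simp add: ud ad)
    ultimately show ?case using g(4) by simp
  next
    case (3 v u v' u')
    obtain g where g: "g \<in> carrier (grp A)" "v = oact U (\<one>\<^bsub>grp B\<^esub>, g) u" "u \<in> tot U" "q v u = g"
      using E[OF 3(1)] by blast
    obtain g' where g': "g' \<in> carrier (grp A)" "v' = oact U (\<one>\<^bsub>grp B\<^esub>, g') u'" "u' \<in> tot U" "q v' u' = g'"
      using E[OF 3(2)] by blast
    have gg: "g' = g" using 3(3) g(4) g'(4) by simp
    \<comment> \<open>Since v and v' have the same image in \<open>pts A\<close>, they differ by
      some h of \<open>grp B\<close>; the common quotient g carries h over to u and u'.\<close>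
    obtain h where h: "h \<in> carrier (grp B)" "v' = oact U (h, \<one>\<^bsub>grp A\<^esub>) v"
      using transB[of v v'] 3 by (auto simp: matched_def)
    have "u' = oact U (\<one>\<^bsub>grp B\<^esub>, inv\<^bsub>grp A\<^esub> g) v'" using g(1) g'(2,3) by (simp add: gg ud)
    also have "\<dots> = oact U (h, \<one>\<^bsub>grp A\<^esub>) u" unfolding h(2) g(2) using g(1,3) h(1) by (simp add: ud)
    finally show ?case using h by auto
  next
    case (4 t)
    then obtain g x where t: "t = (g, x)" "g \<in> carrier (grp A)" "x \<in> pts A" by (auto simp: id_span_def)
    obtain v where v: "v \<in> tot U" "snd (str U v) = x" using subsetD[OF surj t(3)] by auto
    \<comment> \<open>Any v over x will do, and u is then forced to be g^-1 v.\<close>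
    let ?u = "oact U (\<one>\<^bsub>grp B\<^esub>, inv\<^bsub>grp A\<^esub> g) v"
    have u: "?u \<in> tot U" "v = oact U (\<one>\<^bsub>grp B\<^esub>, g) ?u" using v t by (simp_all add: ud)
    have "matched (op_span U) U v ?u" using m[OF u(1) t(2)] u(2) by simp
    moreover have "q v ?u = g" using q_eq[OF u(1) t(2)] u(2) by simp
    ultimately show ?case using v t(1) by blast
  next
    case (5 v u k a)
    then obtain g where g: "g \<in> carrier (grp A)" "v = oact U (\<one>\<^bsub>grp B\<^esub>, g) u" "u \<in> tot U" "q v u = g"
      using E by blast
    have e: "oact U (\<one>\<^bsub>grp B\<^esub>, k) v = oact U (\<one>\<^bsub>grp B\<^esub>, k \<otimes>\<^bsub>grp A\<^esub> g \<otimes>\<^bsub>grp A\<^esub> inv\<^bsub>grp A\<^esub> a) (oact U (\<one>\<^bsub>grp B\<^esub>, a) u)"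
      using g 5(2,3) by (simp add: ud A.m_assoc)
    have "q (oact U (\<one>\<^bsub>grp B\<^esub>, k) v) (oact U (\<one>\<^bsub>grp B\<^esub>, a) u) = k \<otimes>\<^bsub>grp A\<^esub> g \<otimes>\<^bsub>grp A\<^esub> inv\<^bsub>grp A\<^esub> a"
      unfolding e using g 5(2,3) by (intro q_eq) (auto simp: ud)
    then show ?case using g matchedD(1)[OF 5(1)] 5(2,3) by (simp add: i ud ad)
  next
    case (6 v u)
    then obtain g where g: "g \<in> carrier (grp A)" "v = oact U (\<one>\<^bsub>grp B\<^esub>, g) u" "u \<in> tot U" "q v u = g"
      using E by blast
    have "act A (inv\<^bsub>grp A\<^esub> g) (act A g (snd (str U u))) = snd (str U u)"
      using g by (simp add: ud ad(5) flip: ad(6))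
    then show ?case using g by (simp add: i ud ad)
  qed
qed

lemma iso_C_biprincipal:
  assumes A: "finite_gset A" and B: "finite_gset B" and bi: "biprincipal B A U"
  shows "iso_C TYPE('r::comm_ring_1) A B"
proof (rule iso_C_spanI[OF A B])
  show U: "over_base (ext_prod B A) U" using bi by (simp add: biprincipal_def)
  show "over_base (ext_prod A B) (op_span U)" by (rule over_base_op_span[OF A B U])
  show "over_iso (ext_prod A A) (span_comp A B A (op_span U) U) (id_span A)"
    by (rule biprincipal_comp[OF A B bi])
  show "over_iso (ext_prod B B) (span_comp B A B U (op_span U)) (id_span B)"
    \<comment> \<open>The second composite is the first one for the opposite span, whose own
      opposite is \<open>U\<close> again.\<close>
    using biprincipal_comp[OF B A biprincipal_op_span[OF A B bi]] by (simp add: op_op_span)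
qed

text \<open>The disjoint union over \<open>i\<close> of the coset spaces \<open>((\<Prod>j. S\<^sub>j) \<times> G) / S\<^sub>i\<close>, \<open>S\<^sub>i\<close> embedded diagonally;
  each coset has a unique representative whose coordinate in \<open>S\<^sub>i\<close> is \<open>1\<close>.\<close>

definition orbit_span ::
  "('g, 'x) gset \<Rightarrow> 'i set \<Rightarrow> ('i \<Rightarrow> 'x) \<Rightarrow> ('i \<Rightarrow> 'g monoid) \<Rightarrow>
   ('i \<Rightarrow> 'g, 'i \<times> unit \<times> ('i \<Rightarrow> 'g), 'g, 'x, 'i \<times> 'g \<times> ('i \<Rightarrow> 'g)) span" where
  "orbit_span A I x S =
     (let T = (SIGMA i:I. carrier (grp A) \<times> (\<Pi>\<^sub>E j \<in> I - {i}. carrier (S j))) in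
      \<lparr>tot = T,
       oact = (\<lambda>(s, a). \<lambda>(i, g, f) \<in> T.
         (i, a \<otimes>\<^bsub>grp A\<^esub> g \<otimes>\<^bsub>grp A\<^esub> inv\<^bsub>grp A\<^esub> (s i), \<lambda>j \<in> I - {i}. s j \<otimes>\<^bsub>grp A\<^esub> f j)),
       str = (\<lambda>(i, g, f). ((i, (), f), act A g (x i)))\<rparr>)"

text \<open>The span \<open>orbit_span\<close> is biprincipal. Its leg to the direct sum forgets g,
  so the fibres are copies of \<open>grp A\<close> under left multiplication. Its leg to
  \<open>A\<close> sends (i, g, f) to g x i; in a fibre g runs through a coset of the stabilizer of
  x i and f through the other coordinates, which together make up one copy of the product
  group.\<close>

lemma iso_C_dir_sum_stabilizers:
  assumes A: "finite_gset A" and I: "finite I"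
    and x: "\<And>i. i \<in> I \<Longrightarrow> x i \<in> pts A"
    and cover: "\<And>y. y \<in> pts A \<Longrightarrow> \<exists>i \<in> I. \<exists>g \<in> carrier (grp A). y = act A g (x i)"
    and disj: "\<And>i j g. i \<in> I \<Longrightarrow> j \<in> I \<Longrightarrow> g \<in> carrier (grp A) \<Longrightarrow> x j = act A g (x i) \<Longrightarrow> i = j"
    and S: "\<And>i. i \<in> I \<Longrightarrow> S i = (grp A)\<lparr>carrier := stabilizer (grp A) (act A) (x i)\<rparr>"
    and SG: "\<And>i. i \<in> I \<Longrightarrow> group (S i)"
  shows "iso_C TYPE('r::comm_ring_1) A (dir_sum I (\<lambda>i. point (S i)))"
proof -
  note ad = finite_gsetD[OF A]
  interpret A: group "grp A" by (rule ad)
  let ?D = "dir_sum I (\<lambda>i. point (S i))"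
  let ?U = "orbit_span A I x S"
  have carr: "s \<in> carrier (S i) \<longleftrightarrow> s \<in> carrier (grp A) \<and> act A s (x i) = x i" if "i \<in> I" for i s
    using that by (simp add: S stabilizer_def)
  have mult: "s \<otimes>\<^bsub>S i\<^esub> t = s \<otimes>\<^bsub>grp A\<^esub> t" if "i \<in> I" for i s t using S[OF that] by simp
  have one: "\<one>\<^bsub>S i\<^esub> = \<one>\<^bsub>grp A\<^esub>" if "i \<in> I" for i using S[OF that] by simp
  have Sfin: "finite (carrier (S i))" if "i \<in> I" for i
    by (rule finite_subset[OF _ ad(2)]) (use carr[OF that] in blast)
  have D: "finite_gset ?D" by (intro finite_gset_dir_sum I finite_gset_point SG Sfin)
  have gD: "grp ?D = product_group I S" by (simp add: dir_sum_def point_def)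
  have pD: "pts ?D = {(i, u, f). i \<in> I \<and> f \<in> (\<Pi>\<^sub>E j \<in> I - {i}. carrier (S j))}"
    by (auto simp: dir_sum_def dir_sum_pts_def point_def)
  have aD: "act ?D s (i, (), f) = (i, (), \<lambda>j \<in> I - {i}. s j \<otimes>\<^bsub>grp A\<^esub> f j)"
    if "i \<in> I" "f \<in> (\<Pi>\<^sub>E j \<in> I - {i}. carrier (S j))" for s i f
    using that mult by (auto simp: dir_sum_def dir_sum_pts_def point_def intro!: restrict_ext)
  have totU: "(i, g, f) \<in> tot ?U \<longleftrightarrow> i \<in> I \<and> g \<in> carrier (grp A) \<and> f \<in> (\<Pi>\<^sub>E j \<in> I - {i}. carrier (S j))" for i g f
    by (simp add: orbit_span_def Let_def)
  have oU: "oact ?U (s, a) (i, g, f) =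
      (i, a \<otimes>\<^bsub>grp A\<^esub> g \<otimes>\<^bsub>grp A\<^esub> inv\<^bsub>grp A\<^esub> (s i), \<lambda>j \<in> I - {i}. s j \<otimes>\<^bsub>grp A\<^esub> f j)"
    if "(i, g, f) \<in> tot ?U" for s a i g f
    using that by (simp add: orbit_span_def Let_def)
  have sU: "str ?U (i, g, f) = ((i, (), f), act A g (x i))" for i g f
    by (simp add: orbit_span_def Let_def)
  have sm: "s \<otimes>\<^bsub>grp A\<^esub> t \<in> carrier (S j)" if "j \<in> I" "s \<in> carrier (S j)" "t \<in> carrier (S j)" for j s t
    using monoid.m_closed[OF group.is_monoid[OF SG[OF that(1)]] that(2,3)] mult[OF that(1)] by simp
  have si: "inv\<^bsub>grp A\<^esub> s \<in> carrier (S j)" if "j \<in> I" "s \<in> carrier (S j)" for j s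
  proof -
    have s: "s \<in> carrier (grp A)" "act A s (x j) = x j" using that by (simp_all add: carr)
    have "act A (inv\<^bsub>grp A\<^esub> s) (act A s (x j)) = x j" using s(1) x[OF that(1)] by (simp add: ad(5) flip: ad(6))
    then show ?thesis using s that(1) by (simp add: carr)
  qed
  have sA: "s \<in> carrier (grp A)" if "j \<in> I" "s \<in> carrier (S j)" for j s using that by (simp add: carr)
  have cD: "s j \<in> carrier (S j)" if "s \<in> carrier (grp ?D)" "j \<in> I" for s j using that by (auto simp: gD)
  have oU_tot: "oact ?U (s, a) (i, g, f) \<in> tot ?U"
    if "s \<in> carrier (grp ?D)" "a \<in> carrier (grp A)" "(i, g, f) \<in> tot ?U" for s a i g f
    unfolding oU[OF that(3)] totU
    using that cD[OF that(1)] sA si sm by (auto simp: totU PiE_iff)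
  have oneD: "\<one>\<^bsub>grp ?D\<^esub> j = \<one>\<^bsub>grp A\<^esub>" if "j \<in> I" for j using that one by (simp add: gD)
  have multD: "(s \<otimes>\<^bsub>grp ?D\<^esub> t) j = s j \<otimes>\<^bsub>grp A\<^esub> t j" if "j \<in> I" for s t j
    using that mult by (simp add: gD product_group_def)
  have ext: "(\<lambda>j \<in> I - {i}. \<one>\<^bsub>grp ?D\<^esub> j \<otimes>\<^bsub>grp A\<^esub> f j) = f"
    if "i \<in> I" "f \<in> (\<Pi>\<^sub>E j \<in> I - {i}. carrier (S j))" for i f
    by (rule extensionalityI[of _ "I - {i}"]) (use that oneD sA in \<open>auto simp: PiE_iff\<close>)
  have ga: "group_action (grp (ext_prod ?D A)) (tot ?U) (oact ?U)"
  proof (rule group_actionI, goal_cases)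
    case 1
    show ?case by (rule finite_gsetD(1)[OF finite_gset_ext_prod[OF D A]])
  next
    case (2 p)
    then show ?case by (cases p) (simp add: orbit_span_def Let_def)
  next
    case (3 p u)
    then show ?case using oU_tot by (cases p, cases u) (auto simp: ext_prod_def)
  next
    case (4 u)
    obtain i g f where u: "u = (i, g, f)" by (cases u)
    show ?case using 4 unfolding u
      by (simp add: ext_prod_def oU totU oneD ext)
  next
    case (5 p q u)
    obtain s a t b i g f where e: "p = (s, a)" "q = (t, b)" "u = (i, g, f)" by (cases p, cases q, cases u)
    have c: "s \<in> carrier (grp ?D)" "a \<in> carrier (grp A)" "t \<in> carrier (grp ?D)" "b \<in> carrier (grp A)"
      using 5 by (auto simp: e ext_prod_def)
    have u: "(i, g, f) \<in> tot ?U" using 5 e by simp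
    have iI: "i \<in> I" and g: "g \<in> carrier (grp A)" and f: "f \<in> (\<Pi>\<^sub>E j \<in> I - {i}. carrier (S j))"
      using u by (simp_all add: totU)
    note cs = sA[OF _ cD[OF c(1)]] and ct = sA[OF _ cD[OF c(3)]]
    have "(\<lambda>j \<in> I - {i}. (s \<otimes>\<^bsub>grp ?D\<^esub> t) j \<otimes>\<^bsub>grp A\<^esub> f j) =
        (\<lambda>j \<in> I - {i}. s j \<otimes>\<^bsub>grp A\<^esub> (\<lambda>j \<in> I - {i}. t j \<otimes>\<^bsub>grp A\<^esub> f j) j)"
      using f cs ct sA by (intro restrict_ext) (auto simp: multD A.m_assoc PiE_iff)
    moreover have "a \<otimes>\<^bsub>grp A\<^esub> b \<otimes>\<^bsub>grp A\<^esub> g \<otimes>\<^bsub>grp A\<^esub> inv\<^bsub>grp A\<^esub> ((s \<otimes>\<^bsub>grp ?D\<^esub> t) i) =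
        a \<otimes>\<^bsub>grp A\<^esub> (b \<otimes>\<^bsub>grp A\<^esub> g \<otimes>\<^bsub>grp A\<^esub> inv\<^bsub>grp A\<^esub> (t i)) \<otimes>\<^bsub>grp A\<^esub> inv\<^bsub>grp A\<^esub> (s i)"
      using c g cs[OF iI iI] ct[OF iI iI] iI by (simp add: multD A.m_assoc A.inv_mult_group)
    moreover have "oact ?U p (oact ?U q u) = (i, a \<otimes>\<^bsub>grp A\<^esub> (b \<otimes>\<^bsub>grp A\<^esub> g \<otimes>\<^bsub>grp A\<^esub> inv\<^bsub>grp A\<^esub> (t i)) \<otimes>\<^bsub>grp A\<^esub> inv\<^bsub>grp A\<^esub> (s i),
        \<lambda>j \<in> I - {i}. s j \<otimes>\<^bsub>grp A\<^esub> (\<lambda>j \<in> I - {i}. t j \<otimes>\<^bsub>grp A\<^esub> f j) j)"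
      unfolding e using oU[OF oU_tot[OF c(3,4) u, unfolded oU[OF u]]] by (simp add: oU[OF u])
    moreover have "p \<otimes>\<^bsub>grp (ext_prod ?D A)\<^esub> q = (s \<otimes>\<^bsub>grp ?D\<^esub> t, a \<otimes>\<^bsub>grp A\<^esub> b)"
      by (simp add: e ext_prod_def)
    ultimately show ?case unfolding e(3) by (simp add: oU[OF u])
  qed
  have U: "over_base (ext_prod ?D A) ?U"
    unfolding over_base_def
  proof (intro conjI ga ballI)
    show "finite (tot ?U)"
      unfolding orbit_span_def Let_def using I ad(2) Sfin by (auto intro!: finite_SigmaI finite_PiE)
    show "str ?U \<in> tot ?U \<rightarrow> pts (ext_prod ?D A)"
      using x ad(4) by (auto simp: totU sU ext_prod_def pD)
    fix p u assume p: "p \<in> carrier (grp (ext_prod ?D A))" and u: "u \<in> tot ?U"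
    obtain s a i g f where e: "p = (s, a)" "u = (i, g, f)" by (cases p, cases u)
    have c: "s \<in> carrier (grp ?D)" "a \<in> carrier (grp A)" using p by (auto simp: e ext_prod_def)
    have iI: "i \<in> I" and g: "g \<in> carrier (grp A)" and f: "f \<in> (\<Pi>\<^sub>E j \<in> I - {i}. carrier (S j))"
      using u by (simp_all add: e totU)
    \<comment> \<open>The factor that multiplies g from the right stabilizes x i, so it disappears
      from the leg to \<open>A\<close>.\<close>
    have s: "inv\<^bsub>grp A\<^esub> (s i) \<in> carrier (grp A)" "act A (inv\<^bsub>grp A\<^esub> (s i)) (x i) = x i"
      using si[OF iI cD[OF c(1) iI]] carr[OF iI] by auto
    have "(i, (), f) \<in> pts ?D" using iI f by (simp add: pD)
    then show "str ?U (oact ?U p u) = act (ext_prod ?D A) p (str ?U u)"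
      using u unfolding e using c g s x[OF iI] by (simp add: oU sU ext_prod_def aD[OF iI f] ad)
  qed
  have "biprincipal ?D A ?U"
    unfolding biprincipal_def
  proof (intro conjI U ballI impI)
    fix u a assume u: "u \<in> tot ?U" and a: "a \<in> carrier (grp A)" and fix_u: "oact ?U (\<one>\<^bsub>grp ?D\<^esub>, a) u = u"
    obtain i g f where e: "u = (i, g, f)" by (cases u)
    show "a = \<one>\<^bsub>grp A\<^esub>"
      using fix_u u a unfolding e by (simp add: oU totU oneD)
  next
    fix u s assume u: "u \<in> tot ?U" and s: "s \<in> carrier (grp ?D)" and fix_u: "oact ?U (s, \<one>\<^bsub>grp A\<^esub>) u = u"
    obtain i g f where e: "u = (i, g, f)" by (cases u)
    have iI: "i \<in> I" and g: "g \<in> carrier (grp A)" and f: "f \<in> (\<Pi>\<^sub>E j \<in> I - {i}. carrier (S j))"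
      using u by (simp_all add: e totU)
    \<comment> \<open>Coordinate i of s is detected by g, every other coordinate by f.\<close>
    have "s j = \<one>\<^bsub>grp A\<^esub>" if j: "j \<in> I" for j
    proof (cases "j = i")
      case True
      have "g \<otimes>\<^bsub>grp A\<^esub> inv\<^bsub>grp A\<^esub> (s i) = g" using fix_u u g unfolding e by (simp add: oU)
      then have "inv\<^bsub>grp A\<^esub> (s i) = \<one>\<^bsub>grp A\<^esub>" using g sA[OF iI cD[OF s iI]] by simp
      then show ?thesis using sA[OF iI cD[OF s iI]] True by simp
    next
      case False
      have ff: "(\<lambda>j \<in> I - {i}. s j \<otimes>\<^bsub>grp A\<^esub> f j) = f" using fix_u u unfolding e by (simp add: oU)
      have "s j \<otimes>\<^bsub>grp A\<^esub> f j = f j" using fun_cong[OF ff, of j] False j by simp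
      then show ?thesis using sA[OF j cD[OF s j]] sA[OF j, of "f j"] f j False by (auto simp: PiE_iff)
    qed
    then show "s = \<one>\<^bsub>grp ?D\<^esub>"
      using s one by (intro extensionalityI[of _ I]) (auto simp: gD PiE_iff)
  next
    fix u u' assume u: "u \<in> tot ?U" "u' \<in> tot ?U" and eq: "fst (str ?U u) = fst (str ?U u')"
    obtain i g f g' where e: "u = (i, g, f)" "u' = (i, g', f)"
      using eq by (cases u, cases u') (auto simp: sU)
    have "u' = oact ?U (\<one>\<^bsub>grp ?D\<^esub>, g' \<otimes>\<^bsub>grp A\<^esub> inv\<^bsub>grp A\<^esub> g) u"
      using u unfolding e by (simp add: oU totU oneD ext A.m_assoc)
    moreover have "g' \<otimes>\<^bsub>grp A\<^esub> inv\<^bsub>grp A\<^esub> g \<in> carrier (grp A)" using u unfolding e by (simp add: totU)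
    ultimately show "\<exists>a \<in> carrier (grp A). u' = oact ?U (\<one>\<^bsub>grp ?D\<^esub>, a) u" by blast
  next
    fix u u' assume u: "u \<in> tot ?U" "u' \<in> tot ?U" and eq: "snd (str ?U u) = snd (str ?U u')"
    obtain i g f i' g' f' where e: "u = (i, g, f)" "u' = (i', g', f')" by (cases u, cases u')
    have c: "i \<in> I" "g \<in> carrier (grp A)" "f \<in> (\<Pi>\<^sub>E j \<in> I - {i}. carrier (S j))"
        "i' \<in> I" "g' \<in> carrier (grp A)" "f' \<in> (\<Pi>\<^sub>E j \<in> I - {i'}. carrier (S j))"
      using u by (simp_all add: e totU)
    have "act A g (x i) = act A g' (x i')" using eq by (simp add: e sU)
    then have "act A (inv\<^bsub>grp A\<^esub> g') (act A g (x i)) = act A (inv\<^bsub>grp A\<^esub> g') (act A g' (x i'))" by simp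
    then have gg: "act A (inv\<^bsub>grp A\<^esub> g' \<otimes>\<^bsub>grp A\<^esub> g) (x i) = x i'"
      using c x by (simp add: ad(5) flip: ad(6))
    have ii: "i' = i" using disj[OF c(1,4) _ gg[symmetric]] c by simp
    \<comment> \<open>Coordinate i acts on g by right multiplication with its inverse, so g' = g
      s^-1 determines it, and by \<open>gg\<close> it stabilizes x i. Every other coordinate has to
      take f j to f' j.\<close>
    let ?s = "\<lambda>j \<in> I. if j = i then inv\<^bsub>grp A\<^esub> g' \<otimes>\<^bsub>grp A\<^esub> g else f' j \<otimes>\<^bsub>grp A\<^esub> inv\<^bsub>grp A\<^esub> (f j)"
    have fj: "f j \<in> carrier (S j)" "f' j \<in> carrier (S j)" if "j \<in> I" "j \<noteq> i" for j
      using c(3,6) that by (auto simp: PiE_iff ii)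
    have s: "?s \<in> carrier (grp ?D)"
      using gg c fj sm si by (auto simp: gD ii carr[OF c(1)])
    have "g \<otimes>\<^bsub>grp A\<^esub> inv\<^bsub>grp A\<^esub> (inv\<^bsub>grp A\<^esub> g' \<otimes>\<^bsub>grp A\<^esub> g) = g'"
      using c by (simp add: A.inv_mult_group flip: A.m_assoc)
    moreover have "(\<lambda>j \<in> I - {i}. ?s j \<otimes>\<^bsub>grp A\<^esub> f j) = f'"
    proof (rule extensionalityI[of _ "I - {i}"])
      fix j assume j: "j \<in> I - {i}"
      then show "(\<lambda>j \<in> I - {i}. ?s j \<otimes>\<^bsub>grp A\<^esub> f j) j = f' j"
        using fj[of j] sA[of j] by (simp add: A.m_assoc)
    qed (use c(6) in \<open>auto simp: PiE_iff ii\<close>)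
    ultimately have "u' = oact ?U (?s, \<one>\<^bsub>grp A\<^esub>) u"
      unfolding e oU[OF u(1)[unfolded e]] using c(1,2) ii by simp
    then show "\<exists>s \<in> carrier (grp ?D). u' = oact ?U (s, \<one>\<^bsub>grp A\<^esub>) u" using s by blast
  next
    show "pts ?D \<subseteq> (\<lambda>u. fst (str ?U u)) ` tot ?U"
    proof
      fix y assume "y \<in> pts ?D"
      then obtain i f where "y = (i, (), f)" "i \<in> I" "f \<in> (\<Pi>\<^sub>E j \<in> I - {i}. carrier (S j))"
        by (auto simp: pD)
      then show "y \<in> (\<lambda>u. fst (str ?U u)) ` tot ?U"
        by (intro image_eqI[of _ _ "(i, \<one>\<^bsub>grp A\<^esub>, f)"]) (simp_all add: totU sU)
    qed
    show "pts A \<subseteq> (\<lambda>u. snd (str ?U u)) ` tot ?U"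
    proof
      fix y assume "y \<in> pts A"
      then obtain i g where "i \<in> I" "g \<in> carrier (grp A)" "y = act A g (x i)" using cover by blast
      \<comment> \<open>The leg to \<open>A\<close> does not see f, so identities serve as default
        coordinates.\<close>
      then show "y \<in> (\<lambda>u. snd (str ?U u)) ` tot ?U"
        using one by (intro image_eqI[of _ _ "(i, g, \<lambda>j \<in> I - {i}. \<one>\<^bsub>S j\<^esub>)"])
          (auto simp: totU sU monoid.one_closed group.is_monoid SG)
    qed
  qed
  then show ?thesis by (rule iso_C_biprincipal[OF A D])
qed

lemma subgroup_stabilizer:
  assumes A: "finite_gset A" and y: "y \<in> pts A"
  shows "subgroup (stabilizer (grp A) (act A) y) (grp A)"
  using A y group_action.stabilizer_subgroup[of "grp A" "pts A" "act A" y] by (simp add: finite_gset_def)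

section \<open>Decomposition into orbits\<close>

lemma iso_C_refl:
  assumes "finite_gset A"
  shows "iso_C TYPE('r::comm_ring_1) A A"
  by (rule iso_C_spanI[OF assms assms over_base_id_span[OF assms] over_base_id_span[OF assms]])
    (rule span_comp_id_left[OF assms assms over_base_id_span[OF assms]])+

lemma orbit_eq:
  assumes A: "finite_gset A" and y: "y \<in> pts A" and z: "z \<in> orbit (grp A) (act A) y"
  shows "z \<in> pts A" "orbit (grp A) (act A) z = orbit (grp A) (act A) y"
proof -
  note ad = finite_gsetD[OF A]
  interpret group "grp A" by (rule ad)
  have sub: "orbit (grp A) (act A) z \<subseteq> orbit (grp A) (act A) y"
    if "y \<in> pts A" "z \<in> orbit (grp A) (act A) y" for y z
    using that by (auto simp: orbit_def simp flip: ad(6))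
  obtain g where g: "g \<in> carrier (grp A)" "z = act A g y" using z by (auto simp: orbit_def)
  show zA: "z \<in> pts A" using g y by (simp add: ad)
  have "y = act A (inv\<^bsub>grp A\<^esub> g) z" using g y by (simp add: ad(5) flip: ad(6))
  then have "y \<in> orbit (grp A) (act A) z" using g(1) unfolding orbit_def by blast
  then show "orbit (grp A) (act A) z = orbit (grp A) (act A) y" using sub y z zA by blast
qed

text \<open>The points x i form a transversal of the orbits: surjectivity of \<open>Orb\<close>
  gives the hypothesis \<open>cover\<close> of \<open>iso_C_dir_sum_stabilizers\<close>, injectivity
  gives \<open>disj\<close>.\<close>

lemma iso_C_orbit_decomposition:
  assumes A: "finite_gset A"
    and Orb: "bij_betw Orb {1..n::nat} (orbits (grp A) (pts A) (act A))"
    and x: "\<forall>i \<in> {1..n}. x i \<in> Orb i"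
    and S: "\<forall>i \<in> {1..n}. S i = (grp A)\<lparr>carrier := stabilizer (grp A) (act A) (x i)\<rparr>"
  shows "\<And>i. i \<in> {1..n} \<Longrightarrow> group (S i) \<and> finite (carrier (S i))"
    and "iso_C TYPE('r::comm_ring_1) A (dir_sum {1..n} (\<lambda>i. point (S i)))"
proof -
  note ad = finite_gsetD[OF A]
  interpret group "grp A" by (rule ad)
  have orb: "x i \<in> pts A" "Orb i = orbit (grp A) (act A) (x i)" if "i \<in> {1..n}" for i
  proof -
    have "Orb i \<in> orbits (grp A) (pts A) (act A)" using bij_betwE[OF Orb] \<open>i \<in> {1..n}\<close> by blast
    then obtain y where y: "y \<in> pts A" "Orb i = orbit (grp A) (act A) y" unfolding orbits_def by blast
    have "x i \<in> orbit (grp A) (act A) y" using x \<open>i \<in> {1..n}\<close> y(2) by blast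
    from orbit_eq[OF A y(1) this] show "x i \<in> pts A" "Orb i = orbit (grp A) (act A) (x i)"
      by (simp_all add: y(2))
  qed
  have sub: "subgroup (stabilizer (grp A) (act A) (x i)) (grp A)" if "i \<in> {1..n}" for i
    by (rule subgroup_stabilizer[OF A orb(1)[OF that]])
  show SG: "group (S i) \<and> finite (carrier (S i))" if "i \<in> {1..n}" for i
    using subgroup_imp_group[OF sub[OF that]] S that finite_subset[OF subgroup.subset[OF sub[OF that]] ad(2)]
    by simp
  show "iso_C TYPE('r::comm_ring_1) A (dir_sum {1..n} (\<lambda>i. point (S i)))"
  proof (rule iso_C_dir_sum_stabilizers[OF A, where x = x])
    fix y assume y: "y \<in> pts A"
    then have "orbit (grp A) (act A) y \<in> Orb ` {1..n}"
      using bij_betw_imp_surj_on[OF Orb] by (auto simp: orbits_def)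
    then obtain i where i: "i \<in> {1..n}" "orbit (grp A) (act A) y = Orb i" by blast
    have "y = act A \<one>\<^bsub>grp A\<^esub> y" using y by (simp add: ad)
    then have "y \<in> orbit (grp A) (act A) (x i)"
      using orb(2)[OF i(1)] i(2) one_closed unfolding orbit_def by blast
    then show "\<exists>i \<in> {1..n}. \<exists>g \<in> carrier (grp A). y = act A g (x i)"
      using i(1) unfolding orbit_def by blast
  next
    fix i j g assume ij: "i \<in> {1..n}" "j \<in> {1..n}" and "g \<in> carrier (grp A)" "x j = act A g (x i)"
    then have "x j \<in> orbit (grp A) (act A) (x i)" unfolding orbit_def by blast
    then have "Orb j = Orb i" using orbit_eq(2)[OF A orb(1)[OF ij(1)]] orb(2)[OF ij(1)] orb(2)[OF ij(2)] by simp
    then show "i = j" using bij_betw_imp_inj_on[OF Orb] ij by (metis inj_onD)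
  next
    fix i assume i: "i \<in> {1..n}"
    show "x i \<in> pts A" by (rule orb(1)[OF i])
    show "S i = (grp A)\<lparr>carrier := stabilizer (grp A) (act A) (x i)\<rparr>" using S i by blast
    show "group (S i)" using SG[OF i] by blast
  qed simp
qed

theorem corollary3p8:
  shows
    "(\<forall>(n::nat) (m::nat) (G :: nat \<Rightarrow> 'g monoid) (H :: nat \<Rightarrow> 'h monoid).
        (\<forall>i \<in> {1..n}. group (G i) \<and> finite (carrier (G i))) \<longrightarrow>
        (\<forall>j \<in> {1..m}. group (H j) \<and> finite (carrier (H j))) \<longrightarrow>
        iso_C TYPE('r::comm_ring_1)
          (dir_sum {1..n} (\<lambda>i. point (G i))) (dir_sum {1..m} (\<lambda>j. point (H j))) \<longrightarrow>
        m = n \<and> (\<exists>\<sigma>. \<sigma> permutes {1..n} \<and> (\<forall>i \<in> {1..n}. G i \<cong> H (\<sigma> i))))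
     \<and>
     (\<forall>(A :: ('k, 'x) gset) (n::nat) (Orb :: nat \<Rightarrow> 'x set) (x :: nat \<Rightarrow> 'x) (S :: nat \<Rightarrow> 'k monoid).
        finite_gset A \<longrightarrow>
        bij_betw Orb {1..n} (orbits (grp A) (pts A) (act A)) \<longrightarrow>
        (\<forall>i \<in> {1..n}. x i \<in> Orb i) \<longrightarrow>
        (\<forall>i \<in> {1..n}. S i = (grp A)\<lparr>carrier := stabilizer (grp A) (act A) (x i)\<rparr>) \<longrightarrow>
        iso_C TYPE('r) A (dir_sum {1..n} (\<lambda>i. point (S i))) \<and>
        (\<forall>(m::nat) (H :: nat \<Rightarrow> 'l monoid).
           (\<forall>j \<in> {1..m}. group (H j) \<and> finite (carrier (H j))) \<longrightarrow>
           iso_C TYPE('r) A (dir_sum {1..m} (\<lambda>j. point (H j))) \<longrightarrow>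
           m = n \<and> (\<exists>\<sigma>. \<sigma> permutes {1..n} \<and> (\<forall>i \<in> {1..n}. S i \<cong> H (\<sigma> i)))))"
proof (rule conjI; intro allI impI)
  fix n m :: nat and G :: "nat \<Rightarrow> 'g monoid" and H :: "nat \<Rightarrow> 'h monoid"
  assume G: "\<forall>i \<in> {1..n}. group (G i) \<and> finite (carrier (G i))"
    and H: "\<forall>j \<in> {1..m}. group (H j) \<and> finite (carrier (H j))"
    and iso: "iso_C TYPE('r) (dir_sum {1..n} (\<lambda>i. point (G i))) (dir_sum {1..m} (\<lambda>j. point (H j)))"
  have D: "finite_gset (dir_sum {1..n} (\<lambda>i. point (G i)))"
    using G by (auto intro!: finite_gset_dir_sum finite_gset_point)
  \<comment> \<open>The common object is the first direct sum, compared with itself by the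
    identity.\<close>
  show "m = n \<and> (\<exists>\<sigma>. \<sigma> permutes {1..n} \<and> (\<forall>i \<in> {1..n}. G i \<cong> H (\<sigma> i)))"
    by (rule unique_decomposition[OF G[rule_format] H[rule_format] D iso_C_refl[OF D] iso])
next
  fix A :: "('k, 'x) gset" and n :: nat and Orb :: "nat \<Rightarrow> 'x set" and x :: "nat \<Rightarrow> 'x" and S :: "nat \<Rightarrow> 'k monoid"
  assume A: "finite_gset A" and Orb: "bij_betw Orb {1..n} (orbits (grp A) (pts A) (act A))"
    and x: "\<forall>i \<in> {1..n}. x i \<in> Orb i"
    and S: "\<forall>i \<in> {1..n}. S i = (grp A)\<lparr>carrier := stabilizer (grp A) (act A) (x i)\<rparr>"
  note dec = iso_C_orbit_decomposition[OF A Orb x S]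
  show "iso_C TYPE('r) A (dir_sum {1..n} (\<lambda>i. point (S i))) \<and>
    (\<forall>(m::nat) (H :: nat \<Rightarrow> 'l monoid).
       (\<forall>j \<in> {1..m}. group (H j) \<and> finite (carrier (H j))) \<longrightarrow>
       iso_C TYPE('r) A (dir_sum {1..m} (\<lambda>j. point (H j))) \<longrightarrow>
       m = n \<and> (\<exists>\<sigma>. \<sigma> permutes {1..n} \<and> (\<forall>i \<in> {1..n}. S i \<cong> H (\<sigma> i))))"
  proof (intro conjI dec(2); intro allI impI)
    fix m :: nat and H :: "nat \<Rightarrow> 'l monoid"
    assume H: "\<forall>j \<in> {1..m}. group (H j) \<and> finite (carrier (H j))"
      and iso: "iso_C TYPE('r) A (dir_sum {1..m} (\<lambda>j. point (H j)))"
    \<comment> \<open>Here the common object is \<open>A\<close>, and the existence part supplies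
      its decomposition into stabilizers.\<close>
    show "m = n \<and> (\<exists>\<sigma>. \<sigma> permutes {1..n} \<and> (\<forall>i \<in> {1..n}. S i \<cong> H (\<sigma> i)))"
      by (rule unique_decomposition[OF dec(1) H[rule_format] A dec(2) iso])
  qed
qed

end
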